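(* Let $T$ be a thick positive theory (working in a monster model of $T$). Let $(a_\eta)_{\eta \in \omega^{<\omega}}$ be a tree of tuples all of the same length and let $C$ be any (small) set of parameters. Then there is a tree $(b_\eta)_{\eta \in \omega^{<\omega}}$ that is str-indiscernible over $C$ and $\mathrm{EM}_{\mathrm{str}}$-based on $(a_\eta)_{\eta \in \omega^{<\omega}}$ over $C$.
   Context: Positive logic: a positive formula is built from atomic formulas using $\wedge,\vee,\top,\bot,\exists$; a positive theory is a set of h-inductive sentences $\forall x(\phi(x)\to\psi(x))$ with $\phi,\psi$ positive existential. A model $M$ is existentially closed (e.c.) if whenever $M\not\models\phi(a)$ for positive $\phi$, there is a positive $\psi$ with $T\models\neg\exists x(\phi(x)\wedge\psi(x))$ and $M\models\psi(a)$. One works in a monster model: an e.c. model that is very homogeneous and very saturated (for small sets). All formulas in the monster are positive; $\mathrm{tp}(a/C)$ is the set of positive formulas over $C$ satisfied by $a$, and $a\equiv_C b$ means $\mathrm{tp}(a/C)=\mathrm{tp}(b/C)$. A sequence $(a_i)_{i\in I}$ ($I$ a linear order) is $C$-indiscernible if $a_{i_1}\dots a_{i_n}\equiv_C a_{j_1}\dots a_{j_n}$ whenever $i_1<\dots<i_n$ and $j_1<\dots<j_n$. $T$ is thick if being an indiscernible sequence is type-definable: there is a partial type $\Theta((x_i)_{i<\omega})$ with $\models\Theta((a_i)_{i<\omega})$ iff $(a_i)_{i<\omega}$ is an indiscernible sequence. Trees: $\omega^{<\omega}$ is the set of finite sequences of natural numbers, with $\eta\unlhd\nu$ iff $\nu$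 extends $\eta$; $\eta\wedge\nu$ is the longest common initial segment; $\eta<_{\mathrm{lex}}\nu$ iff $\eta\lhd\nu$, or $\eta,\nu$ are $\unlhd$-incomparable and $\eta(\gamma)<\nu(\gamma)$ at the least $\gamma$ where they differ; $\eta<_{\mathrm{len}}\nu$ iff the length of $\eta$ is less than that of $\nu$. The strong Shelah language is $\mathcal{L}_{\mathrm{str}}=\{\unlhd,\wedge,<_{\mathrm{lex}},<_{\mathrm{len}}\}$. For an index structure $I$ in a language $\mathcal{L}$ and a tuple $\bar\eta=(\eta_1,\dots,\eta_n)$ in $I$, write $a_{\bar\eta}=(a_{\eta_1},\dots,a_{\eta_n})$ and $\mathrm{qftp}_{\mathcal{L}}(\bar\eta)$ for its quantifier-free $\mathcal{L}$-type (in the full first-order sense, negations allowed). $(a_i)_{i\in I}$ is $I$-indiscernible over $C$ if $\mathrm{qftp}_{\mathcal{L}}(\bar\eta)=\mathrm{qftp}_{\mathcal{L}}(\bar\nu)$ implies $a_{\bar\eta}\equiv_C a_{\bar\nu}$ for all finite tuples; with $I=\omega^{<\omega}$ as an $\mathcal{L}_{\mathrm{str}}$-structure this is called str-indiscernible. The $\mathrm{EM}_{\mathcal{L}}$-type $\mathrm{EM}_{\mathcal{L}}((a_i)_{i\in I}/C)$ is the set of positive formulas $\phi(x_{\bar\eta})$ over $C$ (for finite $\bar\eta$ in $I$) such that $\models\phi(a_{\bar\nu})$ for all $\bar\nu$ in $I$ with $\mathrm{qftp}_{\mathcal{L}}(\bar\nu)=\mathrm{qftp}_{\mathcal{L}}(\bar\eta)$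 (this qf type is the associated qf type). $(b_i)_{i\in I'}$ is $\mathrm{EM}_{\mathcal{L}}$-based on $(a_i)_{i\in I}$ over $C$ if for every $\phi\in\mathrm{EM}_{\mathcal{L}}((a_i)_{i\in I}/C)$ with associated qf type $\Delta$ and every tuple $\bar\eta$ in $I'$ realising $\Delta$ we have $\models\phi(b_{\bar\eta})$. $\mathrm{EM}_{\mathrm{str}}$-based means $\mathrm{EM}_{\mathcal{L}_{\mathrm{str}}}$-based. *)

theory Defs
  imports "HOL-Library.Equipollence" "HOL-Library.Sublist"
begin

section \<open>Languages, structures, terms and formulas\<close>

record ('f, 'r) lang =
  fun_syms :: "'f set"
  rel_syms :: "'r set"
  fun_arity :: "'f \<Rightarrow> nat"
  rel_arity :: "'r \<Rightarrow> nat"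

record ('a, 'f, 'r) struc =
  carrier :: "'a set"
  func :: "'f \<Rightarrow> 'a list \<Rightarrow> 'a"
  rel :: "'r \<Rightarrow> 'a list \<Rightarrow> bool"

text \<open>The interpretations \<open>func\<close> and \<open>rel\<close> only matter on symbols of the language and on
  lists of elements of the carrier of the correct length.\<close>

definition wf_struc :: "('f, 'r) lang \<Rightarrow> ('a, 'f, 'r) struc \<Rightarrow> bool" where
  "wf_struc L M \<longleftrightarrow> carrier M \<noteq> {} \<and>
     (\<forall>f \<in> fun_syms L. \<forall>xs \<in> lists (carrier M).
        length xs = fun_arity L f \<longrightarrow> func M f xs \<in> carrier M)"

datatype 'f tm = Var nat | Fn 'f "'f tm list"

datatype ('f, 'r) atom = Equal "'f tm" "'f tm" | Rel 'r "'f tm list"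

datatype ('f, 'r) pform =
    Atom "('f, 'r) atom" | Top | Bot
  | And "('f, 'r) pform" "('f, 'r) pform"
  | Or "('f, 'r) pform" "('f, 'r) pform"
  | Ex nat "('f, 'r) pform"

datatype ('f, 'r) qform =
    QAtom "('f, 'r) atom" | QTop
  | QNot "('f, 'r) qform"
  | QAnd "('f, 'r) qform" "('f, 'r) qform"

fun wf_tm :: "('f, 'r) lang \<Rightarrow> 'f tm \<Rightarrow> bool" where
  "wf_tm L (Var n) = True"
| "wf_tm L (Fn f ts) = (f \<in> fun_syms L \<and> length ts = fun_arity L f \<and> (\<forall>t \<in> set ts. wf_tm L t))"

fun wf_atom :: "('f, 'r) lang \<Rightarrow> ('f, 'r) atom \<Rightarrow> bool" where
  "wf_atom L (Equal t u) = (wf_tm L t \<and> wf_tm L u)"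
| "wf_atom L (Rel r ts) = (r \<in> rel_syms L \<and> length ts = rel_arity L r \<and> (\<forall>t \<in> set ts. wf_tm L t))"

fun wf_pform :: "('f, 'r) lang \<Rightarrow> ('f, 'r) pform \<Rightarrow> bool" where
  "wf_pform L (Atom A) = wf_atom L A"
| "wf_pform L Top = True"
| "wf_pform L Bot = True"
| "wf_pform L (And \<phi> \<psi>) = (wf_pform L \<phi> \<and> wf_pform L \<psi>)"
| "wf_pform L (Or \<phi> \<psi>) = (wf_pform L \<phi> \<and> wf_pform L \<psi>)"
| "wf_pform L (Ex n \<phi>) = wf_pform L \<phi>"

fun wf_qform :: "('f, 'r) lang \<Rightarrow> ('f, 'r) qform \<Rightarrow> bool" where
  "wf_qform L (QAtom A) = wf_atom L A"
| "wf_qform L QTop = True"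
| "wf_qform L (QNot \<chi>) = wf_qform L \<chi>"
| "wf_qform L (QAnd \<chi> \<xi>) = (wf_qform L \<chi> \<and> wf_qform L \<xi>)"

fun vars_tm :: "'f tm \<Rightarrow> nat set" where
  "vars_tm (Var n) = {n}"
| "vars_tm (Fn f ts) = (\<Union>t \<in> set ts. vars_tm t)"

fun vars_atom :: "('f, 'r) atom \<Rightarrow> nat set" where
  "vars_atom (Equal t u) = vars_tm t \<union> vars_tm u"
| "vars_atom (Rel r ts) = (\<Union>t \<in> set ts. vars_tm t)"

fun fv :: "('f, 'r) pform \<Rightarrow> nat set" where
  "fv (Atom A) = vars_atom A"
| "fv Top = {}"
| "fv Bot = {}"
| "fv (And \<phi> \<psi>) = fv \<phi> \<union> fv \<psi>"
| "fv (Or \<phi> \<psi>) = fv \<phi> \<union> fv \<psi>"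
| "fv (Ex n \<phi>) = fv \<phi> - {n}"

fun vars_qform :: "('f, 'r) qform \<Rightarrow> nat set" where
  "vars_qform (QAtom A) = vars_atom A"
| "vars_qform QTop = {}"
| "vars_qform (QNot \<chi>) = vars_qform \<chi>"
| "vars_qform (QAnd \<chi> \<xi>) = vars_qform \<chi> \<union> vars_qform \<xi>"

fun val :: "('a, 'f, 'r) struc \<Rightarrow> (nat \<Rightarrow> 'a) \<Rightarrow> 'f tm \<Rightarrow> 'a" where
  "val M e (Var n) = e n"
| "val M e (Fn f ts) = func M f (map (val M e) ts)"

fun sat_atom :: "('a, 'f, 'r) struc \<Rightarrow> (nat \<Rightarrow> 'a) \<Rightarrow> ('f, 'r) atom \<Rightarrow> bool" where
  "sat_atom M e (Equal t u) = (val M e t = val M e u)"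
| "sat_atom M e (Rel r ts) = rel M r (map (val M e) ts)"

fun sat :: "('a, 'f, 'r) struc \<Rightarrow> (nat \<Rightarrow> 'a) \<Rightarrow> ('f, 'r) pform \<Rightarrow> bool" where
  "sat M e (Atom A) = sat_atom M e A"
| "sat M e Top = True"
| "sat M e Bot = False"
| "sat M e (And \<phi> \<psi>) = (sat M e \<phi> \<and> sat M e \<psi>)"
| "sat M e (Or \<phi> \<psi>) = (sat M e \<phi> \<or> sat M e \<psi>)"
| "sat M e (Ex n \<phi>) = (\<exists>x \<in> carrier M. sat M (e(n := x)) \<phi>)"

fun sat_q :: "('a, 'f, 'r) struc \<Rightarrow> (nat \<Rightarrow> 'a) \<Rightarrow> ('f, 'r) qform \<Rightarrow> bool" where
  "sat_q M e (QAtom A) = sat_atom M e A"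
| "sat_q M e QTop = True"
| "sat_q M e (QNot \<chi>) = (\<not> sat_q M e \<chi>)"
| "sat_q M e (QAnd \<chi> \<xi>) = (sat_q M e \<chi> \<and> sat_q M e \<xi>)"


section \<open>Positive theories and existentially closed models\<close>

text \<open>A pair \<open>(\<phi>, \<psi>)\<close> stands for the h-inductive sentence \<open>\<forall>x (\<phi>(x) \<longrightarrow> \<psi>(x))\<close>, where \<open>x\<close> lists all
  the free variables.\<close>

type_synonym ('f, 'r) hsent = "('f, 'r) pform \<times> ('f, 'r) pform"

definition positive_theory :: "('f, 'r) lang \<Rightarrow> ('f, 'r) hsent set \<Rightarrow> bool" where
  "positive_theory L T \<longleftrightarrow> (\<forall>(\<phi>, \<psi>) \<in> T. wf_pform L \<phi> \<and> wf_pform L \<psi>)"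

definition model :: "('f, 'r) lang \<Rightarrow> ('f, 'r) hsent set \<Rightarrow> ('a, 'f, 'r) struc \<Rightarrow> bool" where
  "model L T M \<longleftrightarrow> wf_struc L M \<and>
     (\<forall>(\<phi>, \<psi>) \<in> T. \<forall>e. range e \<subseteq> carrier M \<longrightarrow> sat M e \<phi> \<longrightarrow> sat M e \<psi>)"

text \<open>\<open>contradictory L T \<phi> \<psi>\<close> says that \<open>T \<Turnstile> \<not>\<exists>x (\<phi>(x) \<and> \<psi>(x))\<close>. One cannot quantify over models in
  all types, so the models range over all structures whose carrier is a set of formulas. As there
  are at least \<open>|L| + \<aleph>\<^sub>0\<close> formulas, this is no restriction by the downward Loewenheim-Skolem theorem; see
  \<open>contradictory_all_models\<close> below.\<close>

definition contradictory ::
    "('f, 'r) lang \<Rightarrow> ('f, 'r) hsent set \<Rightarrow> ('f, 'r) pform \<Rightarrow> ('f, 'r) pform \<Rightarrow> bool" where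
  "contradictory L T \<phi> \<psi> \<longleftrightarrow>
     (\<forall>N :: (('f, 'r) pform, 'f, 'r) struc. model L T N \<longrightarrow>
        \<not> (\<exists>e. range e \<subseteq> carrier N \<and> sat N e \<phi> \<and> sat N e \<psi>))"

definition ec_model :: "('f, 'r) lang \<Rightarrow> ('f, 'r) hsent set \<Rightarrow> ('a, 'f, 'r) struc \<Rightarrow> bool" where
  "ec_model L T M \<longleftrightarrow> model L T M \<and>
     (\<forall>\<phi> e. wf_pform L \<phi> \<and> range e \<subseteq> carrier M \<and> \<not> sat M e \<phi> \<longrightarrow>
        (\<exists>\<psi>. wf_pform L \<psi> \<and> contradictory L T \<phi> \<psi> \<and> sat M e \<psi>))"


section \<open>Formulas with parameters, and types\<close>

text \<open>A positive formula over \<open>C\<close> in variables from \<open>X\<close> is a pair \<open>(\<phi>, s)\<close>, where \<open>s\<close> replaces each free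
  variable of \<open>\<phi>\<close> by a variable from \<open>X\<close> (tagged \<open>Inl\<close>) or by a parameter from \<open>C\<close> (tagged \<open>Inr\<close>).
  Tuples of length \<open>J\<close> are functions, considered on the index set \<open>J\<close> only.\<close>

type_synonym ('f, 'r, 'x, 'a) cform = "('f, 'r) pform \<times> (nat \<Rightarrow> 'x + 'a)"

definition cforms :: "('f, 'r) lang \<Rightarrow> 'a set \<Rightarrow> 'x set \<Rightarrow> ('f, 'r, 'x, 'a) cform set" where
  "cforms L C X = {(\<phi>, s). wf_pform L \<phi> \<and> s ` fv \<phi> \<subseteq> X <+> C}"

definition holds :: "('a, 'f, 'r) struc \<Rightarrow> ('x \<Rightarrow> 'a) \<Rightarrow> ('f, 'r, 'x, 'a) cform \<Rightarrow> bool" where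
  "holds M v p \<longleftrightarrow> sat M (case_sum v id \<circ> snd p) (fst p)"

definition tp ::
    "('f, 'r) lang \<Rightarrow> ('a, 'f, 'r) struc \<Rightarrow> 'a set \<Rightarrow> 'x set \<Rightarrow> ('x \<Rightarrow> 'a) \<Rightarrow> ('f, 'r, 'x, 'a) cform set"
  where "tp L M C X a = {p \<in> cforms L C X. holds M a p}"

text \<open>The concatenation of the tuples \<open>a i\<close>, for \<open>i\<close> running through a list of indices.\<close>

definition subtuple :: "('i \<Rightarrow> 'j \<Rightarrow> 'a) \<Rightarrow> 'i list \<Rightarrow> nat \<times> 'j \<Rightarrow> 'a" where
  "subtuple a ks = (\<lambda>(k, j). a (ks ! k) j)"

abbreviation positions :: "'i list \<Rightarrow> 'j set \<Rightarrow> (nat \<times> 'j) set" where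
  "positions ks J \<equiv> {..<length ks} \<times> J"


section \<open>Monster models\<close>

text \<open>The cardinal \<open>\<kappa>\<close> bounding the small sets is represented by a set \<open>K\<close> of this cardinality: a set
  \<open>A\<close> is small if \<open>A \<prec> K\<close>. Every small set is equipollent to a subset of \<open>K\<close>, so that in the
  definitions below it suffices to consider index sets in the type of \<open>K\<close>. That \<open>M\<close> is \<open>very\<close>
  saturated and homogeneous means that \<open>\<kappa>\<close> is an uncountable strong limit, with fewer than \<open>\<kappa>\<close>
  symbols in the language; no inaccessibility is required.\<close>

definition strong_limit :: "'k set \<Rightarrow> bool" where
  "strong_limit K \<longleftrightarrow> (UNIV :: nat set) \<prec> K \<and> (\<forall>A \<subseteq> K. A \<prec> K \<longrightarrow> Pow A \<prec> K)"

definition saturated :: "'k set \<Rightarrow> ('f, 'r) lang \<Rightarrow> ('a, 'f, 'r) struc \<Rightarrow> bool" where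
  "saturated K L M \<longleftrightarrow>
     (\<forall>C (X :: 'k set) \<Sigma>. C \<subseteq> carrier M \<and> C \<prec> K \<and> X \<prec> K \<and> \<Sigma> \<subseteq> cforms L C X \<and>
        (\<forall>\<Sigma>\<^sub>0 \<subseteq> \<Sigma>. finite \<Sigma>\<^sub>0 \<longrightarrow> (\<exists>v. v ` X \<subseteq> carrier M \<and> (\<forall>p \<in> \<Sigma>\<^sub>0. holds M v p))) \<longrightarrow>
        (\<exists>v. v ` X \<subseteq> carrier M \<and> (\<forall>p \<in> \<Sigma>. holds M v p)))"

definition automorphism :: "('f, 'r) lang \<Rightarrow> ('a, 'f, 'r) struc \<Rightarrow> ('a \<Rightarrow> 'a) \<Rightarrow> bool" where
  "automorphism L M g \<longleftrightarrow> bij_betw g (carrier M) (carrier M) \<and>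
     (\<forall>f \<in> fun_syms L. \<forall>xs \<in> lists (carrier M). length xs = fun_arity L f \<longrightarrow>
        g (func M f xs) = func M f (map g xs)) \<and>
     (\<forall>r \<in> rel_syms L. \<forall>xs \<in> lists (carrier M). length xs = rel_arity L r \<longrightarrow>
        (rel M r (map g xs) \<longleftrightarrow> rel M r xs))"

definition homogeneous :: "'k set \<Rightarrow> ('f, 'r) lang \<Rightarrow> ('a, 'f, 'r) struc \<Rightarrow> bool" where
  "homogeneous K L M \<longleftrightarrow>
     (\<forall>(X :: 'k set) a b. X \<prec> K \<and> a ` X \<subseteq> carrier M \<and> b ` X \<subseteq> carrier M \<and>
        tp L M {} X a = tp L M {} X b \<longrightarrow>
        (\<exists>g. automorphism L M g \<and> (\<forall>x \<in> X. g (a x) = b x)))"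

definition monster ::
    "'k set \<Rightarrow> ('f, 'r) lang \<Rightarrow> ('f, 'r) hsent set \<Rightarrow> ('a, 'f, 'r) struc \<Rightarrow> bool" where
  "monster K L T M \<longleftrightarrow>
     strong_limit K \<and> fun_syms L \<prec> K \<and> rel_syms L \<prec> K \<and>
     ec_model L T M \<and> saturated K L M \<and> homogeneous K L M"


section \<open>Indiscernible sequences and thickness\<close>

definition indiscernible_seq ::
    "('f, 'r) lang \<Rightarrow> ('a, 'f, 'r) struc \<Rightarrow> 'a set \<Rightarrow> 'j set \<Rightarrow> ('i :: linorder \<Rightarrow> 'j \<Rightarrow> 'a) \<Rightarrow> bool"
  where
  "indiscernible_seq L M C J a \<longleftrightarrow>
     (\<forall>ks ls. sorted_wrt (<) ks \<and> sorted_wrt (<) ls \<and> length ks = length ls \<longrightarrow>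
        tp L M C (positions ks J) (subtuple a ks) = tp L M C (positions ls J) (subtuple a ls))"

text \<open>\<open>T\<close> enters through its monster model \<open>M\<close>. The sequences consist of tuples of any small length.\<close>

definition thick :: "'k set \<Rightarrow> ('f, 'r) lang \<Rightarrow> ('a, 'f, 'r) struc \<Rightarrow> bool" where
  "thick K L M \<longleftrightarrow>
     (\<forall>J :: 'k set. J \<prec> K \<longrightarrow>
        (\<exists>\<Theta> \<subseteq> cforms L {} ((UNIV :: nat set) \<times> J).
           \<forall>a. (\<forall>i. a i ` J \<subseteq> carrier M) \<longrightarrow>
             ((\<forall>p \<in> \<Theta>. holds M (\<lambda>(i, j). a i j) p) \<longleftrightarrow> indiscernible_seq L M {} J a)))"


section \<open>Generalised indiscernibles\<close>

definition qftp :: "('g, 's) lang \<Rightarrow> ('i, 'g, 's) struc \<Rightarrow> 'i list \<Rightarrow> ('g, 's) qform set" where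
  "qftp L' I \<eta>s = {\<chi>. wf_qform L' \<chi> \<and> vars_qform \<chi> \<subseteq> {..<length \<eta>s} \<and> sat_q I (\<lambda>k. \<eta>s ! k) \<chi>}"

definition indiscernible ::
    "('g, 's) lang \<Rightarrow> ('i, 'g, 's) struc \<Rightarrow> ('f, 'r) lang \<Rightarrow> ('a, 'f, 'r) struc \<Rightarrow> 'a set \<Rightarrow> 'j set \<Rightarrow>
     ('i \<Rightarrow> 'j \<Rightarrow> 'a) \<Rightarrow> bool" where
  "indiscernible L' I L M C J a \<longleftrightarrow>
     (\<forall>\<eta>s \<in> lists (carrier I). \<forall>\<nu>s \<in> lists (carrier I). qftp L' I \<eta>s = qftp L' I \<nu>s \<longrightarrow>
        tp L M C (positions \<eta>s J) (subtuple a \<eta>s) = tp L M C (positions \<nu>s J) (subtuple a \<nu>s))"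

text \<open>An element \<open>(\<Delta>, p)\<close> of the EM-type is a formula \<open>p\<close> together with its associated
  quantifier-free type \<open>\<Delta>\<close>; the variable \<open>(k, j)\<close> of \<open>p\<close> is the \<open>j\<close>-th coordinate of the variable
  attached to the \<open>k\<close>-th entry of the index tuple.\<close>

definition EM_type ::
    "('g, 's) lang \<Rightarrow> ('i, 'g, 's) struc \<Rightarrow> ('f, 'r) lang \<Rightarrow> ('a, 'f, 'r) struc \<Rightarrow> 'a set \<Rightarrow> 'j set \<Rightarrow>
     ('i \<Rightarrow> 'j \<Rightarrow> 'a) \<Rightarrow> (('g, 's) qform set \<times> ('f, 'r, nat \<times> 'j, 'a) cform) set" where
  "EM_type L' I L M C J a =
     {(\<Delta>, p). \<exists>\<eta>s \<in> lists (carrier I). \<Delta> = qftp L' I \<eta>s \<and> p \<in> cforms L C (positions \<eta>s J) \<and>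
        (\<forall>\<nu>s \<in> lists (carrier I). qftp L' I \<nu>s = qftp L' I \<eta>s \<longrightarrow> holds M (subtuple a \<nu>s) p)}"

definition EM_based ::
    "('g, 's) lang \<Rightarrow> ('f, 'r) lang \<Rightarrow> ('a, 'f, 'r) struc \<Rightarrow> 'a set \<Rightarrow> 'j set \<Rightarrow>
     ('i', 'g, 's) struc \<Rightarrow> ('i' \<Rightarrow> 'j \<Rightarrow> 'a) \<Rightarrow> ('i, 'g, 's) struc \<Rightarrow> ('i \<Rightarrow> 'j \<Rightarrow> 'a) \<Rightarrow> bool" where
  "EM_based L' L M C J I' b I a \<longleftrightarrow>
     (\<forall>(\<Delta>, p) \<in> EM_type L' I L M C J a. \<forall>\<eta>s \<in> lists (carrier I').
        qftp L' I' \<eta>s = \<Delta> \<longrightarrow> holds M (subtuple b \<eta>s) p)"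


section \<open>The strong Shelah language on the tree of finite sequences\<close>

datatype str_fun = Meet

datatype str_rel = Prefix | Lex | Len

definition L_str :: "(str_fun, str_rel) lang" where
  "L_str = \<lparr>fun_syms = UNIV, rel_syms = UNIV, fun_arity = (\<lambda>_. 2), rel_arity = (\<lambda>_. 2)\<rparr>"

definition lex_less :: "nat list \<Rightarrow> nat list \<Rightarrow> bool" where
  "lex_less \<eta> \<nu> \<longleftrightarrow> strict_prefix \<eta> \<nu> \<or>
     (\<exists>\<gamma> < min (length \<eta>) (length \<nu>). take \<gamma> \<eta> = take \<gamma> \<nu> \<and> \<eta> ! \<gamma> < \<nu> ! \<gamma>)"

fun str_rel_holds :: "str_rel \<Rightarrow> nat list \<Rightarrow> nat list \<Rightarrow> bool" where
  "str_rel_holds Prefix \<eta> \<nu> = prefix \<eta> \<nu>"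
| "str_rel_holds Lex \<eta> \<nu> = lex_less \<eta> \<nu>"
| "str_rel_holds Len \<eta> \<nu> = (length \<eta> < length \<nu>)"

definition str_tree :: "(nat list, str_fun, str_rel) struc" where
  "str_tree = \<lparr>carrier = UNIV,
     func = (\<lambda>_ xs. longest_common_prefix (xs ! 0) (xs ! 1)),
     rel = (\<lambda>r xs. str_rel_holds r (xs ! 0) (xs ! 1))\<rparr>"

definition str_indiscernible ::
    "('f, 'r) lang \<Rightarrow> ('a, 'f, 'r) struc \<Rightarrow> 'a set \<Rightarrow> 'j set \<Rightarrow> (nat list \<Rightarrow> 'j \<Rightarrow> 'a) \<Rightarrow> bool" where
  "str_indiscernible = indiscernible L_str str_tree"

definition EM_str_based ::
    "('f, 'r) lang \<Rightarrow> ('a, 'f, 'r) struc \<Rightarrow> 'a set \<Rightarrow> 'j set \<Rightarrow>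
     (nat list \<Rightarrow> 'j \<Rightarrow> 'a) \<Rightarrow> (nat list \<Rightarrow> 'j \<Rightarrow> 'a) \<Rightarrow> bool" where
  "EM_str_based L M C J b a = EM_based L_str L M C J str_tree b str_tree a"


section \<open>Downward Loewenheim-Skolem\<close>

lemma finite_vars_tm: "finite (vars_tm t)"
  by (induction t) auto

lemma finite_fv: "finite (fv \<phi>)"
proof (induction \<phi>)
  case (Atom A)
  then show ?case by (cases A) (auto simp: finite_vars_tm)
qed auto

lemma val_cong: "(\<And>n. n \<in> vars_tm t \<Longrightarrow> e n = e' n) \<Longrightarrow> val M e t = val M e' t"
proof (induction t)
  case (Fn f ts)
  then have "map (val M e) ts = map (val M e') ts" by auto
  then show ?case by (simp del: map_eq_conv)
qed auto

lemma sat_atom_cong: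
  assumes "\<And>n. n \<in> vars_atom A \<Longrightarrow> e n = e' n"
  shows "sat_atom M e A = sat_atom M e' A"
proof (cases A)
  case (Equal t u)
  then show ?thesis using assms val_cong[of t e e' M] val_cong[of u e e' M] by auto
next
  case (Rel r ts)
  have "map (val M e) ts = map (val M e') ts"
    using assms Rel by (auto intro!: val_cong)
  then show ?thesis using Rel by (simp del: map_eq_conv)
qed

lemma sat_cong: "(\<And>n. n \<in> fv \<phi> \<Longrightarrow> e n = e' n) \<Longrightarrow> sat M e \<phi> = sat M e' \<phi>"
proof (induction \<phi> arbitrary: e e')
  case (Atom A)
  then show ?case using sat_atom_cong[of A e e' M] by simp
next
  case (And \<phi> \<psi>)
  have "sat M e \<phi> = sat M e' \<phi>" "sat M e \<psi> = sat M e' \<psi>"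
    using And.prems And.IH[of e e'] by simp_all
  then show ?case by simp
next
  case (Or \<phi> \<psi>)
  have "sat M e \<phi> = sat M e' \<phi>" "sat M e \<psi> = sat M e' \<psi>"
    using Or.prems Or.IH[of e e'] by simp_all
  then show ?case by simp
next
  case (Ex n \<phi>)
  have "sat M (e(n := x)) \<phi> = sat M (e'(n := x)) \<phi>" for x
  proof (rule Ex.IH)
    fix k assume "k \<in> fv \<phi>"
    then show "(e(n := x)) k = (e'(n := x)) k" using Ex.prems by simp
  qed
  then show ?case by simp
qed simp_all

definition list_env :: "'b list \<Rightarrow> 'b \<Rightarrow> nat \<Rightarrow> 'b" where
  "list_env l d k = (if k < length l then l ! k else d)"

definition witness ::
    "('b, 'f, 'r) struc \<Rightarrow> 'b \<Rightarrow> ('f, 'r) pform \<Rightarrow> nat \<Rightarrow> 'b list \<Rightarrow> 'b" where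
  "witness N d \<phi> n l =
     (if \<exists>x \<in> carrier N. sat N ((list_env l d)(n := x)) \<phi>
      then SOME x. x \<in> carrier N \<and> sat N ((list_env l d)(n := x)) \<phi> else d)"

text \<open>The Skolem hull of the range of \<open>e\<close>, enumerated by formulas: \<open>And\<close> and \<open>Top\<close> code lists,
  \<open>Ex n Top\<close> codes \<open>e n\<close>, and \<open>Or \<phi> (Ex n l)\<close> codes a witness for \<open>\<exists>x\<^sub>n. \<phi>\<close>.\<close>

fun hull :: "('b, 'f, 'r) struc \<Rightarrow> (nat \<Rightarrow> 'b) \<Rightarrow> ('f, 'r) pform \<Rightarrow> 'b"
  and hull_list :: "('b, 'f, 'r) struc \<Rightarrow> (nat \<Rightarrow> 'b) \<Rightarrow> ('f, 'r) pform \<Rightarrow> 'b list" where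
  "hull N e (Or \<phi> (Ex n l)) = witness N (e 0) \<phi> n (hull_list N e l)"
| "hull N e (Ex n Top) = e n"
| "hull N e c = e 0"
| "hull_list N e (And c l) = hull N e c # hull_list N e l"
| "hull_list N e c = []"

lemma witness_in: "d \<in> carrier N \<Longrightarrow> witness N d \<phi> n l \<in> carrier N"
  unfolding witness_def by (smt (verit, best) someI_ex)

lemma hull_in:
  assumes "range e \<subseteq> carrier N"
  shows "hull N e c \<in> carrier N"
  using assms by (cases "(N, e, c)" rule: hull.cases) (auto intro: witness_in)

lemma hull_list_surj: "set l \<subseteq> range (hull N e) \<Longrightarrow> \<exists>c. hull_list N e c = l"
proof (induction l)
  case Nil
  have "hull_list N e Top = []" by simp
  then show ?case by blast
next
  case (Cons x l)
  then obtain c d where "hull_list N e c = l" "x = hull N e d" by auto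
  then have "hull_list N e (And d c) = x # l" by simp
  then show ?case by blast
qed

lemma hull_base: "e n \<in> range (hull N e)"
  by (metis hull.simps(2) rangeI)

lemma hull_witness:
  assumes e': "range e' \<subseteq> range (hull N e)"
    and ex: "\<exists>x \<in> carrier N. sat N (e'(n := x)) \<phi>"
  shows "\<exists>x \<in> range (hull N e). sat N (e'(n := x)) \<phi>"
proof -
  obtain m where m: "\<And>k. k \<in> fv \<phi> \<Longrightarrow> k < m"
    using finite_fv[of \<phi>] by (meson finite_nat_set_iff_bounded)
  define l where "l = map e' [0..<m]"
  have eq: "sat N (e'(n := x)) \<phi> = sat N ((list_env l (e 0))(n := x)) \<phi>" for x
    using m by (intro sat_cong) (auto simp: list_env_def l_def)
  have "set l \<subseteq> range (hull N e)" using e' by (auto simp: l_def)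
  then obtain c where c: "hull_list N e c = l" using hull_list_surj by blast
  define w where "w = witness N (e 0) \<phi> n l"
  have ex': "\<exists>x. x \<in> carrier N \<and> sat N ((list_env l (e 0))(n := x)) \<phi>"
    using ex unfolding eq by blast
  then have "w = (SOME x. x \<in> carrier N \<and> sat N ((list_env l (e 0))(n := x)) \<phi>)"
    unfolding w_def witness_def by (metis (no_types, lifting))
  then have "sat N ((list_env l (e 0))(n := w)) \<phi>"
    using someI_ex[OF ex'] by blast
  moreover have "w = hull N e (Or \<phi> (Ex n c))" by (simp add: c w_def)
  ultimately show ?thesis using eq by blast
qed

lemma hull_func:
  fixes N :: "('b, 'f, 'r) struc"
  assumes N: "wf_struc L N" and e: "range e \<subseteq> carrier N"
    and xs: "set xs \<subseteq> range (hull N e)" and f: "f \<in> fun_syms L" and len: "length xs = fun_arity L f"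
  shows "func N f xs \<in> range (hull N e)"
proof -
  let ?m = "length xs"
  let ?\<phi> = "Atom (Equal (Var ?m) (Fn f (map Var [0..<?m]))) :: ('f, 'r) pform"
  define e' where "e' = list_env xs (e 0)"
  have "set xs \<subseteq> carrier N" using xs hull_in[OF e] by auto
  then have F: "func N f xs \<in> carrier N" using N f len by (auto simp: wf_struc_def lists_eq_set)
  have "range e' \<subseteq> range (hull N e)"
    using xs hull_base[of e 0 N] by (auto simp: e'_def list_env_def)
  moreover have sat: "sat N (e'(?m := x)) ?\<phi> \<longleftrightarrow> x = func N f xs" for x
  proof -
    have "map (val N (e'(?m := x)) \<circ> Var) [0..<?m] = xs"
      by (rule nth_equalityI) (auto simp: e'_def list_env_def)
    then show ?thesis by simp
  qed
  moreover have "\<exists>x \<in> carrier N. sat N (e'(?m := x)) ?\<phi>" using F sat by blast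
  ultimately obtain x where x: "x \<in> range (hull N e)" "sat N (e'(?m := x)) ?\<phi>"
    using hull_witness[of e' N e ?m ?\<phi>] by metis
  have "x = func N f xs" using x(2) unfolding sat .
  then show ?thesis using x(1) by simp
qed

theorem contradictory_all_models:
  fixes N :: "('b, 'f, 'r) struc"
  assumes "contradictory L T \<phi> \<psi>" and T: "positive_theory L T"
    and wf: "wf_pform L \<phi>" "wf_pform L \<psi>"
    and N: "model L T N" and e: "range e \<subseteq> carrier N"
  shows "\<not> (sat N e \<phi> \<and> sat N e \<psi>)"
proof -
  define h where "h = hull N e"
  define H where "H = range h"
  define g where "g = inv_into UNIV h"
  have hg: "h (g y) = y" if "y \<in> H" for y
    using that by (simp add: g_def H_def f_inv_into_f)
  have H: "H \<subseteq> carrier N" using hull_in[OF e] by (auto simp: H_def h_def)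
  have struc: "wf_struc L N" using N by (simp add: model_def)
  define N' :: "(('f, 'r) pform, 'f, 'r) struc" where
    "N' = \<lparr>carrier = g ` H, func = (\<lambda>f cs. g (func N f (map h cs))),
      rel = (\<lambda>r cs. rel N r (map h cs))\<rparr>"
  have cN': "carrier N' = g ` H" by (simp add: N'_def)
  have h_in: "h c \<in> H" for c by (simp add: H_def)
  have gh: "g (h c) = c" if "c \<in> carrier N'" for c using that hg by (auto simp: cN')
  have fN: "func N f (map h cs) \<in> H" if "f \<in> fun_syms L" "length cs = fun_arity L f" for f cs
    using hull_func[OF struc e, of "map h cs" f] that by (auto simp: H_def h_def)
  have v: "val N' e' t \<in> carrier N' \<and> h (val N' e' t) = val N (h \<circ> e') t"
    if "wf_tm L t" and e': "range e' \<subseteq> carrier N'" for e' t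
    using that(1)
  proof (induction t)
    case (Var n)
    then show ?case using e' by auto
  next
    case (Fn f ts)
    have m: "map (val N (h \<circ> e')) ts = map h (map (val N' e') ts)"
      using Fn by (simp add: o_def)
    have "func N f (map h (map (val N' e') ts)) \<in> H" using Fn by (intro fN) simp_all
    then show ?case unfolding val.simps m by (simp add: N'_def hg)
  qed
  have sat_iff: "sat N' e' \<chi> \<longleftrightarrow> sat N (h \<circ> e') \<chi>"
    if "wf_pform L \<chi>" "range e' \<subseteq> carrier N'" for e' \<chi>
    using that
  proof (induction \<chi> arbitrary: e')
    case (Atom A)
    show ?case
    proof (cases A)
      case (Equal t u)
      have vt: "val N' e' t \<in> carrier N'" "h (val N' e' t) = val N (h \<circ> e') t"
        and vu: "val N' e' u \<in> carrier N'" "h (val N' e' u) = val N (h \<circ> e') u"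
        using Atom Equal v[of t e'] v[of u e'] by auto
      have "val N' e' t = val N' e' u" if "h (val N' e' t) = h (val N' e' u)"
        using arg_cong[OF that, of g] unfolding gh[OF vt(1)] gh[OF vu(1)] .
      then show ?thesis unfolding Equal sat.simps sat_atom.simps vt(2)[symmetric] vu(2)[symmetric]
        by metis
    next
      case (Rel r ts)
      then have m: "map (val N (h \<circ> e')) ts = map h (map (val N' e') ts)"
        using Atom v by auto
      have "rel N' r cs = rel N r (map h cs)" for cs by (simp add: N'_def)
      then show ?thesis unfolding Rel sat.simps sat_atom.simps m by blast
    qed
  next
    case (Ex n \<chi>)
    have upd: "h \<circ> e'(n := c) = (h \<circ> e')(n := h c)" for c by auto
    have IH: "sat N' (e'(n := c)) \<chi> \<longleftrightarrow> sat N ((h \<circ> e')(n := h c)) \<chi>"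
      if "c \<in> carrier N'" for c
    proof -
      have "range (e'(n := c)) \<subseteq> carrier N'" using Ex.prems(2) that by auto
      moreover have "wf_pform L \<chi>" using Ex.prems(1) by simp
      ultimately show ?thesis using Ex.IH[of "e'(n := c)"] unfolding upd by blast
    qed
    have "range (h \<circ> e') \<subseteq> range (hull N e)" by (auto simp: h_def)
    then have "(\<exists>x \<in> carrier N. sat N ((h \<circ> e')(n := x)) \<chi>) \<longleftrightarrow>
        (\<exists>x \<in> H. sat N ((h \<circ> e')(n := x)) \<chi>)"
      using hull_witness[of "h \<circ> e'" N e n \<chi>] H unfolding H_def h_def by blast
    also have "\<dots> \<longleftrightarrow> (\<exists>c \<in> carrier N'. sat N ((h \<circ> e')(n := h c)) \<chi>)"
      by (auto simp: cN' hg)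
    finally show ?case using IH unfolding sat.simps by blast
  qed auto
  have "wf_struc L N'"
    unfolding wf_struc_def using fN h_in by (auto simp: N'_def H_def)
  moreover have "sat N' e' \<beta>" if "(\<alpha>, \<beta>) \<in> T" "range e' \<subseteq> carrier N'" "sat N' e' \<alpha>" for \<alpha> \<beta> e'
  proof -
    have "wf_pform L \<alpha>" "wf_pform L \<beta>" using T that(1) by (auto simp: positive_theory_def)
    moreover have "range (h \<circ> e') \<subseteq> carrier N" using H h_in by auto
    ultimately show ?thesis using that N sat_iff by (fastforce simp: model_def)
  qed
  ultimately have "model L T N'" unfolding model_def by auto
  moreover have eH: "e k \<in> H" for k using hull_base[of e k N] by (simp add: H_def h_def)
  then have r: "range (g \<circ> e) \<subseteq> carrier N'" by (auto simp: cN')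
  moreover have "h \<circ> (g \<circ> e) = e" using hg eH by auto
  ultimately show ?thesis
    using assms(1) sat_iff[OF wf(1) r] sat_iff[OF wf(2) r] unfolding contradictory_def by metis
qed

end

theory Submission
  imports Defs "HOL-Library.Ramsey" "HOL-Library.Countable_Set"
begin

text \<open>Consider the sets of formulas in variables indexed by a linear order which some family satisfies
  together with all its increasing reindexings. A maximal such set is complete: realize it along a
  long linear order, colour the increasing \<open>n\<close>-tuples by a formula \<open>\<phi>\<close> or by formulas contradicting it,
  and use the Erdos-Rado theorem for the fixed exponent \<open>n\<close> to add one of them. This replaces the
  usual argument with types in all arities at once, so that a strong limit \<open>\<kappa>\<close> suffices.

  The principle is applied twice. Applied to the entries of the nodes, and composed with the coding of
  a node by its initial segments, it gives a tree in which the type of a tuple depends only on the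
  levels of the meets and on the lexicographic order. Applied to the levels, it removes the dependence
  on the actual levels. The second step keeps the invariance obtained in the first one because
  thickness expresses it by formulas: if two tuples agree in the lengths of the meets and in the
  lexicographic order, they begin sequences with a common continuation which have to be
  indiscernible.\<close>

section \<open>Strong limit cardinals\<close>

text \<open>Positive logic has no negation, so the failure of a formula has to be witnessed by
  another formula, and there are many candidates; hence the colours are formulas and not two truth
  values. Testing a maximal set against one formula involves a fixed number of letters, so each use
  of the partition theorem costs only finitely many power sets. The variables are words over a
  linear order rather than its points: a node can be read as a word of initial segments, or as the
  word of its levels with the entries kept in the label, and one principle serves both readings. The
  obstacle to using it twice is that invariance is an equivalence between positive formulas, hence
  not positive itself, while only positive formulas that hold under all reindexings pass to the new
  tree. Finally, the quantifier-free type of a tuple amounts to its lexicographic order and the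
  comparisons between the lengths of its meets; tuples that agree in these can be spread out by
  increasing maps of the levels until the lengths agree as well.\<close>

lemma lepoll_subset_eqpoll:
  assumes "A \<lesssim> B"
  obtains A' where "A' \<subseteq> B" "A \<approx> A'"
  using assms unfolding lepoll_def eqpoll_def by (metis bij_betw_imageI)

lemma Pow_lepoll_mono: "A \<lesssim> B \<Longrightarrow> Pow A \<lesssim> Pow B"
proof -
  assume "A \<lesssim> B"
  then obtain f where f: "inj_on f A" "f ` A \<subseteq> B" by (auto simp: lepoll_def)
  then have "inj_on ((`) f) (Pow A)" by (simp add: inj_on_image_Pow)
  moreover have "(`) f ` Pow A \<subseteq> Pow B" using f(2) by auto
  ultimately show ?thesis by (auto simp: lepoll_def)
qed

lemma lepoll_linear: "A \<lesssim> B \<or> B \<lesssim> A"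
  unfolding lepoll_def by (metis card_of_ordLeq card_of_Well_order ordLeq_total)

lemma infinite_times_self_lepoll: "infinite A \<Longrightarrow> A \<times> A \<lesssim> A"
  by (rule eqpoll_imp_lepoll) (metis card_of_Times_same_infinite eqpoll_iff_card_of_ordIso)

text \<open>A list is determined by its graph, the set of pairs of a position and the entry
  there.\<close>

lemma lists_lepoll_Pow: "lists A \<lesssim> Pow ((UNIV :: nat set) \<times> A)"
proof -
  have "inj_on (\<lambda>xs. {(i, xs ! i) |i. i < length xs}) (lists A)"
  proof (rule inj_onI)
    fix xs ys :: "'a list"
    assume eq: "{(i, xs ! i) |i. i < length xs} = {(i, ys ! i) |i. i < length ys}"
    have dom: "fst ` {(i, zs ! i) |i. i < length zs} = {..<length zs}" for zs :: "'a list"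
      by force
    have "{..<length xs} = {..<length ys}" using dom[of xs] dom[of ys] unfolding eq by simp
    then have len: "length xs = length ys" by simp
    have "xs ! i = ys ! i" if "i < length xs" for i
    proof -
      have "(i, xs ! i) \<in> {(i, ys ! i) |i. i < length ys}" using that unfolding eq[symmetric] by blast
      then show ?thesis by simp
    qed
    then show "xs = ys" using len by (rule nth_equalityI[rotated])
  qed
  moreover have "(\<lambda>xs. {(i, xs ! i) |i. i < length xs}) ` lists A \<subseteq> Pow (UNIV \<times> A)"
    by (auto simp: in_lists_conv_set)
  ultimately show ?thesis by (auto simp: lepoll_def)
qed

section \<open>Closure of the small sets under power sets, products, sums and lists\<close>

context
  fixes K :: "'k set"
  assumes K: "strong_limit K"
begin

lemma small_countable: "countable A \<Longrightarrow> A \<prec> K"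
  using K unfolding strong_limit_def
  by (metis lepoll_def lesspoll_trans1
      countable_def subset_UNIV)

text \<open>\<open>strong_limit\<close> speaks about subsets of \<open>K\<close> only; an arbitrary
  small set is first replaced by an equipollent one inside \<open>K\<close>.\<close>

lemma small_Pow:
  assumes "A \<prec> K"
  shows "Pow A \<prec> K"
proof -
  obtain A' where "A' \<subseteq> K" "A \<approx> A'"
    using lepoll_subset_eqpoll[OF lesspoll_imp_lepoll[OF assms]] .
  then have "A' \<prec> K" using assms eq_lesspoll_trans eqpoll_sym by blast
  then have "Pow A' \<prec> K" using K \<open>A' \<subseteq> K\<close> by (simp add: strong_limit_def)
  then show ?thesis
    using Pow_lepoll_mono[OF eqpoll_imp_lepoll[OF \<open>A \<approx> A'\<close>]] lesspoll_trans1 by blast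
qed

lemma small_Times:
  assumes "A \<prec> K" "B \<prec> K"
  shows "A \<times> B \<prec> K"
proof -
  have aux: "A \<times> B \<prec> K" if "A \<prec> K" "B \<prec> K" "A \<lesssim> B" for A :: "'c set" and B :: "'d set"
  proof (cases "infinite B")
    case True
    have "A \<times> B \<lesssim> B \<times> B" by (simp add: that(3) times_lepoll_mono)
    also have "B \<times> B \<lesssim> B" using True infinite_times_self_lepoll by blast
    finally show ?thesis using that(2) lesspoll_trans1 by blast
  next
    case False
    then have "finite (A \<times> B)" using that(3) by (simp add: lepoll_def inj_on_finite) (meson finite_SigmaI inj_on_finite)
    then show ?thesis by (simp add: small_countable countable_finite)
  qed
  show ?thesis
    using aux[OF assms] aux[OF assms(2,1)] lepoll_linear[of A B] times_commute_eqpoll[of A B]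
      eq_lesspoll_trans by blast
qed

lemma small_lepoll: "A \<lesssim> B \<Longrightarrow> B \<prec> K \<Longrightarrow> A \<prec> K"
  by (rule lesspoll_trans1)

lemma small_image: "A \<prec> K \<Longrightarrow> f ` A \<prec> K"
  by (rule small_lepoll[OF image_lepoll])

lemma small_subset: "A \<subseteq> B \<Longrightarrow> B \<prec> K \<Longrightarrow> A \<prec> K"
  by (rule small_lepoll[OF subset_imp_lepoll])

lemma small_Plus:
  assumes "A \<prec> K" "B \<prec> K"
  shows "A <+> B \<prec> K"
proof -
  have "(UNIV :: bool set) \<times> (insert None (Some ` A) \<times> insert None (Some ` B)) \<prec> K"
  proof (intro small_Times)
    have *: "insert None (Some ` A) \<prec> K" if "A \<prec> K" for A :: "'c set"
    proof (cases "finite A")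
      case True
      then show ?thesis by (simp add: small_countable countable_finite)
    next
      case False
      then have "insert None (Some ` A) \<approx> A"
        using infinite_insert_eqpoll[of "Some ` A" None]
        by (meson eqpoll_trans finite_imageD inj_Some inj_on_image_eqpoll_self inj_on_subset subset_UNIV)
      then show ?thesis using that eq_lesspoll_trans by blast
    qed
    show "insert None (Some ` A) \<prec> K" "insert None (Some ` B) \<prec> K" using * assms by auto
    show "(UNIV :: bool set) \<prec> K" by (simp add: small_countable countable_finite)
  qed
  moreover have "A <+> B \<lesssim> (UNIV :: bool set) \<times> (insert None (Some ` A) \<times> insert None (Some ` B))"
    unfolding lepoll_def
    by (rule exI[of _ "case_sum (\<lambda>x. (True, Some x, None)) (\<lambda>y. (False, None, Some y))"])
      (auto simp: inj_on_def)
  ultimately show ?thesis by (rule small_lepoll[rotated])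
qed

lemma small_lists: "A \<prec> K \<Longrightarrow> lists A \<prec> K"
  by (rule small_lepoll[OF lists_lepoll_Pow]) (simp add: small_Pow small_Times small_countable)

lemma small_Fpow: "A \<prec> K \<Longrightarrow> Fpow A \<prec> K"
  using small_subset[OF Fpow_subset_Pow] small_Pow by blast

lemma small_into:
  assumes "A \<prec> K"
  obtains \<iota> where "inj_on \<iota> A" "\<iota> ` A \<subseteq> K" "\<iota> ` A \<prec> K"
  using lesspoll_imp_lepoll[OF assms] small_image[OF assms] unfolding lepoll_def by metis


section \<open>The Erdos-Rado theorem for a fixed exponent\<close>

text \<open>The partition relation between \<open>X\<close> and \<open>A\<close> for
  \<open>n\<close>-element sets. Admitting all \<open>Y\<close> at least as large as
  \<open>X\<close> makes it depend only on the cardinality of \<open>X\<close>, so that the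
  induction can apply it to an injective image of \<open>T\<close>.\<close>

definition arrows :: "'c set \<Rightarrow> 'k set \<Rightarrow> nat \<Rightarrow> 'k set \<Rightarrow> bool" where
  "arrows Col A n X \<longleftrightarrow>
     (\<forall>(Y :: 'k set) f. X \<lesssim> Y \<longrightarrow> range f \<subseteq> Col \<longrightarrow>
        (\<exists>H \<subseteq> Y. A \<lesssim> H \<and> (\<exists>c. \<forall>s \<in> nsets H n. f s = c)))"

text \<open>The pivot \<open>y\<close> guides a greedy construction: along a well-order of \<open>T\<close>, choose new elements which
  cannot be distinguished from \<open>y\<close> over the earlier ones. Either this never meets \<open>y\<close>, and then the
  colour of a set does not depend on its last element, or \<open>y\<close> is determined by a code.\<close>

lemma arrows_Suc:
  fixes Col :: "'c set"
  assumes T: "arrows Col A n T"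
    and X: "\<not> X \<lesssim> T \<times> Pow (Fpow T \<times> Col)"
  shows "arrows Col A (Suc n) X"
  unfolding arrows_def
proof (intro allI impI)
  fix Y :: "'k set" and f :: "'k set \<Rightarrow> 'c"
  assume XY: "X \<lesssim> Y" and f: "range f \<subseteq> Col"
  obtain r :: "'k rel" where r: "well_order_on UNIV r" using well_order_on by blast
  define R where "R = r - Id"
  have wf: "wf R" using r by (simp add: R_def well_order_on_def)
  have tot: "(t, t') \<in> R \<or> t = t' \<or> (t', t) \<in> R" for t t'
    using r by (auto simp: R_def well_order_on_def linear_order_on_def total_on_def)
  define below where "below t = {t' \<in> T. (t', t) \<in> R}" for t
  \<comment> \<open>The pivot \<open>y\<close> is itself a candidate unless it already occurs in
    \<open>E\<close>, and the predicate depends on \<open>y\<close> only through its colours over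
    \<open>E\<close>. The first fact keeps the construction going, the second makes the codes below
    injective.\<close>
  define good where "good y E x \<longleftrightarrow> x \<in> Y \<and> x \<notin> E \<and>
     (\<forall>s \<in> nsets E n. f (insert x s) = f (insert y s))" for y E x
  define e where "e y = wfrec R (\<lambda>e t. SOME x. good y (e ` below t) x)" for y
  have e: "e y t = (SOME x. good y (e y ` below t) x)" for y t
  proof -
    have "e y t = (SOME x. good y (cut (e y) R t ` below t) x)"
      unfolding e_def by (rule wfrec[OF wf])
    moreover have "cut (e y) R t ` below t = e y ` below t"
      by (intro image_cong) (auto simp: below_def cut_apply)
    ultimately show ?thesis by simp
  qed
  show "\<exists>H \<subseteq> Y. A \<lesssim> H \<and> (\<exists>c. \<forall>s \<in> nsets H (Suc n). f s = c)"
  proof (cases "\<exists>y \<in> Y. y \<notin> e y ` T")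
    case True
    then obtain y where y: "y \<in> Y" "y \<notin> e y ` T" by blast
    have good: "good y (e y ` below t) (e y t)" for t
    proof -
      have "good y (e y ` below t) y" using y by (auto simp: good_def below_def)
      then show ?thesis unfolding e[of y t] by (rule someI)
    qed
    have neq: "e y t \<noteq> e y t'" if "t' \<in> T" "(t', t) \<in> R" for t t'
      using good[of t] that by (auto simp: good_def below_def)
    have inj: "inj_on (e y) T" using neq tot by (metis inj_onI)
    have "T \<lesssim> e y ` T" using inj by simp
    then obtain H c where H: "H \<subseteq> e y ` T" "A \<lesssim> H"
      and c: "\<And>s. s \<in> nsets H n \<Longrightarrow> f (insert y s) = c"
      using T f unfolding arrows_def
      by (elim allE[of _ "e y ` T"] allE[of _ "\<lambda>s. f (insert y s)"]) blast
    have "f s = c" if s: "s \<in> nsets H (Suc n)" for s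
    proof -
      define S where "S = {t \<in> T. e y t \<in> s}"
      have s': "s \<subseteq> H" "finite s" "card s = Suc n" using s by (auto simp: nsets_def)
      have sS: "s = e y ` S" using s' H by (auto simp: S_def)
      have injS: "inj_on (e y) S" using inj by (rule inj_on_subset) (auto simp: S_def)
      have finS: "finite S" using s'(2) sS injS finite_imageD by blast
      have "S \<noteq> {}" using s'(3) sS by auto
      have "\<exists>t \<in> S. \<forall>t' \<in> S. (t, t') \<notin> R"
      proof -
        have "acyclic (R \<inter> S \<times> S)" using wf_acyclic[OF wf] acyclic_subset by blast
        then have "wf ((R \<inter> S \<times> S)\<inverse>)" using finS by (intro finite_acyclic_wf_converse) auto
        then obtain m where "m \<in> S" "\<And>t. (t, m) \<in> (R \<inter> S \<times> S)\<inverse> \<Longrightarrow> t \<notin> S"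
          using \<open>S \<noteq> {}\<close> wfE_min' by (metis (no_types, lifting))
        then show ?thesis by blast
      qed
      then obtain t where t: "t \<in> S" "\<And>t'. t' \<in> S \<Longrightarrow> (t, t') \<notin> R" by blast
      define s0 where "s0 = e y ` (S - {t})"
      have ss0: "s = insert (e y t) s0" using t(1) by (auto simp: sS s0_def)
      have "S - {t} \<subseteq> below t" using t tot by (auto simp: below_def S_def)
      moreover have "card s0 = n"
        using s'(3) t(1) finS injS by (simp add: s0_def sS card_image inj_on_diff)
      ultimately have "s0 \<in> nsets (e y ` below t) n" "s0 \<in> nsets H n"
        using finS s'(1) sS by (auto simp: nsets_def s0_def)
      \<comment> \<open>The last element \<open>e y t\<close> has the same colour over
        \<open>s0\<close> as the pivot, and homogeneity of \<open>H\<close> says that this colour is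
        \<open>c\<close>.\<close>
      then show ?thesis using good[of t] c unfolding good_def ss0 by metis
    qed
    then show ?thesis using H \<open>H \<subseteq> e y ` T\<close> good by (intro exI[of _ H]) (auto simp: good_def)
  next
    case False
    then have "\<forall>y \<in> Y. \<exists>t. t \<in> T \<and> e y t = y" by force
    then obtain \<tau> where \<tau>: "\<And>y. y \<in> Y \<Longrightarrow> \<tau> y \<in> T \<and> e y (\<tau> y) = y" by metis
    \<comment> \<open>Colours are recorded for index sets \<open>S\<close> and not for their images
      under \<open>e y\<close>, which vary with \<open>y\<close>; so all codes lie in one set built
      from \<open>T\<close> and \<open>Col\<close>.\<close>
    define code where
      "code y = (\<tau> y, {(S, c). S \<in> Fpow T \<and> c = f (insert y (e y ` S))})" for y
    have "inj_on code Y"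
    proof (rule inj_onI)
      fix y y' assume y: "y \<in> Y" "y' \<in> Y" and "code y = code y'"
      then have \<tau>_eq: "\<tau> y = \<tau> y'"
        and sets: "{(S, c). S \<in> Fpow T \<and> c = f (insert y (e y ` S))} =
          {(S, c). S \<in> Fpow T \<and> c = f (insert y' (e y' ` S))}"
        by (auto simp: code_def)
      have col: "f (insert y (e y ` S)) = f (insert y' (e y' ` S))" if "S \<in> Fpow T" for S
      proof -
        have "(S, f (insert y (e y ` S))) \<in> {(S, c). S \<in> Fpow T \<and> c = f (insert y (e y ` S))}"
          using that by simp
        then show ?thesis unfolding sets by simp
      qed
      have "e y t = e y' t" for t
        using wf
      proof (induction t rule: wf_induct_rule)
        case (less t)
        then have img: "e y ` below t = e y' ` below t"
          by (intro image_cong) (auto simp: below_def)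
        have "f (insert y s) = f (insert y' s)" if "s \<in> nsets (e y ` below t) n" for s
        proof -
          have "finite s" "s \<subseteq> e y ` below t" using that by (auto simp: nsets_def)
          then obtain S where S: "S \<subseteq> below t" "finite S" "s = e y ` S"
            by (meson finite_subset_image)
          then have "e y ` S = e y' ` S" using less by (intro image_cong) (auto simp: below_def)
          moreover have "S \<in> Fpow T" using S by (auto simp: Fpow_def below_def)
          ultimately show ?thesis using col[of S] S(3) by simp
        qed
        then have "good y (e y ` below t) = good y' (e y' ` below t)"
          unfolding good_def img[symmetric] by auto
        then show ?case unfolding e[of y t] e[of y' t] by simp
      qed
      then show "y = y'" using \<tau>[OF y(1)] \<tau>[OF y(2)] \<tau>_eq by metis
    qed
    moreover have "code ` Y \<subseteq> T \<times> Pow (Fpow T \<times> Col)"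
      using \<tau> f by (auto simp: code_def)
    ultimately have "Y \<lesssim> T \<times> Pow (Fpow T \<times> Col)" by (auto simp: lepoll_def)
    then show ?thesis using X XY lepoll_trans by blast
  qed
qed

text \<open>For exponent \<open>0\<close> only the empty set is coloured. In the step
  \<open>X\<close> has the size of the power set of the set of codes, so by Cantor's theorem it does
  not embed there, and it stays small because \<open>K\<close> is a strong limit.\<close>

lemma arrows_exists:
  assumes "Col \<prec> K" "A \<prec> K"
  shows "\<exists>X. X \<prec> K \<and> arrows Col A n X"
proof (induction n)
  case 0
  have "arrows Col A 0 A"
    unfolding arrows_def by (intro allI impI exI conjI subset_refl) (auto simp: nsets_def)
  then show ?case using assms by blast
next
  case (Suc n)
  then obtain T where T: "T \<prec> K" "arrows Col A n T" by blast
  let ?W = "T \<times> Pow (Fpow T \<times> Col)"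
  have "Pow ?W \<prec> K"
    using T(1) assms(1) by (intro small_Pow small_Times small_Fpow)
  then obtain X where X: "X \<subseteq> K" "Pow ?W \<approx> X"
    using lepoll_subset_eqpoll lesspoll_imp_lepoll by metis
  then have "X \<prec> K" using \<open>Pow ?W \<prec> K\<close> eq_lesspoll_trans eqpoll_sym by blast
  moreover have "\<not> X \<lesssim> ?W"
    using X(2) lesspoll_Pow_self[of ?W] by (meson lepoll_trans1 lesspoll_not_refl lesspoll_trans2)
  ultimately show ?case using arrows_Suc[OF T(2)] by blast
qed

lemma erdos_rado:
  assumes "Col \<prec> K" and "Col \<noteq> {}"
  obtains X :: "'k set" where "X \<prec> K" "infinite X"
    "\<And>f. range f \<subseteq> Col \<Longrightarrow> \<exists>H \<subseteq> X. infinite H \<and> (\<exists>c. \<forall>s \<in> nsets H n. f s = c)"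
proof -
  obtain A where A: "A \<subseteq> K" "(UNIV :: nat set) \<approx> A"
    using K lepoll_subset_eqpoll lesspoll_imp_lepoll unfolding strong_limit_def by metis
  then have "A \<prec> K" using K eq_lesspoll_trans eqpoll_sym unfolding strong_limit_def by blast
  then obtain X where X: "X \<prec> K" "arrows Col A n X" using arrows_exists[OF assms(1)] by blast
  have inf: "infinite H" if "A \<lesssim> H" for H :: "'k set"
    using A(2) that infinite_le_lepoll lepoll_trans1 by blast
  have *: "\<exists>H \<subseteq> X. infinite H \<and> (\<exists>c. \<forall>s \<in> nsets H n. f s = c)" if "range f \<subseteq> Col" for f
    using X(2) that inf unfolding arrows_def by (metis lepoll_refl)
  obtain c where "c \<in> Col" using assms(2) by blast
  then have "infinite X" using *[of "\<lambda>_. c"] infinite_super by blast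
  then show ?thesis using that X(1) * by blast
qed

end


section \<open>Counting formulas\<close>

instance tm :: (countable) countable by countable_datatype
instance atom :: (countable, countable) countable by countable_datatype
instance pform :: (countable, countable) countable by countable_datatype

lemma set_tm_wf: "wf_tm L t \<Longrightarrow> set_tm t \<subseteq> fun_syms L"
  by (induction t) auto

lemma set_atom_wf:
  "wf_atom L A \<Longrightarrow> set1_atom A \<subseteq> fun_syms L \<and> set2_atom A \<subseteq> rel_syms L"
  using set_tm_wf[of L] by (cases A) fastforce+

lemma set_pform_wf:
  "wf_pform L \<phi> \<Longrightarrow> set1_pform \<phi> \<subseteq> fun_syms L \<and> set2_pform \<phi> \<subseteq> rel_syms L"
  using set_atom_wf[of L] by (induction \<phi>) auto

lemma finite_set_tm: "finite (set_tm t)"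
  by (induction t) auto

lemma finite_set_atom: "finite (set1_atom A) \<and> finite (set2_atom A)"
  by (cases A) (auto simp: finite_set_tm)

lemma finite_set_pform: "finite (set1_pform \<phi>) \<and> finite (set2_pform \<phi>)"
  by (induction \<phi>) (auto simp: finite_set_atom)

lemma map_nth_inverse:
  assumes "finite S"
  obtains xs and g :: "'b \<Rightarrow> nat" where "set xs = S" "\<And>x. x \<in> S \<Longrightarrow> xs ! g x = x"
proof -
  obtain xs where "set xs = S" using finite_list[OF assms] by blast
  moreover from this have "\<forall>x \<in> S. \<exists>i. xs ! i = x" by (metis in_set_conv_nth)
  ultimately show ?thesis using that by metis
qed

text \<open>A formula is a formula in the symbols \<open>0, 1, 2, \<dots>\<close> together with lists interpreting them.\<close>

lemma small_wf_pform:
  assumes K: "strong_limit K" and "fun_syms L \<prec> K" "rel_syms L \<prec> K"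
  shows "{\<phi> :: ('f, 'r) pform. wf_pform L \<phi>} \<prec> K"
proof -
  let ?S = "lists (fun_syms L) \<times> lists (rel_syms L) \<times> (UNIV :: (nat, nat) pform set)"
  let ?h = "\<lambda>(xs, ys, \<phi>). map_pform ((!) xs) ((!) ys) \<phi>"
  have "\<phi> \<in> ?h ` ?S" if \<phi>: "wf_pform L \<phi>" for \<phi> :: "('f, 'r) pform"
  proof -
    obtain xs and g :: "'f \<Rightarrow> nat" where xs: "set xs = set1_pform \<phi>"
      "\<And>x. x \<in> set1_pform \<phi> \<Longrightarrow> xs ! g x = x"
      using map_nth_inverse finite_set_pform by metis
    obtain ys and h :: "'r \<Rightarrow> nat" where ys: "set ys = set2_pform \<phi>"
      "\<And>x. x \<in> set2_pform \<phi> \<Longrightarrow> ys ! h x = x"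
      using map_nth_inverse finite_set_pform by metis
    have "map_pform ((!) xs) ((!) ys) (map_pform g h \<phi>) = map_pform id id \<phi>"
      unfolding pform.map_comp using xs ys by (intro pform.map_cong) auto
    then have "\<phi> = ?h (xs, ys, map_pform g h \<phi>)" by (simp add: pform.map_id)
    moreover have "(xs, ys, map_pform g h \<phi>) \<in> ?S"
      using xs(1) ys(1) set_pform_wf[OF \<phi>] by auto
    ultimately show ?thesis by blast
  qed
  then have "{\<phi> :: ('f, 'r) pform. wf_pform L \<phi>} \<subseteq> ?h ` ?S" by blast
  moreover have "?S \<prec> K"
    using assms by (simp add: small_Times small_lists small_countable)
  ultimately show ?thesis using small_subset[OF K] small_image[OF K] by blast
qed


section \<open>Substitution in formulas with parameters\<close>

definition symbols :: "('f, 'r, 'x, 'a) cform \<Rightarrow> ('x + 'a) set" where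
  "symbols p = snd p ` fv (fst p)"

definition vars :: "('f, 'r, 'x, 'a) cform \<Rightarrow> 'x set" where
  "vars p = {x. Inl x \<in> symbols p}"

text \<open>The substitution acts on parameters as well, because parameters are traded for variables
  when thickness is extended to nonempty parameter sets; \<open>ren\<close> is the case that changes
  variables only.\<close>

definition sub :: "('x + 'a \<Rightarrow> 'y + 'b) \<Rightarrow> ('f, 'r, 'x, 'a) cform \<Rightarrow> ('f, 'r, 'y, 'b) cform" where
  "sub \<sigma> p = (fst p, \<sigma> \<circ> snd p)"

abbreviation ren :: "('x \<Rightarrow> 'y) \<Rightarrow> ('f, 'r, 'x, 'a) cform \<Rightarrow> ('f, 'r, 'y, 'a) cform" where
  "ren \<rho> \<equiv> sub (map_sum \<rho> id)"

lemma symbols_sub: "symbols (sub \<sigma> p) = \<sigma> ` symbols p"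
  by (auto simp: symbols_def sub_def)

lemma fst_sub [simp]: "fst (sub \<sigma> p) = fst p"
  by (simp add: sub_def)

lemma finite_symbols: "finite (symbols p)"
  by (simp add: symbols_def finite_fv)

lemma finite_vars: "finite (vars p)"
proof -
  have "Inl ` vars p \<subseteq> symbols p" by (auto simp: vars_def)
  then show ?thesis using finite_symbols by (metis finite_imageD finite_subset inj_Inl)
qed

lemma cforms_iff: "p \<in> cforms L C X \<longleftrightarrow> wf_pform L (fst p) \<and> symbols p \<subseteq> X <+> C"
  by (auto simp: cforms_def symbols_def split: prod.splits)

lemma vars_cforms: "p \<in> cforms L C X \<Longrightarrow> vars p \<subseteq> X"
  by (auto simp: cforms_iff vars_def)

lemma vars_ren:
  fixes p :: "('f, 'r, 'a, 'd) cform"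
  shows "vars (ren \<rho> p) = \<rho> ` vars p"
proof -
  have "Inl y \<in> map_sum \<rho> id ` S \<longleftrightarrow> y \<in> \<rho> ` {x. Inl x \<in> S}" for y and S :: "('a + 'd) set"
  proof -
    have "map_sum \<rho> id z = Inl y \<longleftrightarrow> (\<exists>x. z = Inl x \<and> \<rho> x = y)" for z :: "'a + 'd"
      by (cases z) auto
    then have "(\<exists>z \<in> S. map_sum \<rho> id z = Inl y) \<longleftrightarrow> (\<exists>x. Inl x \<in> S \<and> \<rho> x = y)" by auto
    then show ?thesis unfolding image_iff by (metis mem_Collect_eq)
  qed
  then show ?thesis unfolding vars_def symbols_sub by blast
qed

lemma ren_cforms:
  assumes "p \<in> cforms L C X" "\<rho> ` vars p \<subseteq> Y"
  shows "ren \<rho> p \<in> cforms L C Y"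
proof -
  have "map_sum \<rho> id z \<in> Y <+> C" if "z \<in> symbols p" for z
    using assms that by (cases z) (auto simp: cforms_iff vars_def)
  then show ?thesis using assms by (auto simp: cforms_iff symbols_sub)
qed

lemma cforms_mono: "p \<in> cforms L C X \<Longrightarrow> vars p \<subseteq> Y \<Longrightarrow> p \<in> cforms L C Y"
  using ren_cforms[of p L C X id Y] by (simp add: sum.map_id0 sub_def)

lemma holds_sub_cong:
  assumes "\<And>z. z \<in> symbols p \<Longrightarrow> case_sum v id (\<sigma> z) = case_sum w id z"
  shows "holds M v (sub \<sigma> p) \<longleftrightarrow> holds M w p"
  unfolding holds_def sub_def using assms by (auto simp: symbols_def intro!: sat_cong)

lemma holds_ren: "holds M v (ren \<rho> p) \<longleftrightarrow> holds M (v \<circ> \<rho>) p"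
  by (rule holds_sub_cong) (auto split: sum.splits)

lemma holds_cong:
  assumes "\<And>x. x \<in> vars p \<Longrightarrow> v x = w x"
  shows "holds M v p \<longleftrightarrow> holds M w p"
  unfolding holds_def
proof (rule sat_cong)
  fix n assume "n \<in> fv (fst p)"
  then show "(case_sum v id \<circ> snd p) n = (case_sum w id \<circ> snd p) n"
    using assms by (cases "snd p n") (force simp: vars_def symbols_def)+
qed

text \<open>A formula contradicting \<open>p\<close> may have free variables that do not occur in \<open>p\<close>, where
  \<open>snd p\<close> need not be a variable or parameter under consideration.\<close>

definition variant ::
    "'x \<Rightarrow> ('f, 'r, 'x, 'a) cform \<Rightarrow> ('f, 'r) pform \<Rightarrow> ('f, 'r, 'x, 'a) cform" where
  "variant x\<^sub>0 p \<chi> = (\<chi>, \<lambda>n. if n \<in> fv (fst p) then snd p n else Inl x\<^sub>0)"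

lemma holds_variant_self: "holds M v (variant x\<^sub>0 p (fst p)) \<longleftrightarrow> holds M v p"
  unfolding holds_def variant_def by (auto intro!: sat_cong)

lemma variant_cforms:
  "p \<in> cforms L C X \<Longrightarrow> x\<^sub>0 \<in> X \<Longrightarrow> wf_pform L \<chi> \<Longrightarrow> variant x\<^sub>0 p \<chi> \<in> cforms L C X"
  by (auto simp: cforms_iff variant_def symbols_def)

lemma ren_variant: "\<rho> x\<^sub>0 = y\<^sub>0 \<Longrightarrow> ren \<rho> (variant x\<^sub>0 p \<chi>) = variant y\<^sub>0 (ren \<rho> p) \<chi>"
  by (auto simp: sub_def variant_def)


section \<open>Monster models\<close>

locale monster_model =
  fixes K :: "'k set" and L :: "('f, 'r) lang" and T :: "('f, 'r) hsent set"
    and M :: "('a, 'f, 'r) struc"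
  assumes positive: "positive_theory L T" and monster: "monster K L T M"
begin

lemma K: "strong_limit K"
  using monster by (simp add: monster_def)

lemmas small = small_countable[OF K] small_Pow[OF K] small_Times[OF K] small_Plus[OF K]
  small_lists[OF K]

lemma model: "model L T M"
  using monster by (simp add: monster_def ec_model_def)

lemma small_formulas: "{\<phi>. wf_pform L \<phi>} \<prec> K"
  using monster by (intro small_wf_pform) (auto simp: monster_def)

lemma carrier_nonempty: "carrier M \<noteq> {}"
  using model by (simp add: model_def wf_struc_def)

text \<open>Saturation is stated for variables in the type of \<open>K\<close>; other variables are
  copied there by an injection. The solution is total with values in the model, as existential
  closedness speaks about total environments.\<close>

lemma realize:
  fixes X :: "'x set"
  assumes X: "X \<prec> K" and C: "C \<subseteq> carrier M" "C \<prec> K" and \<Sigma>: "\<Sigma> \<subseteq> cforms L C X"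
    and fin: "\<And>\<Sigma>\<^sub>0. finite \<Sigma>\<^sub>0 \<Longrightarrow> \<Sigma>\<^sub>0 \<subseteq> \<Sigma> \<Longrightarrow> \<exists>v. range v \<subseteq> carrier M \<and> (\<forall>p \<in> \<Sigma>\<^sub>0. holds M v p)"
  obtains v where "range v \<subseteq> carrier M" "\<forall>p \<in> \<Sigma>. holds M v p"
proof -
  obtain \<iota> where \<iota>: "inj_on \<iota> X" "\<iota> ` X \<subseteq> K" "\<iota> ` X \<prec> K" using small_into[OF K X] .
  obtain d where d: "d \<in> carrier M" using carrier_nonempty by blast
  have "\<exists>v. v ` \<iota> ` X \<subseteq> carrier M \<and> (\<forall>p \<in> ren \<iota> ` \<Sigma>. holds M v p)"
  proof -
    have "ren \<iota> ` \<Sigma> \<subseteq> cforms L C (\<iota> ` X)"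
    proof (rule image_subsetI)
      fix p assume "p \<in> \<Sigma>"
      then have "p \<in> cforms L C X" using \<Sigma> by blast
      then show "ren \<iota> p \<in> cforms L C (\<iota> ` X)"
        by (rule ren_cforms) (use vars_cforms \<open>p \<in> cforms L C X\<close> in blast)
    qed
    moreover have "\<exists>v. v ` \<iota> ` X \<subseteq> carrier M \<and> (\<forall>p \<in> \<Sigma>\<^sub>0. holds M v p)"
      if \<Sigma>\<^sub>0: "\<Sigma>\<^sub>0 \<subseteq> ren \<iota> ` \<Sigma>" "finite \<Sigma>\<^sub>0" for \<Sigma>\<^sub>0
    proof -
      obtain \<Sigma>\<^sub>1 where \<Sigma>\<^sub>1: "\<Sigma>\<^sub>1 \<subseteq> \<Sigma>" "finite \<Sigma>\<^sub>1" "\<Sigma>\<^sub>0 = ren \<iota> ` \<Sigma>\<^sub>1"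
        using finite_subset_image[OF \<Sigma>\<^sub>0(2,1)] by blast
      obtain v where v: "range v \<subseteq> carrier M" "\<forall>p \<in> \<Sigma>\<^sub>1. holds M v p"
        using fin[OF \<Sigma>\<^sub>1(2,1)] by blast
      have "holds M (v \<circ> inv_into X \<iota>) (ren \<iota> p)" if "p \<in> \<Sigma>\<^sub>1" for p
      proof -
        have "vars p \<subseteq> X" using that \<Sigma>\<^sub>1(1) \<Sigma> vars_cforms by blast
        then have "holds M (v \<circ> inv_into X \<iota> \<circ> \<iota>) p \<longleftrightarrow> holds M v p"
          using \<iota>(1) by (intro holds_cong) auto
        then show ?thesis using v(2) that by (simp add: holds_ren)
      qed
      then show ?thesis using v(1) \<Sigma>\<^sub>1(3) by (intro exI[of _ "v \<circ> inv_into X \<iota>"]) auto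
    qed
    ultimately show ?thesis
      using monster C \<iota>(3) unfolding monster_def saturated_def by blast
  qed
  then obtain v where v: "v ` \<iota> ` X \<subseteq> carrier M" "\<forall>p \<in> \<Sigma>. holds M v (ren \<iota> p)" by auto
  define w where "w x = (if x \<in> X then v (\<iota> x) else d)" for x
  have "holds M w p" if "p \<in> \<Sigma>" for p
  proof -
    have "vars p \<subseteq> X" using that \<Sigma> vars_cforms by blast
    then have "holds M (v \<circ> \<iota>) p \<longleftrightarrow> holds M w p" by (intro holds_cong) (auto simp: w_def)
    then show ?thesis using v(2) that by (simp add: holds_ren)
  qed
  moreover have "range w \<subseteq> carrier M" using v(1) d by (auto simp: w_def)
  ultimately show ?thesis using that by blast
qed

lemma variant_env:
  assumes "p \<in> cforms L C X" "C \<subseteq> carrier M" "range v \<subseteq> carrier M"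
  shows "range (case_sum v id \<circ> snd (variant x\<^sub>0 p \<chi>)) \<subseteq> carrier M"
proof -
  have "(case_sum v id \<circ> snd (variant x\<^sub>0 p \<chi>)) n \<in> carrier M" for n
  proof (cases "n \<in> fv (fst p)")
    case True
    then have "snd p n \<in> X <+> C" using assms(1) by (auto simp: cforms_iff symbols_def)
    then show ?thesis using True assms(2,3) by (auto simp: variant_def)
  qed (use assms(3) in \<open>auto simp: variant_def\<close>)
  then show ?thesis by blast
qed

text \<open>Existential closedness. The environment must lie in the model also at the variables that
  are not free in \<open>p\<close>; \<open>variant\<close> gives them the value of
  \<open>x\<^sub>0\<close>.\<close>

lemma refuted:
  assumes "p \<in> cforms L C X" "C \<subseteq> carrier M" "range v \<subseteq> carrier M" "\<not> holds M v p"
  obtains \<psi> where "wf_pform L \<psi>" "contradictory L T (fst p) \<psi>" "holds M v (variant x\<^sub>0 p \<psi>)"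
proof -
  let ?e = "case_sum v id \<circ> (\<lambda>n. if n \<in> fv (fst p) then snd p n else Inl x\<^sub>0)"
  have env: "range ?e \<subseteq> carrier M"
    using variant_env[OF assms(1-3), of x\<^sub>0] by (simp add: variant_def)
  have "\<not> sat M (?e) (fst p)"
    using assms(4) holds_variant_self[of M v x\<^sub>0 p] by (simp add: holds_def variant_def)
  moreover have "wf_pform L (fst p)" using assms(1) by (simp add: cforms_iff)
  ultimately obtain \<psi> where "wf_pform L \<psi>" "contradictory L T (fst p) \<psi>" "sat M (?e) \<psi>"
    using monster env unfolding monster_def ec_model_def by blast
  then show ?thesis using that by (simp add: holds_def variant_def)
qed

text \<open>\<open>contradictory\<close> refers to models built on formulas;
  \<open>contradictory_all_models\<close> makes it available in \<open>M\<close>.\<close>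

lemma not_both:
  assumes "p \<in> cforms L C X" "C \<subseteq> carrier M" "range v \<subseteq> carrier M"
    and \<psi>: "wf_pform L \<psi>" "contradictory L T (fst p) \<psi>" "holds M v (variant x\<^sub>0 p \<psi>)"
  shows "\<not> holds M v p"
proof -
  let ?e = "case_sum v id \<circ> snd (variant x\<^sub>0 p \<psi>)"
  have "\<not> (sat M ?e (fst p) \<and> sat M ?e \<psi>)"
    using contradictory_all_models[OF \<psi>(2) positive _ \<psi>(1) model variant_env[OF assms(1-3)]]
      assms(1) by (simp add: cforms_iff)
  moreover have "sat M ?e \<psi>" using \<psi>(3) by (simp add: holds_def variant_def)
  moreover have "holds M v p \<longleftrightarrow> sat M ?e (fst p)"
    using holds_variant_self[of M v x\<^sub>0 p] by (simp add: holds_def variant_def)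
  ultimately show ?thesis by blast
qed

end


section \<open>Finite pieces of linear orders\<close>

definition linear_on :: "'x set \<Rightarrow> ('x \<Rightarrow> 'x \<Rightarrow> bool) \<Rightarrow> bool" where
  "linear_on X lt \<longleftrightarrow> irreflp_on X lt \<and> transp_on X lt \<and> totalp_on X lt"

text \<open>For a finite linearly ordered \<open>A\<close> this is the position of \<open>x\<close>
  in the increasing enumeration, counted from \<open>0\<close>; the enumeration is its
  inverse.\<close>

definition rank :: "'x set \<Rightarrow> ('x \<Rightarrow> 'x \<Rightarrow> bool) \<Rightarrow> 'x \<Rightarrow> nat" where
  "rank A lt x = card {y \<in> A. lt y x}"

lemma linear_on_subset: "linear_on X lt \<Longrightarrow> Y \<subseteq> X \<Longrightarrow> linear_on Y lt"
  unfolding linear_on_def by (meson irreflp_on_subset totalp_on_subset transp_on_subset)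

lemma linear_on_nat: "linear_on A ((<) :: nat \<Rightarrow> nat \<Rightarrow> bool)"
  by (auto simp: linear_on_def irreflp_on_def transp_on_def totalp_on_def)

lemma linear_on_exists: "\<exists>lt. linear_on (UNIV :: 'x set) lt"
proof -
  obtain r :: "'x rel" where "well_order_on UNIV r" using well_order_on by blast
  then have "trans r" "antisym r" "total r"
    by (auto simp: well_order_on_def linear_order_on_def partial_order_on_def preorder_on_def)
  then have "linear_on UNIV (\<lambda>x y. (x, y) \<in> r \<and> x \<noteq> y)"
    by (auto simp: linear_on_def irreflp_on_def transp_on_def totalp_on_def total_on_def
        dest: transD antisymD)
  then show ?thesis by blast
qed

context
  fixes A :: "'x set" and lt :: "'x \<Rightarrow> 'x \<Rightarrow> bool"
  assumes A: "finite A" "linear_on A lt"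
begin

lemma rank_mono: "monotone_on A lt (<) (rank A lt)"
proof (rule monotone_onI)
  fix x y assume xy: "x \<in> A" "y \<in> A" "lt x y"
  have "x \<notin> {z \<in> A. lt z x}" "x \<in> {z \<in> A. lt z y}"
    using A(2) xy by (auto simp: linear_on_def irreflp_on_def)
  moreover have "{z \<in> A. lt z x} \<subseteq> {z \<in> A. lt z y}"
    using A(2) xy unfolding linear_on_def transp_on_def by blast
  ultimately have "{z \<in> A. lt z x} \<subset> {z \<in> A. lt z y}" by blast
  then show "rank A lt x < rank A lt y"
    unfolding rank_def using A(1) by (intro psubset_card_mono) auto
qed

lemma rank_inj: "inj_on (rank A lt) A"
  using A(2) rank_mono unfolding linear_on_def totalp_on_def monotone_on_def inj_on_def
  by (metis less_irrefl)

lemma rank_image: "rank A lt ` A = {..<card A}"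
proof -
  have "rank A lt x < card A" if "x \<in> A" for x
  proof -
    have "x \<notin> {y \<in> A. lt y x}" using A(2) that by (auto simp: linear_on_def irreflp_on_def)
    then have "{y \<in> A. lt y x} \<subset> A" using that by blast
    then show ?thesis unfolding rank_def using A(1) by (rule psubset_card_mono[rotated])
  qed
  then show ?thesis
    using card_image[OF rank_inj] by (intro card_subset_eq) auto
qed

lemma rank_inv: "i < card A \<Longrightarrow> inv_into A (rank A lt) i \<in> A \<and> rank A lt (inv_into A (rank A lt) i) = i"
  using rank_image by (simp add: f_inv_into_f inv_into_into)

lemma rank_inv_mono: "monotone_on {..<card A} (<) lt (inv_into A (rank A lt))"
proof (rule monotone_onI)
  fix i j assume ij: "i \<in> {..<card A}" "j \<in> {..<card A}" "i < j"
  let ?x = "inv_into A (rank A lt) i" and ?y = "inv_into A (rank A lt) j"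
  have "?x \<in> A" "?y \<in> A" "rank A lt ?x < rank A lt ?y" using ij rank_inv by auto
  then show "lt ?x ?y"
    using A(2) rank_mono unfolding linear_on_def totalp_on_def monotone_on_def
    by (metis less_asym)
qed

end

lemma monotone_on_inj:
  assumes "linear_on A lt" "linear_on B lt'" "monotone_on A lt lt' g" "g ` A \<subseteq> B"
  shows "inj_on g A"
  using assms unfolding linear_on_def totalp_on_def irreflp_on_def monotone_on_def inj_on_def
  by (metis image_subset_iff)

lemma monotone_on_iff:
  assumes "linear_on A lt" "linear_on B lt'" "monotone_on A lt lt' g" "g ` A \<subseteq> B"
    and "x \<in> A" "y \<in> A"
  shows "lt' (g x) (g y) \<longleftrightarrow> lt x y"
  using assms unfolding linear_on_def totalp_on_def irreflp_on_def transp_on_def monotone_on_def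
  by (metis image_subset_iff)

text \<open>An increasing map preserves and reflects the order, so ranks are kept. Thus an
  increasing tuple can be recovered from its set of values, and colouring sets amounts to colouring
  increasing tuples.\<close>

lemma rank_monotone_image:
  assumes "linear_on A lt" "linear_on B lt'" "monotone_on A lt lt' g" "g ` A \<subseteq> B" "x \<in> A"
  shows "rank (g ` A) lt' (g x) = rank A lt x"
proof -
  have "{y \<in> g ` A. lt' y (g x)} = g ` {y \<in> A. lt y x}"
    using monotone_on_iff[OF assms(1-4) _ assms(5)] by auto
  moreover have "inj_on g {y \<in> A. lt y x}"
    using monotone_on_inj[OF assms(1-4)] by (rule inj_on_subset) auto
  ultimately show ?thesis by (simp add: rank_def card_image)
qed

lemma monotone_on_compose:
  "monotone_on A r s g \<Longrightarrow> monotone_on B s t h \<Longrightarrow> g ` A \<subseteq> B \<Longrightarrow> monotone_on A r t (h \<circ> g)"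
  by (auto simp: monotone_on_def image_subset_iff)

lemma embed_finite:
  assumes Z: "finite Z" "linear_on Z lt'" and X: "infinite X" "linear_on X lt"
  obtains \<epsilon> where "monotone_on Z lt' lt \<epsilon>" "\<epsilon> ` Z \<subseteq> X"
proof -
  obtain W where W: "finite W" "card W = card Z" "W \<subseteq> X"
    using infinite_arbitrarily_large[OF X(1)] by blast
  have lin: "linear_on W lt" using linear_on_subset X(2) W(3) by blast
  let ?\<epsilon> = "inv_into W (rank W lt) \<circ> rank Z lt'"
  have "monotone_on Z lt' lt ?\<epsilon>"
    using rank_mono[OF Z] rank_inv_mono[OF W(1) lin] rank_image[OF Z] W(2)
    by (intro monotone_on_compose) auto
  moreover have "?\<epsilon> ` Z \<subseteq> X"
    using rank_inv[OF W(1) lin] rank_image[OF Z] W(2,3) by auto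
  ultimately show ?thesis using that by blast
qed


section \<open>Skeletons\<close>

text \<open>The variables are words with a label, and \<open>relabel g\<close> replaces the letters
  of each word; a formula sees the linear order only through the finitely many letters of its
  words.\<close>

definition letters :: "('f, 'r, 'x list \<times> 'd, 'a) cform \<Rightarrow> 'x set" where
  "letters p = (\<Union>x \<in> vars p. set (fst x))"

abbreviation relabel ::
    "('x \<Rightarrow> 'y) \<Rightarrow> ('f, 'r, 'x list \<times> 'd, 'a) cform \<Rightarrow> ('f, 'r, 'y list \<times> 'd, 'a) cform" where
  "relabel g \<equiv> ren (apfst (map g))"

lemma finite_letters: "finite (letters p)"
  by (simp add: letters_def finite_vars)

lemma letters_cforms: "p \<in> cforms L C (lists X \<times> D) \<Longrightarrow> letters p \<subseteq> X"
  using vars_cforms[of p L C "lists X \<times> D"] by (fastforce simp: letters_def)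

lemma relabel_cforms:
  assumes "p \<in> cforms L C (lists X \<times> D)" "g ` X \<subseteq> Y"
  shows "relabel g p \<in> cforms L C (lists Y \<times> D)"
proof -
  have "apfst (map g) ` vars p \<subseteq> lists Y \<times> D"
    using vars_cforms[OF assms(1)] assms(2) by fastforce
  then show ?thesis using assms(1) by (rule ren_cforms[rotated])
qed

lemma holds_relabel_cong:
  assumes "\<And>x. x \<in> letters p \<Longrightarrow> g x = h x"
  shows "holds M v (relabel g p) \<longleftrightarrow> holds M v (relabel h p)"
  unfolding holds_ren
proof (rule holds_cong)
  fix x assume x: "x \<in> vars p"
  then have "map g (fst x) = map h (fst x)"
    using assms x by (auto simp: letters_def)
  then show "(v \<circ> apfst (map g)) x = (v \<circ> apfst (map h)) x" by (cases x) (simp del: map_eq_conv)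
qed

lemma relabel_relabel: "relabel h (relabel g p) = relabel (h \<circ> g) p"
proof -
  have "map_sum (apfst (map h)) id \<circ> map_sum (apfst (map g)) id = map_sum (apfst (map (h \<circ> g))) id"
    by (rule ext) (auto split: sum.splits simp: map_sum_def split: sum.split)
  then show ?thesis unfolding sub_def by (metis comp_assoc fst_conv snd_conv)
qed

context monster_model
begin

text \<open>In a pair \<open>(n, p)\<close> the letters of \<open>p\<close> are less than \<open>n\<close>. The bound is recorded because an increasing
  map on the letters of \<open>p\<close> need not extend to \<open>{..<n}\<close>.\<close>

definition realizes ::
    "'x set \<Rightarrow> ('x \<Rightarrow> 'x \<Rightarrow> bool) \<Rightarrow> ('x list \<times> 'd \<Rightarrow> 'a) \<Rightarrow>
      (nat \<times> ('f, 'r, nat list \<times> 'd, 'a) cform) set \<Rightarrow> bool" where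
  "realizes X lt v \<Sigma> \<longleftrightarrow> range v \<subseteq> carrier M \<and>
     (\<forall>(n, p) \<in> \<Sigma>. \<forall>g. monotone_on {..<n} (<) lt g \<longrightarrow> g ` {..<n} \<subseteq> X \<longrightarrow> holds M v (relabel g p))"

end

section \<open>Compactness and maximal sets of formulas along linear orders\<close>

locale skeleton = monster_model K L T M
  for K :: "'k set" and L :: "('f, 'r) lang" and T :: "('f, 'r) hsent set"
    and M :: "('a, 'f, 'r) struc" +
  fixes C :: "'a set" and D :: "'d set"
  assumes C: "C \<subseteq> carrier M" "C \<prec> K" and D: "D \<prec> K" "D \<noteq> {}"
begin

definition nforms :: "(nat \<times> ('f, 'r, nat list \<times> 'd, 'a) cform) set" where
  "nforms = {(n, p). p \<in> cforms L C (lists {..<n} \<times> D)}"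

text \<open>Compactness: the variables are words over the small set \<open>X\<close>, so saturation
  applies, and finitely many instances involve only finitely many elements of
  \<open>\<Sigma>\<close> and of \<open>X\<close>.\<close>

lemma stretch_finite:
  fixes X :: "'x set" and \<Sigma> :: "(nat \<times> ('f, 'r, nat list \<times> 'd, 'a) cform) set"
  assumes X: "X \<prec> K" and \<Sigma>: "\<Sigma> \<subseteq> nforms"
    and fin: "\<And>\<Sigma>\<^sub>0 Z. finite \<Sigma>\<^sub>0 \<Longrightarrow> \<Sigma>\<^sub>0 \<subseteq> \<Sigma> \<Longrightarrow> finite Z \<Longrightarrow> Z \<subseteq> X \<Longrightarrow> \<exists>w. realizes Z lt w \<Sigma>\<^sub>0"
  shows "\<exists>v. realizes X lt v \<Sigma>"
proof -
  define I where "I = {((n, p), g). (n, p) \<in> \<Sigma> \<and> monotone_on {..<n} (<) lt g \<and> g ` {..<n} \<subseteq> X}"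
  define form :: "_ \<Rightarrow> ('f, 'r, 'x list \<times> 'd, 'a) cform" where
    "form i = relabel (snd i) (snd (fst i))" for i :: "(nat \<times> ('f, 'r, nat list \<times> 'd, 'a) cform) \<times> (nat \<Rightarrow> 'x)"
  have small: "lists X \<times> D \<prec> K" using X D by (simp add: small)
  have forms: "form ` I \<subseteq> cforms L C (lists X \<times> D)"
    using \<Sigma> relabel_cforms by (fastforce simp: I_def form_def nforms_def)
  have fin: "\<exists>v. range v \<subseteq> carrier M \<and> (\<forall>q \<in> Q. holds M v q)" if "finite Q" "Q \<subseteq> form ` I" for Q
  proof -
    obtain I\<^sub>0 where I\<^sub>0: "I\<^sub>0 \<subseteq> I" "finite I\<^sub>0" "Q = form ` I\<^sub>0"
      using finite_subset_image[OF \<open>finite Q\<close> \<open>Q \<subseteq> form ` I\<close>] by blast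
    let ?Z = "\<Union>((n, p), g) \<in> I\<^sub>0. g ` {..<n}"
    have "\<exists>w. realizes ?Z lt w (fst ` I\<^sub>0)"
      using I\<^sub>0 by (intro fin) (auto simp: I_def split: prod.splits)
    then obtain w where w: "realizes ?Z lt w (fst ` I\<^sub>0)" by blast
    have "holds M w (form ((n, p), g))" if i: "((n, p), g) \<in> I\<^sub>0" for n p g
    proof -
      have "(n, p) \<in> fst ` I\<^sub>0" using i by force
      moreover have "monotone_on {..<n} (<) lt g" using i I\<^sub>0(1) by (auto simp: I_def)
      moreover have "g ` {..<n} \<subseteq> ?Z" using i by (auto intro!: bexI[of _ "((n, p), g)"])
      ultimately show ?thesis using w unfolding realizes_def form_def by fastforce
    qed
    then have "\<forall>i \<in> I\<^sub>0. holds M w (form i)" by (metis prod.collapse)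
    then show ?thesis using w I\<^sub>0(3) unfolding realizes_def by (intro exI[of _ w]) simp
  qed
  obtain v where v: "range v \<subseteq> carrier M" "\<forall>q \<in> form ` I. holds M v q"
    by (rule realize[OF small C forms fin])
  have "holds M v (relabel g p)"
    if "(n, p) \<in> \<Sigma>" "monotone_on {..<n} (<) lt g" "g ` {..<n} \<subseteq> X" for n p g
  proof -
    have "((n, p), g) \<in> I" using that by (simp add: I_def)
    then have "holds M v (form ((n, p), g))" using v(2) by blast
    then show ?thesis by (simp add: form_def)
  qed
  then have "realizes X lt v \<Sigma>" using v(1) unfolding realizes_def by auto
  then show ?thesis by blast
qed

text \<open>Every finite piece of \<open>Y\<close> embeds in the infinite order on \<open>X\<close>;
  pulling the realization back along the embedding serves for this piece, and compactness does the
  rest.\<close>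

lemma stretch:
  fixes X :: "'x set" and Y :: "'y set"
  assumes v: "realizes X lt v \<Sigma>" and X: "infinite X" "linear_on X lt"
    and \<Sigma>: "\<Sigma> \<subseteq> nforms" and Y: "Y \<prec> K" "linear_on Y lt'"
  shows "\<exists>w. realizes Y lt' w \<Sigma>"
proof (rule stretch_finite[OF Y(1) \<Sigma>])
  fix \<Sigma>\<^sub>0 Z assume \<Sigma>\<^sub>0: "\<Sigma>\<^sub>0 \<subseteq> \<Sigma>" and Z: "finite Z" "Z \<subseteq> Y"
  obtain \<epsilon> where \<epsilon>: "monotone_on Z lt' lt \<epsilon>" "\<epsilon> ` Z \<subseteq> X"
    using embed_finite[OF Z(1) linear_on_subset[OF Y(2) Z(2)] X] .
  have "holds M (v \<circ> apfst (map \<epsilon>)) (relabel g p)"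
    if "(n, p) \<in> \<Sigma>\<^sub>0" "monotone_on {..<n} (<) lt' g" "g ` {..<n} \<subseteq> Z" for n p g
  proof -
    have "monotone_on {..<n} (<) lt (\<epsilon> \<circ> g)" by (rule monotone_on_compose[OF that(2) \<epsilon>(1) that(3)])
    moreover have "(\<epsilon> \<circ> g) ` {..<n} \<subseteq> X" using \<epsilon>(2) that(3) by auto
    ultimately have "holds M v (relabel (\<epsilon> \<circ> g) p)"
      using v that(1) \<Sigma>\<^sub>0 unfolding realizes_def by blast
    then show ?thesis by (simp only: holds_ren[symmetric] relabel_relabel)
  qed
  then have "realizes Z lt' (v \<circ> apfst (map \<epsilon>)) \<Sigma>\<^sub>0"
    using v unfolding realizes_def by auto
  then show "\<exists>w. realizes Z lt' w \<Sigma>\<^sub>0" by blast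
qed

text \<open>Zorn's lemma: a finite part of the union of a chain lies in one member, so compactness
  realizes the union.\<close>

lemma maximal_exists:
  assumes "\<Sigma>\<^sub>0 \<subseteq> nforms" "realizes (UNIV :: nat set) (<) v\<^sub>0 \<Sigma>\<^sub>0"
  obtains \<Sigma> v where "\<Sigma>\<^sub>0 \<subseteq> \<Sigma>" "\<Sigma> \<subseteq> nforms" "realizes (UNIV :: nat set) (<) v \<Sigma>"
    "\<And>\<Sigma>' v'. \<Sigma> \<subseteq> \<Sigma>' \<Longrightarrow> \<Sigma>' \<subseteq> nforms \<Longrightarrow> realizes (UNIV :: nat set) (<) v' \<Sigma>' \<Longrightarrow> \<Sigma>' = \<Sigma>"
proof -
  let ?F = "{\<Sigma>. \<Sigma>\<^sub>0 \<subseteq> \<Sigma> \<and> \<Sigma> \<subseteq> nforms \<and> (\<exists>v. realizes (UNIV :: nat set) (<) v \<Sigma>)}"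
  have "\<exists>\<Sigma> \<in> ?F. \<forall>\<Sigma>' \<in> ?F. \<Sigma> \<subseteq> \<Sigma>' \<longrightarrow> \<Sigma>' = \<Sigma>"
  proof (rule subset_Zorn_nonempty)
    show "?F \<noteq> {}" using assms by blast
    fix \<C> assume ne: "\<C> \<noteq> {}" and chain: "subset.chain ?F \<C>"
    have F: "\<C> \<subseteq> ?F" using chain by (simp add: subset.chain_def)
    have "\<exists>v. realizes (UNIV :: nat set) (<) v (\<Union>\<C>)"
    proof (rule stretch_finite)
      show "\<Union>\<C> \<subseteq> nforms" using F by blast
      fix \<Sigma>\<^sub>1 and Z :: "nat set" assume "finite \<Sigma>\<^sub>1" "\<Sigma>\<^sub>1 \<subseteq> \<Union>\<C>"
      then obtain \<Sigma> where "\<Sigma> \<in> \<C>" "\<Sigma>\<^sub>1 \<subseteq> \<Sigma>"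
        using finite_subset_Union_chain[OF _ _ ne chain] by blast
      moreover from this obtain v where "realizes (UNIV :: nat set) (<) v \<Sigma>" using F by blast
      ultimately have "realizes Z (<) v \<Sigma>\<^sub>1" unfolding realizes_def by blast
      then show "\<exists>v. realizes Z (<) v \<Sigma>\<^sub>1" by blast
    qed (simp add: small)
    then show "\<Union>\<C> \<in> ?F" using F ne by blast
  qed
  then obtain \<Sigma> where \<Sigma>: "\<Sigma> \<in> ?F" and max: "\<forall>\<Sigma>' \<in> ?F. \<Sigma> \<subseteq> \<Sigma>' \<longrightarrow> \<Sigma>' = \<Sigma>" by blast
  then obtain v where v: "realizes (UNIV :: nat set) (<) v \<Sigma>" by blast
  have "\<Sigma>' = \<Sigma>" if "\<Sigma> \<subseteq> \<Sigma>'" "\<Sigma>' \<subseteq> nforms" "realizes (UNIV :: nat set) (<) v' \<Sigma>'" for \<Sigma>' v'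
    using max \<Sigma> that by blast
  then show ?thesis using that[of \<Sigma> v] \<Sigma> v by blast
qed

text \<open>Colour the increasing \<open>n\<close>-tuples of a long realization by \<open>p\<close> itself, if it holds, and by a
  formula contradicting \<open>p\<close> otherwise. A homogeneous set shows that the colour can be added.\<close>

lemma maximal_complete:
  assumes \<Sigma>: "\<Sigma> \<subseteq> nforms" "realizes (UNIV :: nat set) (<) v \<Sigma>"
    and max: "\<And>\<Sigma>' v'. \<Sigma> \<subseteq> \<Sigma>' \<Longrightarrow> \<Sigma>' \<subseteq> nforms \<Longrightarrow> realizes (UNIV :: nat set) (<) v' \<Sigma>' \<Longrightarrow> \<Sigma>' = \<Sigma>"
    and p: "p \<in> cforms L C (lists {..<n} \<times> D)" and d: "d \<in> D"
  shows "\<exists>\<chi>. wf_pform L \<chi> \<and> (\<chi> = fst p \<or> contradictory L T (fst p) \<chi>) \<and>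
    (n, variant ([], d) p \<chi>) \<in> \<Sigma>"
proof -
  let ?Col = "{\<chi>. wf_pform L \<chi>}"
  have "Top \<in> ?Col" by simp
  then obtain X :: "'k set" where X: "X \<prec> K" "infinite X"
    and hom: "\<And>f. range f \<subseteq> ?Col \<Longrightarrow> \<exists>H \<subseteq> X. infinite H \<and> (\<exists>c. \<forall>s \<in> nsets H n. f s = c)"
    using erdos_rado[OF K small_formulas] by (metis empty_iff)
  obtain lt :: "'k \<Rightarrow> 'k \<Rightarrow> bool" where "linear_on UNIV lt" using linear_on_exists by blast
  then have lin: "linear_on Y lt" for Y using linear_on_subset by blast
  obtain w where w: "realizes X lt w \<Sigma>"
    using stretch[OF \<Sigma>(2) _ linear_on_nat \<Sigma>(1) X(1) lin] by auto
  have wM: "range w \<subseteq> carrier M" using w by (simp add: realizes_def)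
  \<comment> \<open>The increasing enumeration of \<open>s\<close>, turning a set into the
    increasing tuple to be coloured.\<close>
  define en where "en s = inv_into s (rank s lt)" for s
  define good where "good s \<chi> \<longleftrightarrow> wf_pform L \<chi> \<and> (\<chi> = fst p \<or> contradictory L T (fst p) \<chi>) \<and>
    holds M w (relabel (en s) (variant ([], d) p \<chi>))" for s \<chi>
  have ex: "\<exists>\<chi>. good s \<chi>" if "s \<in> nsets X n" for s
  proof (cases "holds M w (relabel (en s) p)")
    case True
    then have "holds M w (variant ([], d) (relabel (en s) p) (fst p))"
      using holds_variant_self[of M w "([], d)" "relabel (en s) p"] by simp
    then have "good s (fst p)" using p by (simp add: good_def ren_variant cforms_iff)
    then show ?thesis by blast
  next
    case False
    have sp: "relabel (en s) p \<in> cforms L C (lists UNIV \<times> D)" using p by (rule relabel_cforms) simp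
    obtain \<psi> where "wf_pform L \<psi>" "contradictory L T (fst p) \<psi>"
      "holds M w (variant ([], d) (relabel (en s) p) \<psi>)"
      by (rule refuted[OF sp C(1) wM False, unfolded fst_sub])
    then show ?thesis by (auto simp: good_def ren_variant)
  qed
  define f where "f s = (if s \<in> nsets X n then SOME \<chi>. good s \<chi> else Top)" for s
  have f: "good s (f s)" if "s \<in> nsets X n" for s
    using someI_ex[OF ex[OF that]] that by (simp add: f_def)
  have "f s \<in> ?Col" for s
    using f[of s] by (cases "s \<in> nsets X n") (simp_all add: good_def f_def)
  then have "\<exists>H \<subseteq> X. infinite H \<and> (\<exists>c. \<forall>s \<in> nsets H n. f s = c)" by (intro hom) blast
  then obtain H \<chi> where H: "H \<subseteq> X" "infinite H" and f\<chi>: "\<And>s. s \<in> nsets H n \<Longrightarrow> f s = \<chi>"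
    by blast
  have good: "good s \<chi>" if "s \<in> nsets H n" for s
    using f[of s] f\<chi>[OF that] that nsets_mono[OF H(1), of n] by auto
  have "nsets H n \<noteq> {}" using H(2) by (simp add: nsets_eq_empty_iff)
  then have \<chi>: "wf_pform L \<chi>" "\<chi> = fst p \<or> contradictory L T (fst p) \<chi>"
    using good by (auto simp: good_def)
  let ?q = "variant ([], d) p \<chi>"
  have q: "?q \<in> cforms L C (lists {..<n} \<times> D)" using p d \<chi>(1) by (intro variant_cforms) auto
  have "holds M w (relabel g ?q)" if g: "monotone_on {..<n} (<) lt g" "g ` {..<n} \<subseteq> H" for g
  proof -
    let ?s = "g ` {..<n}"
    have inj: "inj_on g {..<n}" using monotone_on_inj[OF linear_on_nat lin g(1)] by blast
    then have s: "?s \<in> nsets H n" using g(2) by (simp add: nsets_def card_image)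
    have "en ?s i = g i" if "i < n" for i
    proof -
      have "rank ?s lt (g i) = rank {..<n} (<) i"
        using rank_monotone_image[OF linear_on_nat lin g(1)] that by blast
      also have "\<dots> = i"
      proof -
        have "{y \<in> {..<n}. y < i} = {..<i}" using that by auto
        then show ?thesis by (simp add: rank_def)
      qed
      finally have "rank ?s lt (g i) = i" .
      moreover have "inj_on (rank ?s lt) ?s" using rank_inj[OF _ lin] by blast
      ultimately show ?thesis unfolding en_def using that by (metis imageI inv_into_f_f lessThan_iff)
    qed
    then have "holds M w (relabel g ?q) \<longleftrightarrow> holds M w (relabel (en ?s) ?q)"
      using letters_cforms[OF q] by (intro holds_relabel_cong) auto
    then show ?thesis using good[OF s] by (simp add: good_def)
  qed
  \<comment> \<open>Along the infinite set \<open>H\<close> the old formulas persist and the new one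
    is added; stretching back to the natural numbers makes maximality applicable.\<close>
  then have "realizes H lt w (insert (n, ?q) \<Sigma>)"
    using w H(1) unfolding realizes_def by blast
  moreover have ins: "insert (n, ?q) \<Sigma> \<subseteq> nforms" using \<Sigma>(1) q by (simp add: nforms_def)
  ultimately obtain v' where "realizes (UNIV :: nat set) (<) v' (insert (n, ?q) \<Sigma>)"
    using stretch[OF _ H(2) lin _ _ linear_on_nat] small(1) by (metis countableI_type)
  then have "insert (n, ?q) \<Sigma> = \<Sigma>" using max ins by blast
  then show ?thesis using \<chi> by blast
qed

text \<open>The maximal set is grown from everything that \<open>a\<close> satisfies under all
  increasing reindexings, which gives the last clause; completeness gives the invariance.
  \<open>Y\<close> may exceed the letters of \<open>p\<close>, so that the hypothesis is required
  only for relabellings that extend increasingly to \<open>Y\<close>.\<close>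

lemma skeleton_indiscernible:
  fixes a :: "nat list \<times> 'd \<Rightarrow> 'a" and X :: "'x set"
  assumes a: "range a \<subseteq> carrier M" and X: "X \<prec> K" "linear_on X lt"
  obtains b :: "'x list \<times> 'd \<Rightarrow> 'a" where "range b \<subseteq> carrier M"
    "\<And>p h. p \<in> cforms L C (lists X \<times> D) \<Longrightarrow> monotone_on (letters p) lt lt h \<Longrightarrow>
      h ` letters p \<subseteq> X \<Longrightarrow> holds M b (relabel h p) \<longleftrightarrow> holds M b p"
    "\<And>p Y. p \<in> cforms L C (lists X \<times> D) \<Longrightarrow> finite Y \<Longrightarrow> letters p \<subseteq> Y \<Longrightarrow> Y \<subseteq> X \<Longrightarrow>
      (\<And>h :: 'x \<Rightarrow> nat. monotone_on Y lt (<) h \<Longrightarrow> holds M a (relabel h p)) \<Longrightarrow> holds M b p"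
proof -
  define \<Sigma>\<^sub>0 where "\<Sigma>\<^sub>0 = {(n, p) \<in> nforms.
    \<forall>g :: nat \<Rightarrow> nat. monotone_on {..<n} (<) (<) g \<longrightarrow> holds M a (relabel g p)}"
  have "realizes (UNIV :: nat set) (<) a \<Sigma>\<^sub>0" using a by (auto simp: realizes_def \<Sigma>\<^sub>0_def)
  moreover have "\<Sigma>\<^sub>0 \<subseteq> nforms" by (auto simp: \<Sigma>\<^sub>0_def)
  ultimately obtain \<Sigma> v where \<Sigma>: "\<Sigma>\<^sub>0 \<subseteq> \<Sigma>" "\<Sigma> \<subseteq> nforms" "realizes (UNIV :: nat set) (<) v \<Sigma>"
    and max: "\<And>\<Sigma>' v'. \<Sigma> \<subseteq> \<Sigma>' \<Longrightarrow> \<Sigma>' \<subseteq> nforms \<Longrightarrow> realizes (UNIV :: nat set) (<) v' \<Sigma>' \<Longrightarrow> \<Sigma>' = \<Sigma>"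
    using maximal_exists by metis
  obtain b where b: "realizes X lt b \<Sigma>"
    using stretch[OF \<Sigma>(3) _ linear_on_nat \<Sigma>(2) X] by auto
  have bM: "range b \<subseteq> carrier M" using b by (simp add: realizes_def)
  obtain d where d: "d \<in> D" using D by blast
  \<comment> \<open>The right-hand side does not mention \<open>g\<close>, so all increasing
    instances of a formula have the same truth value.\<close>
  have complete: "holds M b (relabel g p) \<longleftrightarrow> (n, variant ([], d) p (fst p)) \<in> \<Sigma>"
    if p: "p \<in> cforms L C (lists {..<n} \<times> D)"
      and g: "monotone_on {..<n} (<) lt g" "g ` {..<n} \<subseteq> X" for n p g
  proof -
    have r: "holds M b (variant ([], d) (relabel g p) \<chi>)" if "(n, variant ([], d) p \<chi>) \<in> \<Sigma>" for \<chi>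
    proof -
      have "holds M b (relabel g (variant ([], d) p \<chi>))"
        using b g that unfolding realizes_def by blast
      then show ?thesis by (simp add: ren_variant)
    qed
    have gp: "relabel g p \<in> cforms L C (lists X \<times> D)" using p g(2) by (rule relabel_cforms)
    have "\<exists>\<chi>. wf_pform L \<chi> \<and> (\<chi> = fst p \<or> contradictory L T (fst p) \<chi>) \<and>
        (n, variant ([], d) p \<chi>) \<in> \<Sigma>"
      by (rule maximal_complete[OF \<Sigma>(2,3) max p d])
    then obtain \<chi> where \<chi>: "wf_pform L \<chi>" "\<chi> = fst p \<or> contradictory L T (fst p) \<chi>"
      "(n, variant ([], d) p \<chi>) \<in> \<Sigma>" by blast
    show ?thesis
    proof
      assume "holds M b (relabel g p)"
      then have "\<not> contradictory L T (fst p) \<chi>"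
        using not_both[OF gp C(1) bM \<chi>(1) _ r[OF \<chi>(3)]] by auto
      then show "(n, variant ([], d) p (fst p)) \<in> \<Sigma>" using \<chi> by auto
    next
      assume "(n, variant ([], d) p (fst p)) \<in> \<Sigma>"
      then show "holds M b (relabel g p)"
        using r[of "fst p"] holds_variant_self[of M b "([], d)" "relabel g p"] by simp
    qed
  qed
  \<comment> \<open>A formula over \<open>X\<close> becomes one over numbers through the ranks in
    \<open>Y\<close>; composing with the enumeration of \<open>Y\<close> undoes this for every
    further relabelling.\<close>
  have pull: "\<exists>q. q \<in> cforms L C (lists {..<card Y} \<times> D) \<and> q = relabel (rank Y lt) p \<and>
      (\<forall>(v :: 'x list \<times> 'd \<Rightarrow> 'a) h. holds M v (relabel (h \<circ> inv_into Y (rank Y lt)) q) = holds M v (relabel h p))"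
    if p: "p \<in> cforms L C (lists X \<times> D)" and Y: "finite Y" "letters p \<subseteq> Y" "Y \<subseteq> X" for p Y
  proof -
    note lin = linear_on_subset[OF X(2) Y(3)]
    have "p \<in> cforms L C (lists Y \<times> D)"
      using p Y(2) vars_cforms[OF p] by (intro cforms_mono[OF p]) (fastforce simp: letters_def)
    then have "relabel (rank Y lt) p \<in> cforms L C (lists {..<card Y} \<times> D)"
      using rank_image[OF Y(1) lin] by (intro relabel_cforms) auto
    moreover have "holds M v (relabel (h \<circ> inv_into Y (rank Y lt)) (relabel (rank Y lt) p)) =
      holds M v (relabel h p)" for v :: "'x list \<times> 'd \<Rightarrow> 'a" and h
      unfolding relabel_relabel using Y(2) rank_inj[OF Y(1) lin]
      by (intro holds_relabel_cong) auto
    ultimately show ?thesis by blast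
  qed
  show ?thesis
  proof (rule that[OF bM])
    fix p h assume p: "p \<in> cforms L C (lists X \<times> D)" and h: "monotone_on (letters p) lt lt h"
      "h ` letters p \<subseteq> X"
    let ?Y = "letters p"
    have Y: "finite ?Y" "?Y \<subseteq> X" using letters_cforms[OF p] finite_letters by blast+
    note lin = linear_on_subset[OF X(2) Y(2)]
    obtain q where q: "q \<in> cforms L C (lists {..<card ?Y} \<times> D)"
      "\<And>(v :: 'x list \<times> 'd \<Rightarrow> 'a) h. holds M v (relabel (h \<circ> inv_into ?Y (rank ?Y lt)) q) = holds M v (relabel h p)"
      using pull[OF p Y(1) subset_refl Y(2)] by blast
    let ?e = "inv_into ?Y (rank ?Y lt)"
    have e: "monotone_on {..<card ?Y} (<) lt ?e" "?e ` {..<card ?Y} \<subseteq> ?Y"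
      using rank_inv_mono[OF Y(1) lin] rank_inv[OF Y(1) lin] by auto
    have "holds M b (relabel (h \<circ> ?e) q) \<longleftrightarrow> (card ?Y, variant ([], d) q (fst q)) \<in> \<Sigma>"
      using e h by (intro complete[OF q(1)] monotone_on_compose[OF e(1) h(1)]) auto
    moreover have "holds M b (relabel (id \<circ> ?e) q) \<longleftrightarrow> (card ?Y, variant ([], d) q (fst q)) \<in> \<Sigma>"
      using e Y(2) by (intro complete[OF q(1)]) auto
    ultimately have "holds M b (relabel h p) \<longleftrightarrow> holds M b (relabel id p)" unfolding q(2) by blast
    then show "holds M b (relabel h p) \<longleftrightarrow> holds M b p" by (simp add: holds_ren)
  next
    fix p Y assume p: "p \<in> cforms L C (lists X \<times> D)" and Y: "finite Y" "letters p \<subseteq> Y" "Y \<subseteq> X"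
      and hyp: "\<And>h :: 'x \<Rightarrow> nat. monotone_on Y lt (<) h \<Longrightarrow> holds M a (relabel h p)"
    note lin = linear_on_subset[OF X(2) Y(3)]
    obtain q where q: "q \<in> cforms L C (lists {..<card Y} \<times> D)" "q = relabel (rank Y lt) p"
      "\<And>(v :: 'x list \<times> 'd \<Rightarrow> 'a) h. holds M v (relabel (h \<circ> inv_into Y (rank Y lt)) q) = holds M v (relabel h p)"
      using pull[OF p Y] by blast
    let ?e = "inv_into Y (rank Y lt)"
    have e: "monotone_on {..<card Y} (<) lt ?e" "?e ` {..<card Y} \<subseteq> Y"
      using rank_inv_mono[OF Y(1) lin] rank_inv[OF Y(1) lin] by auto
    have "holds M a (relabel g q)" if "monotone_on {..<card Y} (<) (<) g" for g :: "nat \<Rightarrow> nat"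
      unfolding q(2) relabel_relabel using rank_mono[OF Y(1) lin] rank_image[OF Y(1) lin] that
      by (intro hyp monotone_on_compose) auto
    then have "(card Y, q) \<in> \<Sigma>" using q(1) \<Sigma>(1) by (auto simp: \<Sigma>\<^sub>0_def nforms_def)
    then have "holds M b (relabel (id \<circ> ?e) q)"
      using b e Y(3) unfolding realizes_def by fastforce
    then show "holds M b p" unfolding q(3) by (simp add: holds_ren)
  qed
qed

end


section \<open>Quantifier-free types in the tree\<close>

definition mt :: "nat list \<Rightarrow> nat list \<Rightarrow> nat" where
  "mt \<eta> \<nu> = length (longest_common_prefix \<eta> \<nu>)"

lemma take_mt: "take (mt \<eta> \<nu>) \<eta> = longest_common_prefix \<eta> \<nu>" "take (mt \<eta> \<nu>) \<nu> = longest_common_prefix \<eta> \<nu>"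
  unfolding mt_def using longest_common_prefix_prefix1[of \<eta> \<nu>] longest_common_prefix_prefix2[of \<eta> \<nu>]
  by (metis append_eq_conv_conj prefix_def)+

lemma le_mt_iff: "n \<le> mt \<eta> \<nu> \<longleftrightarrow> n \<le> length \<eta> \<and> n \<le> length \<nu> \<and> take n \<eta> = take n \<nu>"
proof
  assume n: "n \<le> mt \<eta> \<nu>"
  have "mt \<eta> \<nu> \<le> length \<eta>" "mt \<eta> \<nu> \<le> length \<nu>"
    unfolding mt_def by (auto intro: prefix_length_le longest_common_prefix_prefix1 longest_common_prefix_prefix2)
  moreover have "take n (take (mt \<eta> \<nu>) \<eta>) = take n (take (mt \<eta> \<nu>) \<nu>)" by (simp only: take_mt)
  ultimately show "n \<le> length \<eta> \<and> n \<le> length \<nu> \<and> take n \<eta> = take n \<nu>" using n by (simp add: min_def)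
next
  assume n: "n \<le> length \<eta> \<and> n \<le> length \<nu> \<and> take n \<eta> = take n \<nu>"
  then have "prefix (take n \<eta>) (longest_common_prefix \<eta> \<nu>)"
    using longest_common_prefix_max_prefix take_is_prefix by metis
  then have "length (take n \<eta>) \<le> mt \<eta> \<nu>" unfolding mt_def by (rule prefix_length_le)
  then show "n \<le> mt \<eta> \<nu>" using n by simp
qed

lemma mt_le: "mt \<eta> \<nu> \<le> length \<eta>" "mt \<eta> \<nu> \<le> length \<nu>"
  using le_mt_iff by blast+

lemma mt_self [simp]: "mt \<eta> \<eta> = length \<eta>"
  using le_mt_iff[of "length \<eta>" \<eta> \<eta>] mt_le(1)[of \<eta> \<eta>] by simp

lemma mt_commute: "mt \<eta> \<nu> = mt \<nu> \<eta>"
  by (metis le_mt_iff order_antisym order_refl)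

lemma nth_mt: "i < mt \<eta> \<nu> \<Longrightarrow> \<eta> ! i = \<nu> ! i"
  by (metis le_mt_iff nth_take order_refl)

lemma nth_mt_neq: "mt \<eta> \<nu> < length \<eta> \<Longrightarrow> mt \<eta> \<nu> < length \<nu> \<Longrightarrow> \<eta> ! mt \<eta> \<nu> \<noteq> \<nu> ! mt \<eta> \<nu>"
  using le_mt_iff[of "Suc (mt \<eta> \<nu>)" \<eta> \<nu>] le_mt_iff[of "mt \<eta> \<nu>" \<eta> \<nu>] by (auto simp: take_Suc_conv_app_nth)

lemma mt_eqI:
  assumes "m \<le> length \<eta>" "m \<le> length \<nu>" "\<And>i. i < m \<Longrightarrow> \<eta> ! i = \<nu> ! i"
    and "m < length \<eta> \<Longrightarrow> m < length \<nu> \<Longrightarrow> \<eta> ! m \<noteq> \<nu> ! m"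
  shows "mt \<eta> \<nu> = m"
proof -
  have "m \<le> mt \<eta> \<nu>" unfolding le_mt_iff using assms(1-3) by (auto intro: nth_equalityI)
  moreover have "\<not> m < mt \<eta> \<nu>" using assms(4) nth_mt[of m \<eta> \<nu>] mt_le[of \<eta> \<nu>] by force
  ultimately show ?thesis by simp
qed

lemma lex_less_iff:
  "lex_less \<eta> \<nu> \<longleftrightarrow> (mt \<eta> \<nu> = length \<eta> \<and> mt \<eta> \<nu> < length \<nu>) \<or>
     (mt \<eta> \<nu> < length \<eta> \<and> mt \<eta> \<nu> < length \<nu> \<and> \<eta> ! mt \<eta> \<nu> < \<nu> ! mt \<eta> \<nu>)"
proof -
  have "prefix \<eta> \<nu> \<longleftrightarrow> mt \<eta> \<nu> = length \<eta>"
  proof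
    assume "prefix \<eta> \<nu>"
    then have "length \<eta> \<le> mt \<eta> \<nu>" unfolding le_mt_iff by (auto simp: prefix_def)
    then show "mt \<eta> \<nu> = length \<eta>" using mt_le(1)[of \<eta> \<nu>] by simp
  next
    assume "mt \<eta> \<nu> = length \<eta>"
    then have "take (length \<eta>) \<nu> = \<eta>" using take_mt[of \<eta> \<nu>] by simp
    then show "prefix \<eta> \<nu>" by (metis take_is_prefix)
  qed
  then have 1: "strict_prefix \<eta> \<nu> \<longleftrightarrow> mt \<eta> \<nu> = length \<eta> \<and> mt \<eta> \<nu> < length \<nu>"
    using mt_le(2)[of \<eta> \<nu>] prefix_length_less[of \<eta> \<nu>] by (auto simp: strict_prefix_def)
  have "\<gamma> = mt \<eta> \<nu>"
    if "\<gamma> < min (length \<eta>) (length \<nu>)" "take \<gamma> \<eta> = take \<gamma> \<nu>" "\<eta> ! \<gamma> < \<nu> ! \<gamma>" for \<gamma>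
    using that le_mt_iff[of \<gamma> \<eta> \<nu>] nth_mt[of \<gamma> \<eta> \<nu>] by force
  moreover have "take (mt \<eta> \<nu>) \<eta> = take (mt \<eta> \<nu>) \<nu>" by (simp add: take_mt)
  ultimately have "(\<exists>\<gamma> < min (length \<eta>) (length \<nu>). take \<gamma> \<eta> = take \<gamma> \<nu> \<and> \<eta> ! \<gamma> < \<nu> ! \<gamma>) \<longleftrightarrow>
      mt \<eta> \<nu> < length \<eta> \<and> mt \<eta> \<nu> < length \<nu> \<and> \<eta> ! mt \<eta> \<nu> < \<nu> ! mt \<eta> \<nu>"
    by (auto intro: exI[of _ "mt \<eta> \<nu>"])
  with 1 show ?thesis unfolding lex_less_def by (rule arg_cong2)
qed

text \<open>The initial segments of one node form a chain, so comparing lengths selects one of three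
  meets of two given nodes. Hence all terms of the language reduce to meets of two
  variables.\<close>

lemma meet_meet:
  "longest_common_prefix (longest_common_prefix x y) (longest_common_prefix z w) =
    (if mt x y \<le> mt z w \<and> mt x y \<le> mt x z then longest_common_prefix x y
     else if mt z w \<le> mt x z then longest_common_prefix z w
     else longest_common_prefix x z)" (is "?lhs = ?rhs")
proof -
  let ?a = "longest_common_prefix x y" and ?b = "longest_common_prefix z w"
  have ab: "?a = take (mt x y) x" "?b = take (mt z w) z" by (simp_all add: take_mt)
  have len: "length ?a = mt x y" "length ?b = mt z w" by (simp_all add: mt_def)
  have le: "n \<le> mt ?a ?b \<longleftrightarrow> n \<le> mt x y \<and> n \<le> mt z w \<and> n \<le> mt x z" for n
  proof (cases "n \<le> mt x y \<and> n \<le> mt z w")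
    case True
    then have "take n ?a = take n x" "take n ?b = take n z"
      unfolding ab by (simp_all add: min_def)
    moreover have "n \<le> length x" "n \<le> length z" using True mt_le le_trans by blast+
    ultimately show ?thesis using True by (simp add: le_mt_iff[of n ?a] le_mt_iff[of n x z] len)
  next
    case False
    then show ?thesis using mt_le[of ?a ?b] unfolding len by auto
  qed
  have m: "mt ?a ?b = min (mt x y) (min (mt z w) (mt x z))"
  proof (rule order_antisym)
    show "mt ?a ?b \<le> min (mt x y) (min (mt z w) (mt x z))" using le[of "mt ?a ?b"] by simp
    show "min (mt x y) (min (mt z w) (mt x z)) \<le> mt ?a ?b"
      unfolding le by (auto simp: min_le_iff_disj)
  qed
  have lhs: "?lhs = take (mt ?a ?b) ?a" "?lhs = take (mt ?a ?b) ?b" by (simp_all only: take_mt)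
  consider "mt x y \<le> mt z w \<and> mt x y \<le> mt x z" | "\<not> (mt x y \<le> mt z w \<and> mt x y \<le> mt x z)" "mt z w \<le> mt x z"
    | "\<not> (mt x y \<le> mt z w \<and> mt x y \<le> mt x z)" "\<not> mt z w \<le> mt x z" by blast
  then show ?thesis
  proof cases
    case 1
    then have "?lhs = ?a" using lhs(1) m len by (simp add: min_def)
    then show ?thesis using 1 by simp
  next
    case 2
    then have "mt ?a ?b = length ?b" using m len by (auto simp: min_def)
    then have "?lhs = ?b" using lhs(2) by simp
    then show ?thesis using 2 by simp
  next
    case 3
    then have "mt ?a ?b = mt x z" using m by (auto simp: min_def)
    moreover have "mt x z \<le> mt x y" using 3 by auto
    ultimately have "?lhs = take (mt x z) x" using lhs(1) unfolding ab(1) by (simp add: min_def)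
    then show ?thesis unfolding if_not_P[OF 3(1)] if_not_P[OF 3(2)] by (simp add: take_mt)
  qed
qed

lemma prefix_meet_iff:
  "prefix (longest_common_prefix x y) (longest_common_prefix z w) \<longleftrightarrow>
    mt x y \<le> mt z w \<and> mt x y \<le> mt x z"
proof -
  let ?a = "longest_common_prefix x y" and ?b = "longest_common_prefix z w"
  have len: "length ?a = mt x y" "length ?b = mt z w" by (simp_all add: mt_def)
  have "?b = take (mt z w) z" "?a = take (mt x y) x" by (simp_all add: take_mt)
  then have take: "take (mt x y) ?b = take (mt x y) z" if "mt x y \<le> mt z w"
    using that by (simp add: min_def)
  have "mt x y \<le> mt x z \<longleftrightarrow> take (mt x y) z = ?a" if "mt x y \<le> mt z w"
    using that le_mt_iff[of "mt x y" x z] mt_le[of x y] mt_le[of z w] by (auto simp: take_mt)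
  moreover have "prefix ?a ?b \<longleftrightarrow> mt x y \<le> mt z w \<and> take (mt x y) ?b = ?a"
  proof
    assume "prefix ?a ?b"
    then show "mt x y \<le> mt z w \<and> take (mt x y) ?b = ?a"
      unfolding len(1)[symmetric] len(2)[symmetric] by (auto simp: prefix_def)
  next
    assume "mt x y \<le> mt z w \<and> take (mt x y) ?b = ?a"
    then show "prefix ?a ?b" by (metis take_is_prefix)
  qed
  ultimately show ?thesis using take by auto
qed

text \<open>Either the first meet is a proper initial segment of the second, or the two branch; in
  the latter case they branch where \<open>x\<close> and \<open>z\<close> do.\<close>

lemma lex_less_meet_iff:
  "lex_less (longest_common_prefix x y) (longest_common_prefix z w) \<longleftrightarrow>
    (mt x y \<le> mt x z \<and> mt x y < mt z w) \<or> (mt x z < mt x y \<and> mt x z < mt z w \<and> lex_less x z)"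
proof -
  let ?a = "longest_common_prefix x y" and ?b = "longest_common_prefix z w"
  have len: "length ?a = mt x y" "length ?b = mt z w" by (simp_all add: mt_def)
  have m: "mt ?a ?b = (if mt x y \<le> mt z w \<and> mt x y \<le> mt x z then mt x y
     else if mt z w \<le> mt x z then mt z w else mt x z)"
    unfolding mt_def[of ?a ?b] meet_meet by (simp add: mt_def)
  have a: "?a ! i = x ! i" if "i < mt x y" for i using that by (metis nth_take take_mt(1))
  have b: "?b ! i = z ! i" if "i < mt z w" for i using that by (metis nth_take take_mt(1))
  have "lex_less x z \<longleftrightarrow> x ! mt x z < z ! mt x z" if "mt x z < mt x y" "mt x z < mt z w"
    using that mt_le[of x y] mt_le[of z w] unfolding lex_less_iff[of x z] by auto
  then show ?thesis
    unfolding lex_less_iff[of ?a] len m using a[of "mt x z"] b[of "mt x z"] by auto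
qed

text \<open>As \<open>mt \<eta> \<eta>\<close> is the length of \<open>\<eta>\<close>, the lengths
  of the nodes are covered. \<open>same_shape\<close> keeps only the comparisons between lengths of
  meets, which is what the quantifier-free type sees.\<close>

definition same_levels :: "'q set \<Rightarrow> ('q \<Rightarrow> nat list) \<Rightarrow> ('q \<Rightarrow> nat list) \<Rightarrow> bool" where
  "same_levels Q u w \<longleftrightarrow> (\<forall>q \<in> Q. \<forall>r \<in> Q. mt (u q) (u r) = mt (w q) (w r) \<and>
     (lex_less (u q) (u r) \<longleftrightarrow> lex_less (w q) (w r)))"

definition same_shape :: "'q set \<Rightarrow> ('q \<Rightarrow> nat list) \<Rightarrow> ('q \<Rightarrow> nat list) \<Rightarrow> bool" where
  "same_shape Q u w \<longleftrightarrow>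
     (\<forall>q \<in> Q. \<forall>r \<in> Q. \<forall>q' \<in> Q. \<forall>r' \<in> Q. mt (u q) (u r) < mt (u q') (u r') \<longleftrightarrow> mt (w q) (w r) < mt (w q') (w r')) \<and>
     (\<forall>q \<in> Q. \<forall>r \<in> Q. lex_less (u q) (u r) \<longleftrightarrow> lex_less (w q) (w r))"

lemma same_levels_sym: "same_levels Q u w \<Longrightarrow> same_levels Q w u"
  by (simp add: same_levels_def)

lemma same_shape_trans: "same_shape Q u v \<Longrightarrow> same_shape Q v w \<Longrightarrow> same_shape Q u w"
  by (simp add: same_shape_def)

lemma same_levels_shape: "same_levels Q u w \<Longrightarrow> same_shape Q u w"
  by (simp add: same_shape_def same_levels_def)

text \<open>The reduction in \<open>meet_meet\<close> is decided by comparing lengths of meets, so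
  it selects the same pair of variables for both tuples.\<close>

lemma val_str_tree:
  assumes "same_shape Q e e'" "wf_tm L_str t" "vars_tm t \<subseteq> Q"
  shows "\<exists>k \<in> Q. \<exists>l \<in> Q. val str_tree e t = longest_common_prefix (e k) (e l) \<and>
    val str_tree e' t = longest_common_prefix (e' k) (e' l)"
  using assms(2,3)
proof (induction t)
  case (Var n)
  have "longest_common_prefix x x = x" for x :: "nat list" by (induction x) auto
  then show ?case using Var by (intro bexI[of _ n]) auto
next
  case (Fn f ts)
  then have "length ts = 2" by (simp add: L_str_def)
  then obtain t u where ts: "ts = [t, u]" by (auto simp: length_Suc_conv numeral_2_eq_2)
  obtain k l where kl: "k \<in> Q" "l \<in> Q" "val str_tree e t = longest_common_prefix (e k) (e l)"
    "val str_tree e' t = longest_common_prefix (e' k) (e' l)"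
    using Fn.IH[of t] Fn.prems unfolding ts by auto
  obtain m n where mn: "m \<in> Q" "n \<in> Q" "val str_tree e u = longest_common_prefix (e m) (e n)"
    "val str_tree e' u = longest_common_prefix (e' m) (e' n)"
    using Fn.IH[of u] Fn.prems unfolding ts by auto
  have v: "val str_tree e (Fn f ts) = longest_common_prefix (val str_tree e t) (val str_tree e u)" for e
    by (simp add: ts str_tree_def)
  have le: "mt (e q) (e r) \<le> mt (e q') (e r') \<longleftrightarrow> mt (e' q) (e' r) \<le> mt (e' q') (e' r')"
    if "q \<in> Q" "r \<in> Q" "q' \<in> Q" "r' \<in> Q" for q r q' r'
    using assms(1) that unfolding same_shape_def by (meson not_le)
  show ?case
    unfolding v kl(3,4) mn(3,4) meet_meet
    using le[OF kl(1,2) mn(1,2)] le[OF kl(1,2) kl(1) mn(1)] le[OF mn(1,2) kl(1) mn(1)] kl(1,2) mn(1,2)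
    by auto
qed

lemma sat_q_str_tree:
  assumes "same_shape Q e e'" "wf_qform L_str \<chi>" "vars_qform \<chi> \<subseteq> Q"
  shows "sat_q str_tree e \<chi> \<longleftrightarrow> sat_q str_tree e' \<chi>"
  using assms(2,3)
proof (induction \<chi>)
  case (QAtom A)
  have lt: "mt (e q) (e r) < mt (e q') (e r') \<longleftrightarrow> mt (e' q) (e' r) < mt (e' q') (e' r')"
    if "q \<in> Q" "r \<in> Q" "q' \<in> Q" "r' \<in> Q" for q r q' r'
    using assms(1) that unfolding same_shape_def by blast
  then have le: "mt (e q) (e r) \<le> mt (e q') (e r') \<longleftrightarrow> mt (e' q) (e' r) \<le> mt (e' q') (e' r')"
    if "q \<in> Q" "r \<in> Q" "q' \<in> Q" "r' \<in> Q" for q r q' r'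
    using that by (meson not_le)
  have lex: "lex_less (e q) (e r) \<longleftrightarrow> lex_less (e' q) (e' r)" if "q \<in> Q" "r \<in> Q" for q r
    using assms(1) that unfolding same_shape_def by blast
  have terms: "(prefix (val str_tree e t) (val str_tree e u) \<longleftrightarrow> prefix (val str_tree e' t) (val str_tree e' u)) \<and>
      (length (val str_tree e t) < length (val str_tree e u) \<longleftrightarrow> length (val str_tree e' t) < length (val str_tree e' u)) \<and>
      (lex_less (val str_tree e t) (val str_tree e u) \<longleftrightarrow> lex_less (val str_tree e' t) (val str_tree e' u))"
    if tu: "wf_tm L_str t" "wf_tm L_str u" "vars_tm t \<subseteq> Q" "vars_tm u \<subseteq> Q" for t u
  proof -
    obtain k l where kl: "k \<in> Q" "l \<in> Q" "val str_tree e t = longest_common_prefix (e k) (e l)"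
      "val str_tree e' t = longest_common_prefix (e' k) (e' l)"
      using val_str_tree[OF assms(1) tu(1,3)] by blast
    obtain m n where mn: "m \<in> Q" "n \<in> Q" "val str_tree e u = longest_common_prefix (e m) (e n)"
      "val str_tree e' u = longest_common_prefix (e' m) (e' n)"
      using val_str_tree[OF assms(1) tu(2,4)] by blast
    show ?thesis
      unfolding kl(3,4) mn(3,4) prefix_meet_iff lex_less_meet_iff mt_def[symmetric]
      using kl(1,2) mn(1,2) by (simp add: lt le lex)
  qed
  show ?case
  proof (cases A)
    case (Equal t u)
    then show ?thesis
      using terms[of t u] terms[of u t] QAtom by (auto simp: prefix_order.eq_iff)
  next
    case (Rel r ts)
    then have "length ts = 2" using QAtom by (simp add: L_str_def)
    then obtain t u where "ts = [t, u]" by (auto simp: length_Suc_conv numeral_2_eq_2)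
    then show ?thesis
      using terms[of t u] QAtom Rel by (cases r) (auto simp: str_tree_def)
  qed
qed auto

lemma qftp_str_tree_iff:
  "qftp L_str str_tree xs = qftp L_str str_tree ys \<longleftrightarrow>
     length xs = length ys \<and> same_shape {..<length xs} ((!) xs) ((!) ys)"
proof
  assume eq: "qftp L_str str_tree xs = qftp L_str str_tree ys"
  \<comment> \<open>A trivial equation in variable \<open>n\<close> belongs to the type exactly when
    \<open>n\<close> is a position of the tuple, so the type determines the length.\<close>
  have "QAtom (Equal (Var n) (Var n)) \<in> qftp L_str str_tree zs \<longleftrightarrow> n < length zs" for n zs
    by (simp add: qftp_def)
  then have len: "length xs = length ys" using eq by (metis linorder_neqE_nat less_irrefl)
  have transfer: "sat_q str_tree ((!) xs) \<chi> \<longleftrightarrow> sat_q str_tree ((!) ys) \<chi>"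
    if "wf_qform L_str \<chi>" "vars_qform \<chi> \<subseteq> {..<length xs}" for \<chi>
  proof -
    have "\<chi> \<in> qftp L_str str_tree xs \<longleftrightarrow> \<chi> \<in> qftp L_str str_tree ys" using eq by simp
    then show ?thesis using that len by (simp add: qftp_def)
  qed
  have "mt (xs ! q) (xs ! r) < mt (xs ! q') (xs ! r') \<longleftrightarrow> mt (ys ! q) (ys ! r) < mt (ys ! q') (ys ! r')"
    if "q < length xs" "r < length xs" "q' < length xs" "r' < length xs" for q r q' r'
    using transfer[of "QAtom (Rel Len [Fn Meet [Var q, Var r], Fn Meet [Var q', Var r']])"] that
    by (simp add: L_str_def str_tree_def mt_def)
  moreover have "lex_less (xs ! q) (xs ! r) \<longleftrightarrow> lex_less (ys ! q) (ys ! r)"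
    if "q < length xs" "r < length xs" for q r
    using transfer[of "QAtom (Rel Lex [Var q, Var r])"] that by (simp add: L_str_def str_tree_def)
  ultimately show "length xs = length ys \<and> same_shape {..<length xs} ((!) xs) ((!) ys)"
    using len by (simp add: same_shape_def)
next
  assume "length xs = length ys \<and> same_shape {..<length xs} ((!) xs) ((!) ys)"
  then show "qftp L_str str_tree xs = qftp L_str str_tree ys"
    unfolding qftp_def using sat_q_str_tree[of "{..<length xs}" "(!) xs" "(!) ys"] by auto
qed


section \<open>Level maps\<close>

text \<open>The last element of \<open>xs\<close> is the length of the node; the other ones are the positions of the entries
  \<open>vs\<close> among entries \<open>0\<close>.\<close>

definition place :: "nat list \<Rightarrow> nat list \<Rightarrow> nat list" where
  "place xs vs = map (\<lambda>n. case map_of (zip xs vs) n of None \<Rightarrow> 0 | Some v \<Rightarrow> v) [0..<last xs]"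

text \<open>Level \<open>i\<close> moves to level \<open>g i\<close> and gaps are filled with
  \<open>0\<close>. The filling is the same for all nodes, so it creates no new branching and meets
  move along with the levels.\<close>

definition lv :: "(nat \<Rightarrow> nat) \<Rightarrow> nat list \<Rightarrow> nat list" where
  "lv g \<eta> = place (map g [0..<Suc (length \<eta>)]) \<eta>"

lemma length_lv [simp]: "length (lv g \<eta>) = g (length \<eta>)"
  by (simp add: lv_def place_def)

context
  fixes g :: "nat \<Rightarrow> nat"
  assumes g: "strict_mono g"
begin

lemma lv_nth: "i < length \<eta> \<Longrightarrow> lv g \<eta> ! g i = \<eta> ! i"
proof -
  assume i: "i < length \<eta>"
  have "inj g" using g by (simp add: inj_def strict_mono_eq)
  have "map_of (zip (map g [0..<length \<eta>]) \<eta>) (map g [0..<length \<eta>] ! i) = Some (\<eta> ! i)"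
    using i inj_on_subset[OF \<open>inj g\<close> subset_UNIV] by (intro map_of_zip_nth) (simp_all add: distinct_map)
  moreover have "zip (map g [0..<Suc (length \<eta>)]) \<eta> = zip (map g [0..<length \<eta>]) \<eta>"
    by (simp add: zip_append1)
  moreover have "g i < g (length \<eta>)" using g i by (simp add: strict_mono_less)
  ultimately show ?thesis using i by (simp add: lv_def place_def)
qed

lemma lv_nth_gap: "n < g (length \<eta>) \<Longrightarrow> n \<notin> range g \<Longrightarrow> lv g \<eta> ! n = 0"
proof -
  assume n: "n < g (length \<eta>)" "n \<notin> range g"
  have "map_of (zip (map g [0..<Suc (length \<eta>)]) \<eta>) n = None"
    using n(2) by (auto simp: map_of_eq_None_iff dest!: set_zip_leftD)
  then show ?thesis using n(1) by (simp add: lv_def place_def)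
qed

lemma mt_lv: "mt (lv g \<eta>) (lv g \<nu>) = g (mt \<eta> \<nu>)"
proof (rule mt_eqI)
  show "g (mt \<eta> \<nu>) \<le> length (lv g \<eta>)" "g (mt \<eta> \<nu>) \<le> length (lv g \<nu>)"
    using mt_le[of \<eta> \<nu>] g by (simp_all add: strict_mono_less_eq)
next
  fix n assume n: "n < g (mt \<eta> \<nu>)"
  have le: "g (mt \<eta> \<nu>) \<le> g (length \<eta>)" "g (mt \<eta> \<nu>) \<le> g (length \<nu>)"
    using mt_le[of \<eta> \<nu>] g by (simp_all add: strict_mono_less_eq)
  show "lv g \<eta> ! n = lv g \<nu> ! n"
  proof (cases "n \<in> range g")
    case True
    then obtain i where i: "n = g i" by blast
    then have "i < mt \<eta> \<nu>" using n g by (simp add: strict_mono_less)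
    then show ?thesis using lv_nth[of i \<eta>] lv_nth[of i \<nu>] mt_le[of \<eta> \<nu>] nth_mt[of i \<eta> \<nu>] i by simp
  next
    case False
    then show ?thesis using lv_nth_gap[of n \<eta>] lv_nth_gap[of n \<nu>] n le by simp
  qed
next
  assume "g (mt \<eta> \<nu>) < length (lv g \<eta>)" "g (mt \<eta> \<nu>) < length (lv g \<nu>)"
  then have "mt \<eta> \<nu> < length \<eta>" "mt \<eta> \<nu> < length \<nu>" using g by (simp_all add: strict_mono_less)
  then show "lv g \<eta> ! g (mt \<eta> \<nu>) \<noteq> lv g \<nu> ! g (mt \<eta> \<nu>)"
    using nth_mt_neq lv_nth by simp
qed

lemma lex_less_lv: "lex_less (lv g \<eta>) (lv g \<nu>) \<longleftrightarrow> lex_less \<eta> \<nu>"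
proof -
  have "lv g \<eta> ! g (mt \<eta> \<nu>) = \<eta> ! mt \<eta> \<nu>" if "mt \<eta> \<nu> < length \<eta>" using lv_nth that by simp
  moreover have "lv g \<nu> ! g (mt \<eta> \<nu>) = \<nu> ! mt \<eta> \<nu>" if "mt \<eta> \<nu> < length \<nu>" using lv_nth that by simp
  ultimately show ?thesis
    unfolding lex_less_iff mt_lv length_lv using g by (auto simp: strict_mono_less strict_mono_eq)
qed

lemma same_shape_lv: "same_shape Q (lv g \<circ> u) u"
  using g by (simp add: same_shape_def mt_lv lex_less_lv strict_mono_less)

end

text \<open>A \<open>0\<close> filled in by the inner map is copied by the outer one to a place that
  is a gap of the composition, where the value is \<open>0\<close> too.\<close>

lemma lv_lv:
  assumes g: "strict_mono g" and h: "strict_mono h"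
  shows "lv h (lv g \<eta>) = lv (h \<circ> g) \<eta>"
proof (rule nth_equalityI)
  have hg: "strict_mono (h \<circ> g)" using g h by (simp add: strict_mono_def)
  fix n assume "n < length (lv h (lv g \<eta>))"
  then have n: "n < h (g (length \<eta>))" by simp
  show "lv h (lv g \<eta>) ! n = lv (h \<circ> g) \<eta> ! n"
  proof (cases "n \<in> range h")
    case True
    then obtain i where i: "n = h i" by blast
    then have "i < g (length \<eta>)" using n h by (simp add: strict_mono_less)
    then have l: "lv h (lv g \<eta>) ! n = lv g \<eta> ! i" using lv_nth[OF h, of i "lv g \<eta>"] i by simp
    show ?thesis
    proof (cases "i \<in> range g")
      case True
      then obtain k where k: "i = g k" by blast
      then have "k < length \<eta>" using \<open>i < g (length \<eta>)\<close> g by (simp add: strict_mono_less)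
      then show ?thesis using l lv_nth[OF g, of k \<eta>] lv_nth[OF hg, of k \<eta>] k i by simp
    next
      case False
      then have "n \<notin> range (h \<circ> g)" using i h by (auto simp: strict_mono_eq)
      then show ?thesis
        using l lv_nth_gap[OF g \<open>i < g (length \<eta>)\<close> False] lv_nth_gap[OF hg, of n \<eta>] n by simp
    qed
  next
    case False
    then have "n \<notin> range (h \<circ> g)" by auto
    then show ?thesis using False lv_nth_gap[OF h, of n "lv g \<eta>"] lv_nth_gap[OF hg, of n \<eta>] n by simp
  qed
qed simp

lemma extend_strict_mono:
  fixes h :: "nat \<Rightarrow> nat"
  assumes "monotone_on {..m} (<) (<) h"
  obtains g where "strict_mono g" "\<And>i. i \<le> m \<Longrightarrow> g i = h i"
proof -
  define g where "g i = (if i \<le> m then h i else h m + i)" for i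
  have "g i < g (Suc i)" for i
    using monotone_onD[OF assms, of i "Suc i"] monotone_onD[OF assms, of i m]
    by (cases "i = m") (auto simp: g_def)
  then have "strict_mono g" by (simp add: strict_mono_Suc_iff)
  then show ?thesis using that by (simp add: g_def)
qed

text \<open>Amalgamation of two copies of the natural numbers along the finite increasing map
  \<open>\<theta>\<close>.\<close>

lemma amalgamate_strict_mono:
  fixes \<theta> :: "nat \<Rightarrow> nat"
  assumes "finite A" "monotone_on A (<) (<) \<theta>"
  obtains g g' :: "nat \<Rightarrow> nat" where "strict_mono g" "strict_mono g'" "\<And>a. a \<in> A \<Longrightarrow> g a = g' (\<theta> a)"
proof -
  have "\<exists>g g' :: nat \<Rightarrow> nat. strict_mono g \<and> strict_mono g' \<and> (\<forall>a \<in> A. g a = g' (\<theta> a))"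
    using assms
  proof (induction A rule: finite_linorder_max_induct)
    case empty
    then show ?case by (intro exI[of _ id]) (simp add: strict_mono_def)
  next
    case (insert m A)
    have "monotone_on A (<) (<) \<theta>" using insert.prems by (rule monotone_on_subset) auto
    then obtain g g' :: "nat \<Rightarrow> nat"
      where g: "strict_mono g" "strict_mono g'" "\<And>a. a \<in> A \<Longrightarrow> g a = g' (\<theta> a)"
      using insert.IH by blast
    \<comment> \<open>From the new maximum on, each map is raised by the value of the other one
      there, so that both reach \<open>g m + g' (\<theta> m)\<close>.\<close>
    define h where "h x = (if x < m then g x else g x + g' (\<theta> m))" for x
    define h' where "h' x = (if x < \<theta> m then g' x else g' x + g m)" for x
    have "h i < h (Suc i)" "h' i < h' (Suc i)" for i
      using strict_mono_less[OF g(1), of i "Suc i"] strict_mono_less[OF g(2), of i "Suc i"]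
      by (auto simp: h_def h'_def)
    then have "strict_mono h" "strict_mono h'" by (simp_all add: strict_mono_Suc_iff)
    moreover have "\<theta> a < \<theta> m" if "a \<in> A" for a
      using monotone_onD[OF insert.prems] insert.hyps that by blast
    then have "h a = h' (\<theta> a)" if "a \<in> insert m A" for a
      using that g(3) insert.hyps by (auto simp: h_def h'_def)
    ultimately show ?case by blast
  qed
  then show ?thesis using that by blast
qed

text \<open>Sending the length of a meet in \<open>u\<close> to that of the corresponding meet in
  \<open>w\<close> is well defined and increasing, because \<open>same_shape\<close> compares all
  pairs of meets; amalgamation makes the lengths equal.\<close>

lemma same_shape_levels:
  assumes Q: "finite Q" and u: "same_shape Q u w"
  obtains g g' where "strict_mono g" "strict_mono g'" "same_levels Q (lv g \<circ> u) (lv g' \<circ> w)"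
proof -
  let ?A = "(\<lambda>(q, r). mt (u q) (u r)) ` (Q \<times> Q)"
  have "\<exists>n. \<forall>q \<in> Q. \<forall>r \<in> Q. mt (u q) (u r) = m \<longrightarrow> n = mt (w q) (w r)" for m
  proof (cases "m \<in> ?A")
    case True
    then obtain q r where qr: "q \<in> Q" "r \<in> Q" "m = mt (u q) (u r)" by auto
    have "mt (w q) (w r) = mt (w q') (w r')" if "q' \<in> Q" "r' \<in> Q" "mt (u q') (u r') = m" for q' r'
      using u qr that unfolding same_shape_def by (metis less_irrefl linorder_neqE_nat)
    then show ?thesis by blast
  qed auto
  then obtain \<theta> where \<theta>: "\<And>q r. q \<in> Q \<Longrightarrow> r \<in> Q \<Longrightarrow> \<theta> (mt (u q) (u r)) = mt (w q) (w r)" by metis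
  have "monotone_on ?A (<) (<) \<theta>"
    using u \<theta> by (auto simp: monotone_on_def same_shape_def)
  then obtain g g' :: "nat \<Rightarrow> nat" where g: "strict_mono g" "strict_mono g'" "\<And>a. a \<in> ?A \<Longrightarrow> g a = g' (\<theta> a)"
    using amalgamate_strict_mono[of ?A] Q by blast
  have "g (mt (u q) (u r)) = g' (mt (w q) (w r))" if "q \<in> Q" "r \<in> Q" for q r
  proof -
    have "mt (u q) (u r) \<in> ?A" using that by (intro image_eqI[of _ _ "(q, r)"]) auto
    then show ?thesis using g(3) \<theta>[OF that] by simp
  qed
  then have "same_levels Q (lv g \<circ> u) (lv g' \<circ> w)"
    using u g(1,2) by (simp add: same_levels_def same_shape_def mt_lv lex_less_lv)
  then show ?thesis using that g by blast
qed


section \<open>Invariant trees\<close>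

definition fam :: "('n \<Rightarrow> 'j \<Rightarrow> 'a) \<Rightarrow> ('q \<Rightarrow> 'n) \<Rightarrow> 'q \<times> 'j \<Rightarrow> 'a" where
  "fam b u = (\<lambda>(q, j). b (u q) j)"

lemma fam_ren: "holds M (fam b u) (ren (apfst w) p) \<longleftrightarrow> holds M (fam b (u \<circ> w)) p"
  unfolding holds_ren by (rule holds_cong) (auto simp: fam_def)

lemma subtuple_fam: "subtuple a ks = fam a ((!) ks)"
  by (auto simp: subtuple_def fam_def)

lemma tp_eq_iff:
  "tp L M C X a = tp L M C X b \<longleftrightarrow> (\<forall>p \<in> cforms L C X. holds M a p \<longleftrightarrow> holds M b p)"
  by (auto simp: tp_def)

lemma mt_Cons: "mt (x # \<eta>) (y # \<nu>) = (if x = y then Suc (mt \<eta> \<nu>) else 0)"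
  by (simp add: mt_def)

lemma mt_Nil [simp]: "mt [] \<nu> = 0" "mt \<eta> [] = 0"
  by (cases \<eta>) (simp_all add: mt_def)

lemma lex_less_Nil [simp]: "lex_less [] \<nu> \<longleftrightarrow> \<nu> \<noteq> []" "\<not> lex_less \<eta> []"
  by (simp_all add: lex_less_iff)

lemma lex_less_Cons: "lex_less (x # \<eta>) (y # \<nu>) \<longleftrightarrow> x < y \<or> x = y \<and> lex_less \<eta> \<nu>"
  by (auto simp: lex_less_iff mt_Cons)

text \<open>Raising only the first entry moves nodes to other subtrees above the root, without
  changing meets or the order within a tuple. This provides the further terms of indiscernible
  sequences.\<close>

fun shift :: "nat \<Rightarrow> nat list \<Rightarrow> nat list" where
  "shift n [] = []"
| "shift n (x # \<eta>) = (x + n) # \<eta>"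

lemma same_levels_shift: "same_levels Q (shift n \<circ> u) u"
proof -
  have "mt (shift n \<eta>) (shift n \<nu>) = mt \<eta> \<nu>" for \<eta> \<nu>
    by (cases \<eta>; cases \<nu>) (simp_all add: mt_Cons)
  moreover have "lex_less (shift n \<eta>) (shift n \<nu>) \<longleftrightarrow> lex_less \<eta> \<nu>" for \<eta> \<nu>
    by (cases \<eta>; cases \<nu>) (simp_all add: lex_less_Cons)
  ultimately show ?thesis by (simp add: same_levels_def)
qed

text \<open>In the shortlex order shorter segments come first; segments of equal length compare like
  the nodes unless they coincide, which \<open>mt x y < n\<close> excludes.\<close>

lemma lenlex_take_iff:
  assumes "m \<le> length x" "n \<le> length y"
  shows "(take m x, take n y) \<in> lenlex less_than \<longleftrightarrow> m < n \<or> m = n \<and> mt x y < n \<and> lex_less x y"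
proof -
  have lex: "(take n x, take n y) \<in> lex less_than \<longleftrightarrow> mt x y < n \<and> lex_less x y"
    if "n \<le> length x" "n \<le> length y" for n
    using that
  proof (induction n arbitrary: x y)
    case (Suc n)
    then obtain a x' b y' where "x = a # x'" "y = b # y'" by (metis Suc_le_length_iff)
    then show ?case using Suc by (auto simp: mt_Cons lex_less_Cons)
  qed simp
  show ?thesis using assms lex[of m] by (cases "m = n") (simp_all add: lenlex_conv)
qed

lemma linear_on_lenlex: "linear_on A (\<lambda>x y :: nat list. (x, y) \<in> lenlex less_than)"
proof -
  have "trans (lenlex less_than)" "total (lenlex less_than)" "(x, x) \<notin> lenlex less_than" for x :: "nat list"
    by (auto simp: total_lenlex lenlex_irreflexive)
  then show ?thesis
    unfolding linear_on_def irreflp_on_def transp_on_def totalp_on_def total_on_def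
    by (blast dest: transD)
qed

text \<open>Each entry of a node is replaced by the initial segment ending there. Nodes are thus coded by
  lists over a linear order such that the order type of the letters of a tuple of nodes is determined
  by the lengths of the meets and the lexicographic order.\<close>

definition initials :: "nat list \<Rightarrow> nat list list" where
  "initials \<eta> = map (\<lambda>i. take (Suc i) \<eta>) [0..<length \<eta>]"

context skeleton
begin

definition level_invariant :: "(nat list \<Rightarrow> 'd \<Rightarrow> 'a) \<Rightarrow> bool" where
  "level_invariant b \<longleftrightarrow> (\<forall>p \<in> cforms L C ((UNIV :: nat set) \<times> D). \<forall>u w.
     same_levels (fst ` vars p) u w \<longrightarrow> (holds M (fam b u) p \<longleftrightarrow> holds M (fam b w) p))"

definition shape_invariant :: "(nat list \<Rightarrow> 'd \<Rightarrow> 'a) \<Rightarrow> bool" where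
  "shape_invariant b \<longleftrightarrow> (\<forall>(Q :: nat set). finite Q \<longrightarrow> (\<forall>p \<in> cforms L C (Q \<times> D). \<forall>u w.
     same_shape Q u w \<longrightarrow> (holds M (fam b u) p \<longleftrightarrow> holds M (fam b w) p)))"

text \<open>Here the nodes themselves serve as variables, so a formula compares the tree with its
  image under one level map; tuples of nodes are recovered by renaming.\<close>

definition lv_invariant :: "(nat list \<Rightarrow> 'd \<Rightarrow> 'a) \<Rightarrow> bool" where
  "lv_invariant b \<longleftrightarrow> (\<forall>p \<in> cforms L C (UNIV \<times> D). \<forall>g. strict_mono g \<longrightarrow>
     (holds M (fam b (lv g)) p \<longleftrightarrow> holds M (fam b id) p))"

definition lv_based :: "(nat list \<Rightarrow> 'd \<Rightarrow> 'a) \<Rightarrow> (nat list \<Rightarrow> 'd \<Rightarrow> 'a) \<Rightarrow> bool" where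
  "lv_based b a \<longleftrightarrow> (\<forall>p \<in> cforms L C (UNIV \<times> D).
     (\<forall>g. strict_mono g \<longrightarrow> holds M (fam a (lv g)) p) \<longrightarrow> holds M (fam b id) p)"

text \<open>Being EM-based, with quantifier-free types replaced by their combinatorial
  description.\<close>

definition shape_based :: "(nat list \<Rightarrow> 'd \<Rightarrow> 'a) \<Rightarrow> (nat list \<Rightarrow> 'd \<Rightarrow> 'a) \<Rightarrow> bool" where
  "shape_based b a \<longleftrightarrow> (\<forall>(Q :: nat set). finite Q \<longrightarrow> (\<forall>p \<in> cforms L C (Q \<times> D). \<forall>u.
     (\<forall>u'. same_shape Q u' u \<longrightarrow> holds M (fam a u') p) \<longrightarrow> holds M (fam b u) p))"

lemma shape_based_trans:
  assumes "shape_based c b" "shape_based b a"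
  shows "shape_based c a"
  unfolding shape_based_def
proof (intro allI impI ballI)
  fix Q :: "nat set" and p u
  assume Q: "finite Q" and p: "p \<in> cforms L C (Q \<times> D)"
    and a: "\<forall>u'. same_shape Q u' u \<longrightarrow> holds M (fam a u') p"
  have "holds M (fam b u') p" if u': "same_shape Q u' u" for u'
  proof -
    have "\<forall>u''. same_shape Q u'' u' \<longrightarrow> holds M (fam a u'') p"
      using a same_shape_trans[OF _ u'] by blast
    then show ?thesis using assms(2) Q p unfolding shape_based_def by blast
  qed
  then show "holds M (fam c u) p" using assms(1) Q p unfolding shape_based_def by blast
qed

lemma level_invariantD:
  fixes p :: "('f, 'r, 'q :: countable \<times> 'd, 'a) cform"
  assumes "level_invariant b" "p \<in> cforms L C (UNIV \<times> D)" "same_levels (fst ` vars p) u w"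
  shows "holds M (fam b u) p \<longleftrightarrow> holds M (fam b w) p"
proof -
  let ?p = "ren (apfst to_nat) p"
  have "?p \<in> cforms L C (UNIV \<times> D)"
    using vars_cforms[OF assms(2)] by (intro ren_cforms[OF assms(2)]) fastforce
  moreover have "same_levels (fst ` vars ?p) (u \<circ> from_nat) (w \<circ> from_nat)"
    using assms(3) by (simp add: vars_ren same_levels_def)
  ultimately have "holds M (fam b (u \<circ> from_nat)) ?p \<longleftrightarrow> holds M (fam b (w \<circ> from_nat)) ?p"
    using assms(1) unfolding level_invariant_def by blast
  moreover have "from_nat \<circ> to_nat = (id :: 'q \<Rightarrow> 'q)" by auto
  ultimately show ?thesis by (simp add: fam_ren comp_assoc)
qed

lemma level_invariant_lv:
  assumes "level_invariant b" "strict_mono g"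
  shows "level_invariant (b \<circ> lv g)"
proof -
  have "fam (b \<circ> lv g) u = fam b (lv g \<circ> u)" for u :: "nat \<Rightarrow> nat list" by (auto simp: fam_def)
  moreover have "same_levels Q (lv g \<circ> u) (lv g \<circ> w)" if "same_levels Q u w"
    for Q and u w :: "nat \<Rightarrow> nat list"
    using that by (simp add: same_levels_def mt_lv[OF assms(2)] lex_less_lv[OF assms(2)])
  ultimately show ?thesis using assms(1) by (simp add: level_invariant_def)
qed

text \<open>For tuples with the same levels, matching initial segments is an increasing map of
  letters. Conversely, relabelling the letters increasingly by numbers turns words of initial
  segments into nodes with the same levels, whence basedness on \<open>a\<close>.\<close>

lemma level_invariant_exists:
  assumes a: "\<And>\<eta> j. a \<eta> j \<in> carrier M"
  obtains b where "\<And>\<eta> j. b \<eta> j \<in> carrier M" "level_invariant b" "shape_based b a"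
proof -
  define lt where "lt x y \<longleftrightarrow> (x, y) \<in> lenlex less_than" for x y :: "nat list"
  have lin: "linear_on A lt" for A unfolding lt_def by (rule linear_on_lenlex)
  have take_lt: "lt (take m x) (take n y) \<longleftrightarrow> m < n \<or> m = n \<and> mt x y < n \<and> lex_less x y"
    if "m \<le> length x" "n \<le> length y" for m n x y
    using lenlex_take_iff[OF that] by (simp add: lt_def)
  have "range (\<lambda>(\<eta>, j). a \<eta> j) \<subseteq> carrier M" using a by auto
  moreover have "(UNIV :: nat list set) \<prec> K" by (simp add: small)
  ultimately obtain B where B: "range B \<subseteq> carrier M"
    and inv: "\<And>p h. p \<in> cforms L C (lists UNIV \<times> D) \<Longrightarrow> monotone_on (letters p) lt lt h \<Longrightarrow>
      h ` letters p \<subseteq> UNIV \<Longrightarrow> holds M B (relabel h p) \<longleftrightarrow> holds M B p"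
    and based: "\<And>p Y. p \<in> cforms L C (lists UNIV \<times> D) \<Longrightarrow> finite Y \<Longrightarrow> letters p \<subseteq> Y \<Longrightarrow> Y \<subseteq> UNIV \<Longrightarrow>
      (\<And>h :: nat list \<Rightarrow> nat. monotone_on Y lt (<) h \<Longrightarrow> holds M (\<lambda>(\<eta>, j). a \<eta> j) (relabel h p)) \<Longrightarrow> holds M B p"
    using skeleton_indiscernible[OF _ _ lin, of "\<lambda>(\<eta>, j). a \<eta> j" UNIV] by metis
  define b where "b \<eta> j = B (initials \<eta>, j)" for \<eta> j
  have set_initials: "set (initials \<eta>) = {take (Suc i) \<eta> |i. i < length \<eta>}" for \<eta>
    by (auto simp: initials_def)
  have fam_b: "holds M (fam b u) p \<longleftrightarrow> holds M B (ren (apfst (initials \<circ> u)) p)"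
    for u :: "nat \<Rightarrow> nat list" and p
    unfolding holds_ren by (rule holds_cong) (auto simp: fam_def b_def)
  have cf: "ren (apfst (initials \<circ> u)) p \<in> cforms L C (lists UNIV \<times> D)"
    if "p \<in> cforms L C (Q \<times> D)" for u :: "nat \<Rightarrow> nat list" and p Q
    using vars_cforms[OF that] by (intro ren_cforms[OF that]) fastforce
  have letters: "letters (ren (apfst (initials \<circ> u)) p) = (\<Union>q \<in> fst ` vars p. set (initials (u q)))"
    for u :: "nat \<Rightarrow> nat list" and p :: "('f, 'r, nat \<times> 'd, 'a) cform"
    by (force simp: letters_def vars_ren)
  have "level_invariant b"
    unfolding level_invariant_def
  proof (intro ballI allI impI)
    fix p :: "('f, 'r, nat \<times> 'd, 'a) cform" and u w
    let ?Q = "fst ` vars p"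
    assume p: "p \<in> cforms L C (UNIV \<times> D)" and uw: "same_levels ?Q u w"
    have len: "length (u q) = length (w q)" if "q \<in> ?Q" for q
      using uw that unfolding same_levels_def by (metis mt_self)
    \<comment> \<open>A segment of \<open>u q\<close> goes to the segment of \<open>w q\<close> of
      equal length. The choice of \<open>q\<close> is immaterial: sharing a segment of length
      \<open>n\<close> means a meet of length at least \<open>n\<close>, which
      \<open>same_levels\<close> transports to \<open>w\<close>.\<close>
    define h where "h \<zeta> = take (length \<zeta>)
      (w (SOME q. q \<in> ?Q \<and> length \<zeta> \<le> length (u q) \<and> take (length \<zeta>) (u q) = \<zeta>))" for \<zeta>
    have h: "h (take n (u q)) = take n (w q)" if q: "q \<in> ?Q" "n \<le> length (u q)" for n q
    proof -
      let ?P = "\<lambda>r. r \<in> ?Q \<and> n \<le> length (u r) \<and> take n (u r) = take n (u q)"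
      have "?P q" using q by simp
      then have "?P (SOME r. ?P r)" by (rule someI)
      then obtain r where r: "r = (SOME r. ?P r)" "?P r" by blast
      then have "n \<le> mt (u r) (u q)" using q(2) by (simp add: le_mt_iff)
      then have "n \<le> mt (w r) (w q)" using uw r q unfolding same_levels_def by metis
      then have "take n (w r) = take n (w q)" by (simp add: le_mt_iff)
      moreover have "length (take n (u q)) = n" using q(2) by simp
      ultimately show ?thesis unfolding h_def r(1) by simp
    qed
    let ?p = "ren (apfst (initials \<circ> u)) p"
    have "monotone_on (letters ?p) lt lt h"
    proof (rule monotone_onI)
      fix x y assume "x \<in> letters ?p" "y \<in> letters ?p" and xy: "lt x y"
      then obtain q r i k where x: "q \<in> ?Q" "i < length (u q)" "x = take (Suc i) (u q)"
        and y: "r \<in> ?Q" "k < length (u r)" "y = take (Suc k) (u r)"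
        unfolding letters set_initials by blast
      have "mt (u q) (u r) = mt (w q) (w r) \<and> (lex_less (u q) (u r) \<longleftrightarrow> lex_less (w q) (w r))"
        using uw x(1) y(1) unfolding same_levels_def by blast
      moreover have "lt (take (Suc i) (u q)) (take (Suc k) (u r))" using xy x(3) y(3) by simp
      ultimately have "lt (take (Suc i) (w q)) (take (Suc k) (w r))"
        using take_lt[of "Suc i" "u q" "Suc k" "u r"] take_lt[of "Suc i" "w q" "Suc k" "w r"]
          x(1,2) y(1,2) len[of q] len[of r] by simp
      then show "lt (h x) (h y)" using h x y by simp
    qed
    then have "holds M B (relabel h ?p) \<longleftrightarrow> holds M B ?p" using inv[OF cf[OF p]] by simp
    moreover have "holds M B (relabel h ?p) \<longleftrightarrow> holds M B (ren (apfst (initials \<circ> w)) p)"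
      unfolding holds_ren
    proof (rule holds_cong)
      fix z assume z: "z \<in> vars p"
      then have "fst z \<in> ?Q" by blast
      then have "map h (initials (u (fst z))) = initials (w (fst z))"
        using h len by (simp add: initials_def)
      then show "(B \<circ> apfst (map h) \<circ> apfst (initials \<circ> u)) z = (B \<circ> apfst (initials \<circ> w)) z"
        by (cases z) (simp del: map_eq_conv)
    qed
    ultimately show "holds M (fam b u) p \<longleftrightarrow> holds M (fam b w) p" unfolding fam_b by blast
  qed
  moreover have "shape_based b a"
    unfolding shape_based_def
  proof (intro allI impI ballI)
    fix Q :: "nat set" and p :: "('f, 'r, nat \<times> 'd, 'a) cform" and u
    assume Q: "finite Q" and p: "p \<in> cforms L C (Q \<times> D)"
      and hyp: "\<forall>u'. same_shape Q u' u \<longrightarrow> holds M (fam a u') p"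
    let ?p = "ren (apfst (initials \<circ> u)) p"
    \<comment> \<open>All letters of the tuple, not only those occurring in \<open>p\<close>, so
      that the relabelled tuple has the same shape on the whole of \<open>Q\<close>.\<close>
    let ?Y = "\<Union>q \<in> Q. set (initials (u q))"
    have "holds M B ?p"
    proof (rule based[OF cf[OF p]])
      show "finite ?Y" using Q by simp
      show "letters ?p \<subseteq> ?Y" unfolding letters using vars_cforms[OF p] by auto
      fix h :: "nat list \<Rightarrow> nat" assume h: "monotone_on ?Y lt (<) h"
      have h_less: "h x < h y \<longleftrightarrow> lt x y" if "x \<in> ?Y" "y \<in> ?Y" for x y
        using monotone_on_iff[OF lin linear_on_nat h subset_UNIV that] .
      define u' where "u' q = map h (initials (u q))" for q
      have len: "length (u' q) = length (u q)" for q by (simp add: u'_def initials_def)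
      have nth: "u' q ! i = h (take (Suc i) (u q))" if "i < length (u q)" for q i
        using that by (simp add: u'_def initials_def)
      have less: "u' q ! i < u' r ! i \<longleftrightarrow> mt (u q) (u r) < Suc i \<and> lex_less (u q) (u r)"
        if "q \<in> Q" "r \<in> Q" "i < length (u q)" "i < length (u r)" for q r i
      proof -
        have "take (Suc i) (u q) \<in> ?Y" "take (Suc i) (u r) \<in> ?Y"
          using that by (auto simp: set_initials)
        then show ?thesis using that h_less by (simp add: nth take_lt)
      qed
      have mt: "mt (u' q) (u' r) = mt (u q) (u r)" if qr: "q \<in> Q" "r \<in> Q" for q r
      proof (rule mt_eqI)
        show "mt (u q) (u r) \<le> length (u' q)" "mt (u q) (u r) \<le> length (u' r)"
          unfolding len by (rule mt_le)+
      next
        fix i assume "i < mt (u q) (u r)"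
        then have "Suc i \<le> mt (u q) (u r)" by simp
        then have "take (Suc i) (u q) = take (Suc i) (u r)" "i < length (u q)" "i < length (u r)"
          unfolding le_mt_iff by auto
        then show "u' q ! i = u' r ! i" by (simp add: nth)
      next
        assume "mt (u q) (u r) < length (u' q)" "mt (u q) (u r) < length (u' r)"
        then have m: "mt (u q) (u r) < length (u q)" "mt (u q) (u r) < length (u r)" by (simp_all add: len)
        then have "lex_less (u q) (u r) \<or> lex_less (u r) (u q)"
          using nth_mt_neq[OF m] mt_commute[of "u q" "u r"] by (auto simp: lex_less_iff)
        then show "u' q ! mt (u q) (u r) \<noteq> u' r ! mt (u q) (u r)"
          using less[OF qr m] less[OF qr(2,1) m(2,1)] mt_commute[of "u q" "u r"] by auto
      qed
      have "lex_less (u' q) (u' r) \<longleftrightarrow> lex_less (u q) (u r)" if qr: "q \<in> Q" "r \<in> Q" for q r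
        using less[OF qr, of "mt (u q) (u r)"]
        unfolding lex_less_iff[of "u' q"] mt[OF qr] len by (auto simp: lex_less_iff)
      then have "same_shape Q u' u" using mt by (intro same_levels_shape) (simp add: same_levels_def)
      then have "holds M (fam a u') p" using hyp by blast
      moreover have "(\<lambda>(\<eta>, j). a \<eta> j) \<circ> apfst (map h) \<circ> apfst (initials \<circ> u) = fam a u'"
        by (auto simp: fam_def u'_def)
      ultimately show "holds M (\<lambda>(\<eta>, j). a \<eta> j) (relabel h ?p)" by (simp add: holds_ren)
    qed simp
    then show "holds M (fam b u) p" unfolding fam_b .
  qed
  moreover have "b \<eta> j \<in> carrier M" for \<eta> j using B by (auto simp: b_def)
  ultimately show ?thesis using that by blast
qed

text \<open>The letters are now the levels: a node of length \<open>n\<close> is the word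
  \<open>0, ..., n\<close>, while its entries belong to the label and stay fixed. Reindexing the
  letters then acts as a level map.\<close>

lemma lv_invariant_exists:
  assumes a: "\<And>\<eta> j. a \<eta> j \<in> carrier M"
  obtains b where "\<And>\<eta> j. b \<eta> j \<in> carrier M" "lv_invariant b" "lv_based b a"
proof -
  let ?D = "(UNIV :: nat list set) \<times> D"
  let ?a = "\<lambda>(xs, vs, j). a (place xs vs) j"
  interpret S: skeleton K L T M C ?D
  proof (rule skeleton.intro[OF monster_model_axioms], rule skeleton_axioms.intro)
    show "C \<subseteq> carrier M" "C \<prec> K" by (fact C)+
    show "?D \<prec> K" using D(1) by (simp add: small)
    show "?D \<noteq> {}" using D(2) by simp
  qed
  have "range ?a \<subseteq> carrier M" using a by auto
  moreover have "(UNIV :: nat set) \<prec> K" by (simp add: small)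
  ultimately obtain B where B: "range B \<subseteq> carrier M"
    and inv: "\<And>p h. p \<in> cforms L C (lists (UNIV :: nat set) \<times> ?D) \<Longrightarrow> monotone_on (letters p) (<) (<) h \<Longrightarrow>
      h ` letters p \<subseteq> UNIV \<Longrightarrow> holds M B (relabel h p) \<longleftrightarrow> holds M B p"
    and based: "\<And>p Y. p \<in> cforms L C (lists (UNIV :: nat set) \<times> ?D) \<Longrightarrow> finite Y \<Longrightarrow> letters p \<subseteq> Y \<Longrightarrow> Y \<subseteq> UNIV \<Longrightarrow>
      (\<And>h :: nat \<Rightarrow> nat. monotone_on Y (<) (<) h \<Longrightarrow> holds M ?a (relabel h p)) \<Longrightarrow> holds M B p"
    using S.skeleton_indiscernible[OF _ _ linear_on_nat, of ?a UNIV] by metis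
  have based': "holds M B p"
    if p: "p \<in> cforms L C (lists (UNIV :: nat set) \<times> ?D)"
      and hyp: "\<And>g :: nat \<Rightarrow> nat. strict_mono g \<Longrightarrow> holds M ?a (relabel g p)" for p
  proof -
    obtain m where m: "letters p \<subseteq> {..m}"
      using finite_letters[of p] by (metis finite_nat_set_iff_bounded_le atMost_iff subsetI)
    show ?thesis
    proof (rule based[OF p _ m])
      fix h :: "nat \<Rightarrow> nat" assume "monotone_on {..m} (<) (<) h"
      then obtain g where g: "strict_mono g" "\<And>i. i \<le> m \<Longrightarrow> g i = h i"
        using extend_strict_mono by blast
      have "holds M ?a (relabel h p) \<longleftrightarrow> holds M ?a (relabel g p)"
        using g(2) m by (intro holds_relabel_cong) auto
      then show "holds M ?a (relabel h p)" using hyp g(1) by blast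
    qed auto
  qed
  define code where "code = (\<lambda>(\<eta> :: nat list, j :: 'd). ([0..<Suc (length \<eta>)], \<eta>, j))"
  define b where "b \<eta> j = B (code (\<eta>, j))" for \<eta> j
  have cf: "ren code p \<in> cforms L C (lists UNIV \<times> ?D)" if "p \<in> cforms L C (UNIV \<times> D)" for p
    using vars_cforms[OF that] by (intro ren_cforms[OF that]) (fastforce simp: code_def)
  have fam_b: "holds M (fam b id) p \<longleftrightarrow> holds M B (ren code p)" for p
    unfolding holds_ren by (rule holds_cong) (auto simp: fam_def b_def)
  \<comment> \<open>Values of \<open>B\<close> at words that are not codes have to be tied to
    \<open>b\<close>. By \<open>lv_lv\<close> the equation \<open>?E\<close> holds for
    \<open>a\<close> under every reindexing, and as a positive formula it passes to
    \<open>B\<close>.\<close>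
  have moved: "B (map g [0..<Suc (length \<eta>)], \<eta>, j) = b (lv g \<eta>) j"
    if g: "strict_mono g" and j: "j \<in> D" for g \<eta> j
  proof -
    let ?x = "(map g [0..<Suc (length \<eta>)], \<eta>, j)"
    let ?E = "(Atom (Equal (Var 0) (Var 1)), \<lambda>n. if n = 0 then Inl ?x else Inl (code (lv g \<eta>, j)))
      :: ('f, 'r, nat list \<times> nat list \<times> 'd, 'a) cform"
    have "holds M B ?E"
    proof (rule based')
      show "?E \<in> cforms L C (lists UNIV \<times> ?D)" using j by (auto simp: cforms_def code_def)
      fix h :: "nat \<Rightarrow> nat" assume h: "strict_mono h"
      have "?a (apfst (map h) ?x) = a (lv (h \<circ> g) \<eta>) j" by (simp add: lv_def del: upt_Suc)
      moreover have "?a (apfst (map h) (code (lv g \<eta>, j))) = a (lv h (lv g \<eta>)) j"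
        by (simp add: lv_def[of h] code_def del: upt_Suc)
      ultimately show "holds M ?a (relabel h ?E)"
        unfolding holds_ren by (simp add: holds_def lv_lv[OF g h] del: upt_Suc)
    qed
    then show ?thesis by (simp add: holds_def b_def del: upt_Suc)
  qed
  have "lv_invariant b"
    unfolding lv_invariant_def
  proof (intro ballI allI impI)
    fix p :: "('f, 'r, nat list \<times> 'd, 'a) cform" and g :: "nat \<Rightarrow> nat"
    assume p: "p \<in> cforms L C (UNIV \<times> D)" and g: "strict_mono g"
    have "holds M B (relabel g (ren code p)) \<longleftrightarrow> holds M B (ren code p)"
      using g by (intro inv[OF cf[OF p]]) (auto simp: monotone_on_def strict_mono_def)
    moreover have "holds M B (relabel g (ren code p)) \<longleftrightarrow> holds M (fam b (lv g)) p"
      unfolding holds_ren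
    proof (rule holds_cong)
      fix z assume "z \<in> vars p"
      then obtain \<eta> j where "z = (\<eta>, j)" "j \<in> D" using vars_cforms[OF p] by auto
      then show "(B \<circ> apfst (map g) \<circ> code) z = fam b (lv g) z"
        using moved[OF g] by (simp add: code_def fam_def del: upt_Suc)
    qed
    ultimately show "holds M (fam b (lv g)) p \<longleftrightarrow> holds M (fam b id) p" unfolding fam_b by blast
  qed
  moreover have "lv_based b a"
    unfolding lv_based_def fam_b
  proof (intro ballI impI)
    fix p :: "('f, 'r, nat list \<times> 'd, 'a) cform"
    assume p: "p \<in> cforms L C (UNIV \<times> D)" and hyp: "\<forall>g. strict_mono g \<longrightarrow> holds M (fam a (lv g)) p"
    show "holds M B (ren code p)"
    proof (rule based'[OF cf[OF p]])
      fix g :: "nat \<Rightarrow> nat" assume g: "strict_mono g"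
      have "?a \<circ> apfst (map g) \<circ> code = fam a (lv g)"
        by (auto simp: code_def fam_def lv_def simp del: upt_Suc)
      then show "holds M ?a (relabel g (ren code p))" using hyp g by (simp add: holds_ren)
    qed
  qed
  moreover have "b \<eta> j \<in> carrier M" for \<eta> j using B by (auto simp: b_def)
  ultimately show ?thesis using that by blast
qed


section \<open>Thickness\<close>

lemma indiscernible_seq_iff:
  "indiscernible_seq L M P J a \<longleftrightarrow>
    (\<forall>ks ls. sorted_wrt (<) ks \<longrightarrow> sorted_wrt (<) ls \<longrightarrow> length ks = length ls \<longrightarrow>
      (\<forall>p \<in> cforms L P (positions ks J). holds M (subtuple a ks) p \<longleftrightarrow> holds M (subtuple a ls) p))"
proof -
  have "tp L M P (positions ks J) (subtuple a ks) = tp L M P (positions ls J) (subtuple a ls) \<longleftrightarrow>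
      (\<forall>p \<in> cforms L P (positions ks J). holds M (subtuple a ks) p \<longleftrightarrow> holds M (subtuple a ls) p)"
    if "length ks = length ls" for ks ls
    using that by (simp add: tp_eq_iff)
  then show ?thesis unfolding indiscernible_seq_def by blast
qed

text \<open>\<open>thick\<close> speaks about sequences without parameters. Appending the elements
  of \<open>C\<close> to every tuple as constant coordinates turns indiscernibility over
  \<open>C\<close> into plain indiscernibility.\<close>

lemma thick_parameters:
  fixes I :: "'q set"
  assumes thick: "thick K L M" and I: "I \<prec> K"
  obtains \<Theta> where "\<Theta> \<subseteq> cforms L C ((UNIV :: nat set) \<times> I)"
    "\<And>A. (\<And>i x. A i x \<in> carrier M) \<Longrightarrow>
      (\<forall>p \<in> \<Theta>. holds M (\<lambda>(i, x). A i x) p) \<longleftrightarrow> indiscernible_seq L M C I A"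
proof -
  have "I <+> C \<prec> K" using I C(2) by (simp add: small)
  then obtain \<iota> where \<iota>: "inj_on \<iota> (I <+> C)" "\<iota> ` (I <+> C) \<subseteq> K" "\<iota> ` (I <+> C) \<prec> K"
    using small_into[OF K] by metis
  let ?Z = "\<iota> ` (I <+> C)"
  let ?inv = "inv_into (I <+> C) \<iota>"
  have inv_in: "?inv z \<in> I <+> C" if "z \<in> ?Z" for z using that by (rule inv_into_into)
  have inv_\<iota> [simp]: "x \<in> I \<Longrightarrow> ?inv (\<iota> (Inl x)) = Inl x" "c \<in> C \<Longrightarrow> ?inv (\<iota> (Inr c)) = Inr c" for x c
    using \<iota>(1) by (auto intro: inv_into_f_f)
  obtain \<Theta>\<^sub>0 where \<Theta>\<^sub>0: "\<Theta>\<^sub>0 \<subseteq> cforms L {} ((UNIV :: nat set) \<times> ?Z)"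
    "\<And>a. (\<forall>i. a i ` ?Z \<subseteq> carrier M) \<Longrightarrow>
      (\<forall>p \<in> \<Theta>\<^sub>0. holds M (\<lambda>(i, j). a i j) p) \<longleftrightarrow> indiscernible_seq L M {} ?Z a"
    using thick \<iota>(3) unfolding thick_def by meson
  define \<sigma> :: "(nat \<times> 'k) + 'a \<Rightarrow> (nat \<times> 'q) + 'a" where
    "\<sigma> = case_sum (\<lambda>(i, z). case ?inv z of Inl x \<Rightarrow> Inl (i, x) | Inr c \<Rightarrow> Inr c) Inr"
  \<comment> \<open>Parameter coordinates are constant along the sequence, so they may be taken from
    the tuple in position \<open>0\<close>; empty index lists have no such position and are treated
    separately.\<close>
  define \<tau> :: "(nat \<times> 'q) + 'a \<Rightarrow> (nat \<times> 'k) + 'a" where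
    "\<tau> = case_sum (\<lambda>(i, x). Inl (i, \<iota> (Inl x))) (\<lambda>c. Inl (0, \<iota> (Inr c)))"
  have \<sigma>_cf: "sub \<sigma> p \<in> cforms L C (N \<times> I)" if "p \<in> cforms L {} (N \<times> ?Z)" for p and N :: "nat set"
  proof -
    have "\<sigma> z \<in> (N \<times> I) <+> C" if "z \<in> symbols p" for z
    proof -
      have "z \<in> (N \<times> ?Z) <+> {}" using that \<open>p \<in> _\<close> by (auto simp: cforms_iff)
      then obtain i k where "z = Inl (i, k)" "i \<in> N" "k \<in> ?Z" by blast
      then show ?thesis using inv_in[OF \<open>k \<in> ?Z\<close>] by (auto simp: \<sigma>_def)
    qed
    then show ?thesis using that by (auto simp: cforms_iff symbols_sub)
  qed
  have \<tau>_cf: "sub \<tau> p \<in> cforms L {} (N \<times> ?Z)" if "p \<in> cforms L C (N \<times> I)" "0 \<in> N" for p and N :: "nat set"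
  proof -
    have "\<tau> z \<in> (N \<times> ?Z) <+> {}" if "z \<in> symbols p" for z
    proof -
      have "z \<in> (N \<times> I) <+> C" using that \<open>p \<in> _\<close> by (auto simp: cforms_iff)
      then show ?thesis using \<open>0 \<in> N\<close> by (auto simp: \<tau>_def)
    qed
    then show ?thesis using that by (auto simp: cforms_iff symbols_sub)
  qed
  define ext where "ext A i z = (case ?inv z of Inl x \<Rightarrow> A i x | Inr c \<Rightarrow> c)"
    for A :: "nat \<Rightarrow> 'q \<Rightarrow> 'a" and i z
  have \<sigma>_holds: "holds M (\<lambda>(m, x). A (s m) x) (sub \<sigma> p) \<longleftrightarrow> holds M (\<lambda>(m, z). ext A (s m) z) p"
    for A and s :: "nat \<Rightarrow> nat" and p
    by (rule holds_sub_cong) (auto simp: \<sigma>_def ext_def split: sum.splits)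
  have \<tau>_holds: "holds M (\<lambda>(m, z). ext A (s m) z) (sub \<tau> p) \<longleftrightarrow> holds M (\<lambda>(m, x). A (s m) x) p"
    if "p \<in> cforms L C (N \<times> I)" for A and s :: "nat \<Rightarrow> nat" and p and N :: "nat set"
  proof (rule holds_sub_cong)
    fix z assume "z \<in> symbols p"
    then have "z \<in> (N \<times> I) <+> C" using that by (auto simp: cforms_iff)
    then show "case_sum (\<lambda>(m, z). ext A (s m) z) id (\<tau> z) = case_sum (\<lambda>(m, x). A (s m) x) id z"
      by (auto simp: \<tau>_def ext_def)
  qed
  have ext_iff: "indiscernible_seq L M {} ?Z (ext A) \<longleftrightarrow> indiscernible_seq L M C I A" for A
  proof
    assume ind: "indiscernible_seq L M {} ?Z (ext A)"
    show "indiscernible_seq L M C I A"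
      unfolding indiscernible_seq_iff
    proof (intro allI impI ballI)
      fix ks ls :: "nat list" and p
      assume ks: "sorted_wrt (<) ks" "sorted_wrt (<) ls" "length ks = length ls"
        and p: "p \<in> cforms L C (positions ks I)"
      show "holds M (subtuple A ks) p \<longleftrightarrow> holds M (subtuple A ls) p"
      proof (cases "ks = []")
        case True
        then show ?thesis using ks(3) by simp
      next
        case False
        then have "sub \<tau> p \<in> cforms L {} (positions ks ?Z)" using p by (intro \<tau>_cf) auto
        then have "holds M (subtuple (ext A) ks) (sub \<tau> p) \<longleftrightarrow> holds M (subtuple (ext A) ls) (sub \<tau> p)"
          using ind ks unfolding indiscernible_seq_iff by blast
        then show ?thesis unfolding subtuple_def \<tau>_holds[OF p] .
      qed
    qed
  next
    assume ind: "indiscernible_seq L M C I A"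
    show "indiscernible_seq L M {} ?Z (ext A)"
      unfolding indiscernible_seq_iff
    proof (intro allI impI ballI)
      fix ks ls :: "nat list" and p :: "('f, 'r, nat \<times> 'k, 'a) cform"
      assume ks: "sorted_wrt (<) ks" "sorted_wrt (<) ls" "length ks = length ls"
        and p: "p \<in> cforms L {} (positions ks ?Z)"
      have "holds M (subtuple A ks) (sub \<sigma> p) \<longleftrightarrow> holds M (subtuple A ls) (sub \<sigma> p)"
        using ind ks \<sigma>_cf[OF p] unfolding indiscernible_seq_iff by blast
      then show "holds M (subtuple (ext A) ks) p \<longleftrightarrow> holds M (subtuple (ext A) ls) p"
        unfolding subtuple_def \<sigma>_holds .
    qed
  qed
  show ?thesis
  proof (rule that[of "sub \<sigma> ` \<Theta>\<^sub>0"])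
    show "sub \<sigma> ` \<Theta>\<^sub>0 \<subseteq> cforms L C ((UNIV :: nat set) \<times> I)" using \<Theta>\<^sub>0(1) \<sigma>_cf by blast
    fix A :: "nat \<Rightarrow> 'q \<Rightarrow> 'a" assume A: "\<And>i x. A i x \<in> carrier M"
    have "ext A i z \<in> carrier M" if "z \<in> ?Z" for i z
      using inv_in[OF that] A C(1) by (auto simp: ext_def)
    then have "(\<forall>p \<in> \<Theta>\<^sub>0. holds M (\<lambda>(i, j). ext A i j) p) \<longleftrightarrow> indiscernible_seq L M {} ?Z (ext A)"
      by (intro \<Theta>\<^sub>0(2)) blast
    then show "(\<forall>p \<in> sub \<sigma> ` \<Theta>\<^sub>0. holds M (\<lambda>(i, x). A i x) p) \<longleftrightarrow> indiscernible_seq L M C I A"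
      using \<sigma>_holds[of A "\<lambda>i. i"] by (simp add: ext_iff)
  qed
qed

text \<open>The tuples \<open>\<xi> i\<close> share at most the root, so the lengths of the meets and the lexicographic
  order between different tuples are determined by the lengths of their entries.\<close>

lemma indiscernible_separated:
  fixes \<xi> :: "nat \<Rightarrow> nat \<Rightarrow> nat list"
  assumes b: "level_invariant b"
    and levels: "\<And>i j. same_levels Q (\<xi> i) (\<xi> j)"
    and sep: "\<And>i j q r. i < j \<Longrightarrow> q \<in> Q \<Longrightarrow> r \<in> Q \<Longrightarrow> \<xi> i q \<noteq> [] \<Longrightarrow> \<xi> j r \<noteq> [] \<Longrightarrow> hd (\<xi> i q) < hd (\<xi> j r)"
  shows "indiscernible_seq L M C (Q \<times> D) (\<lambda>i. fam b (\<xi> i))"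
  unfolding indiscernible_seq_iff
proof (intro allI impI ballI)
  fix ks ls :: "nat list" and p
  assume ks: "sorted_wrt (<) ks" "sorted_wrt (<) ls" "length ks = length ls"
    and p: "p \<in> cforms L C (positions ks (Q \<times> D))"
  let ?assoc = "\<lambda>(m, q, j). ((m, q), j)"
  let ?p = "ren ?assoc p"
  have p': "?p \<in> cforms L C (UNIV \<times> D)"
    using vars_cforms[OF p] by (intro ren_cforms[OF p]) fastforce
  have Q: "fst ` vars ?p \<subseteq> {..<length ks} \<times> Q"
    using vars_cforms[OF p] by (fastforce simp: vars_ren)
  have len: "length (\<xi> i q) = length (\<xi> j q)" if "q \<in> Q" for i j q
    using levels[of i j] that unfolding same_levels_def by (metis mt_self)
  \<comment> \<open>Nonempty nodes of different tuples have different first entries, so they meet in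
    the root; their order depends only on which tuple is earlier and which nodes are the
    root.\<close>
  have cross: "mt (\<xi> i q) (\<xi> j r) = 0 \<and> mt (\<xi> j r) (\<xi> i q) = 0 \<and>
      (lex_less (\<xi> i q) (\<xi> j r) \<longleftrightarrow> \<xi> j r \<noteq> []) \<and> (lex_less (\<xi> j r) (\<xi> i q) \<longleftrightarrow> \<xi> j r = [] \<and> \<xi> i q \<noteq> [])"
    if "i < j" "q \<in> Q" "r \<in> Q" for i j q r
    using sep[OF that] by (cases "\<xi> i q"; cases "\<xi> j r") (auto simp: mt_Cons lex_less_Cons)
  have "same_levels ({..<length ks} \<times> Q) (\<lambda>(m, q). \<xi> (ks ! m) q) (\<lambda>(m, q). \<xi> (ls ! m) q)"
    unfolding same_levels_def
  proof (clarify, goal_cases)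
    case (1 m q m' r)
    have less: "ks ! m < ks ! m'" "ls ! m < ls ! m'" if "m < m'" "m' < length ks" for m m'
      using ks that by (simp_all add: sorted_wrt_nth_less)
    have nil: "\<xi> (ks ! m) q = [] \<longleftrightarrow> \<xi> (ls ! m') q = []" if "q \<in> Q" for q m m'
      using len[OF that] by (metis length_0_conv)
    consider "m < m'" | "m = m'" | "m' < m" by linarith
    then show ?case
    proof cases
      case 1
      then show ?thesis
        using cross[OF less(1)[OF 1]] cross[OF less(2)[OF 1]]
          nil[OF \<open>q \<in> Q\<close>, of m m] nil[OF \<open>r \<in> Q\<close>, of m' m'] \<open>m' < length ks\<close> \<open>q \<in> Q\<close> \<open>r \<in> Q\<close> by simp
    next
      case 2
      then show ?thesis
        using levels[of "ks ! m" "ls ! m"] \<open>q \<in> Q\<close> \<open>r \<in> Q\<close> unfolding same_levels_def by simp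
    next
      case 3
      then show ?thesis
        using cross[OF less(1)[OF 3]] cross[OF less(2)[OF 3]]
          nil[OF \<open>q \<in> Q\<close>, of m m] nil[OF \<open>r \<in> Q\<close>, of m' m'] \<open>m < length ks\<close> \<open>q \<in> Q\<close> \<open>r \<in> Q\<close> by simp
    qed
  qed
  then have "same_levels (fst ` vars ?p) (\<lambda>(m, q). \<xi> (ks ! m) q) (\<lambda>(m, q). \<xi> (ls ! m) q)"
    using Q unfolding same_levels_def by blast
  then have "holds M (fam b (\<lambda>(m, q). \<xi> (ks ! m) q)) ?p \<longleftrightarrow> holds M (fam b (\<lambda>(m, q). \<xi> (ls ! m) q)) ?p"
    by (rule level_invariantD[OF b p'])
  moreover have "fam b (\<lambda>(m, q). \<xi> (ns ! m) q) \<circ> ?assoc = subtuple (\<lambda>i. fam b (\<xi> i)) ns" for ns :: "nat list"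
    by (auto simp: fam_def subtuple_def)
  ultimately show "holds M (subtuple (\<lambda>i. fam b (\<xi> i)) ks) p \<longleftrightarrow> holds M (subtuple (\<lambda>i. fam b (\<xi> i)) ls) p"
    by (simp add: holds_ren)
qed

text \<open>Thickness is needed only here: it expresses the indiscernibility of the sequences of the
  previous lemma by formulas, which therefore pass from \<open>a\<close> to \<open>b\<close>. Two tuples with the same levels
  begin sequences with the same continuation.\<close>

lemma level_invariant_transfer:
  assumes thick: "thick K L M" and a: "level_invariant a" "\<And>\<eta> j. a \<eta> j \<in> carrier M"
    and b: "\<And>\<eta> j. b \<eta> j \<in> carrier M"
    and based: "lv_based b a"
  shows "level_invariant b"
  unfolding level_invariant_def
proof (intro ballI allI impI)
  fix p :: "('f, 'r, nat \<times> 'd, 'a) cform" and u w :: "nat \<Rightarrow> nat list"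
  define Q where "Q = fst ` vars p"
  assume p: "p \<in> cforms L C (UNIV \<times> D)" and "same_levels (fst ` vars p) u w"
  then have uw: "same_levels Q u w" by (simp add: Q_def)
  have Q: "finite Q" by (simp add: Q_def finite_vars)
  have pQ: "p \<in> cforms L C (Q \<times> D)"
    using vars_cforms[OF p] by (intro cforms_mono[OF p]) (force simp: Q_def)
  have "Q \<times> D \<prec> K" using Q D(1) by (simp add: small countable_finite)
  then obtain \<Theta> where \<Theta>: "\<Theta> \<subseteq> cforms L C ((UNIV :: nat set) \<times> (Q \<times> D))"
    "\<And>A. (\<And>i x. A i x \<in> carrier M) \<Longrightarrow>
      (\<forall>p \<in> \<Theta>. holds M (\<lambda>(i, x). A i x) p) \<longleftrightarrow> indiscernible_seq L M C (Q \<times> D) A"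
    using thick_parameters[OF thick] by blast
  have seq: "holds M (fam b (\<xi> 0)) p \<longleftrightarrow> holds M (fam b (\<xi> 1)) p"
    if levels: "\<And>i j. same_levels Q (\<xi> i) (\<xi> j)"
      and sep: "\<And>i j q r. i < j \<Longrightarrow> q \<in> Q \<Longrightarrow> r \<in> Q \<Longrightarrow> \<xi> i q \<noteq> [] \<Longrightarrow> \<xi> j r \<noteq> [] \<Longrightarrow> hd (\<xi> i q) < hd (\<xi> j r)"
    for \<xi> :: "nat \<Rightarrow> nat \<Rightarrow> nat list"
  proof -
    \<comment> \<open>Coordinate \<open>j\<close> at \<open>q\<close> in the tuple \<open>i\<close>
      becomes a coordinate of the node \<open>\<xi> i q\<close>, so that a formula of
      \<open>\<Theta>\<close> speaks about the tree and \<open>lv_based\<close> applies.\<close>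
    let ?\<rho> = "\<lambda>(i, q, j). (\<xi> i q, j)"
    have "holds M (\<lambda>(i, x). fam b (\<xi> i) x) \<theta>" if \<theta>: "\<theta> \<in> \<Theta>" for \<theta>
    proof -
      have \<theta>': "\<theta> \<in> cforms L C (UNIV \<times> (Q \<times> D))" using \<theta> \<Theta>(1) by blast
      have "ren ?\<rho> \<theta> \<in> cforms L C (UNIV \<times> D)"
        using vars_cforms[OF \<theta>'] by (intro ren_cforms[OF \<theta>']) fastforce
      moreover have "\<forall>g. strict_mono g \<longrightarrow> holds M (fam a (lv g)) (ren ?\<rho> \<theta>)"
      proof (intro allI impI)
        fix g :: "nat \<Rightarrow> nat" assume g: "strict_mono g"
        have "indiscernible_seq L M C (Q \<times> D) (\<lambda>i. fam (a \<circ> lv g) (\<xi> i))"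
          by (rule indiscernible_separated[OF level_invariant_lv[OF a(1) g] levels sep])
        then have "holds M (\<lambda>(i, x). fam (a \<circ> lv g) (\<xi> i) x) \<theta>"
          using \<Theta>(2)[of "\<lambda>i. fam (a \<circ> lv g) (\<xi> i)"] a(2) \<theta> by (auto simp: fam_def)
        moreover have "fam a (lv g) \<circ> ?\<rho> = (\<lambda>(i, x). fam (a \<circ> lv g) (\<xi> i) x)"
          by (auto simp: fam_def)
        ultimately show "holds M (fam a (lv g)) (ren ?\<rho> \<theta>)" by (simp add: holds_ren)
      qed
      ultimately have "holds M (fam b id) (ren ?\<rho> \<theta>)"
        using based unfolding lv_based_def by blast
      moreover have "fam b id \<circ> ?\<rho> = (\<lambda>(i, x). fam b (\<xi> i) x)" by (auto simp: fam_def)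
      ultimately show ?thesis by (simp add: holds_ren)
    qed
    then have "indiscernible_seq L M C (Q \<times> D) (\<lambda>i. fam b (\<xi> i))"
      using \<Theta>(2)[of "\<lambda>i. fam b (\<xi> i)"] b by (auto simp: fam_def)
    moreover have "ren (\<lambda>x. (0, x)) p \<in> cforms L C (positions [n] (Q \<times> D))" for n :: nat
      using vars_cforms[OF pQ] by (intro ren_cforms[OF pQ]) auto
    ultimately have "holds M (subtuple (\<lambda>i. fam b (\<xi> i)) [0]) (ren (\<lambda>x. (0, x)) p) \<longleftrightarrow>
        holds M (subtuple (\<lambda>i. fam b (\<xi> i)) [1]) (ren (\<lambda>x. (0, x)) p)"
      unfolding indiscernible_seq_iff by (metis length_Cons list.size(3) sorted_wrt1)
    moreover have "subtuple (\<lambda>i. fam b (\<xi> i)) [n] \<circ> (\<lambda>x. (0, x)) = fam b (\<xi> n)" for n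
      by (auto simp: subtuple_def)
    ultimately show ?thesis by (simp add: holds_ren)
  qed
  obtain N where N: "\<And>q. q \<in> Q \<Longrightarrow> hd (u q) < N" "\<And>q. q \<in> Q \<Longrightarrow> hd (w q) < N"
  proof -
    have "finite ((hd \<circ> u) ` Q \<union> (hd \<circ> w) ` Q)" using Q by simp
    then obtain N where "\<forall>n \<in> (hd \<circ> u) ` Q \<union> (hd \<circ> w) ` Q. n < N"
      by (meson finite_nat_set_iff_bounded)
    then show ?thesis using that[of N] by simp
  qed
  have moved: "holds M (fam b v) p \<longleftrightarrow> holds M (fam b (shift N \<circ> u)) p"
    if v: "same_levels Q v u" "\<And>q. q \<in> Q \<Longrightarrow> hd (v q) < N" for v
  proof -
    \<comment> \<open>From index \<open>1\<close> on the sequence does not depend on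
      \<open>v\<close>; used for \<open>u\<close> and for \<open>w\<close>, it links both to
      \<open>shift N \<circ> u\<close>. Multiples of \<open>N\<close> keep the first entries of
      different tuples apart.\<close>
    define \<xi> where "\<xi> i = (if i = 0 then v else shift (N * i) \<circ> u)" for i :: nat
    have "same_levels Q (\<xi> i) u" for i using v(1) by (simp add: \<xi>_def same_levels_shift)
    then have levels: "same_levels Q (\<xi> i) (\<xi> j)" for i j unfolding same_levels_def by metis
    have hd_shift: "hd (shift n \<eta>) = hd \<eta> + n" if "shift n \<eta> \<noteq> []" for n \<eta> using that by (cases \<eta>) auto
    have "hd (\<xi> i q) < hd (\<xi> j r)"
      if "i < j" "q \<in> Q" "r \<in> Q" "\<xi> i q \<noteq> []" "\<xi> j r \<noteq> []" for i j q r
    proof -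
      have "hd (\<xi> i q) < N * Suc i"
        using v(2) N(1) that hd_shift[of "N * i" "u q"] by (auto simp: \<xi>_def split: if_splits)
      also have "\<dots> \<le> N * j" using that(1) by (intro mult_le_mono2) simp
      also have "\<dots> \<le> hd (\<xi> j r)" using that hd_shift[of "N * j" "u r"] by (auto simp: \<xi>_def)
      finally show ?thesis .
    qed
    then show ?thesis using seq[of \<xi>, OF levels] by (simp add: \<xi>_def)
  qed
  have "same_levels Q u u" by (simp add: same_levels_def)
  then show "holds M (fam b u) p \<longleftrightarrow> holds M (fam b w) p"
    using moved[of u] moved[OF same_levels_sym[OF uw]] N by blast
qed

text \<open>Level maps bring two tuples of the same shape to the same levels; level invariance
  compares the images, and invariance under level maps removes the maps again. As level maps
  preserve shapes, basedness through them implies \<open>shape_based\<close>.\<close>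

lemma shape_invariant_exists:
  assumes thick: "thick K L M" and a: "\<And>\<eta> j. a \<eta> j \<in> carrier M"
  obtains b where "\<And>\<eta> j. b \<eta> j \<in> carrier M" "shape_based b a" "shape_invariant b"
proof -
  obtain a' where a': "\<And>\<eta> j. a' \<eta> j \<in> carrier M" "level_invariant a'" "shape_based a' a"
    by (rule level_invariant_exists[of a, OF a]) (rule that, blast+)
  obtain b where b: "\<And>\<eta> j. b \<eta> j \<in> carrier M" and inv: "lv_invariant b" and based: "lv_based b a'"
    by (rule lv_invariant_exists[of a', OF a'(1)]) (rule that, blast+)
  have lev: "level_invariant b" by (rule level_invariant_transfer[OF thick a'(2,1) b based])
  have node: "ren (apfst u) p \<in> cforms L C (UNIV \<times> D)" if "p \<in> cforms L C (Q \<times> D)"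
    for u :: "nat \<Rightarrow> nat list" and p and Q :: "nat set"
    using vars_cforms[OF that] by (intro ren_cforms[OF that]) fastforce
  have "shape_based b a'"
    unfolding shape_based_def
  proof (intro allI impI ballI)
    fix Q :: "nat set" and p :: "('f, 'r, nat \<times> 'd, 'a) cform" and u
    assume p: "p \<in> cforms L C (Q \<times> D)" and hyp: "\<forall>u'. same_shape Q u' u \<longrightarrow> holds M (fam a' u') p"
    have "holds M (fam a' (lv g)) (ren (apfst u) p)" if "strict_mono g" for g
      using hyp same_shape_lv[OF that, of Q u] by (simp add: fam_ren)
    then have "holds M (fam b id) (ren (apfst u) p)"
      using based node[OF p] unfolding lv_based_def by blast
    then show "holds M (fam b u) p" by (simp add: fam_ren)
  qed
  then have "shape_based b a" using a'(3) shape_based_trans by blast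
  moreover have "shape_invariant b"
    unfolding shape_invariant_def
  proof (intro allI impI ballI)
    fix Q :: "nat set" and p :: "('f, 'r, nat \<times> 'd, 'a) cform" and u w
    assume Q: "finite Q" and p: "p \<in> cforms L C (Q \<times> D)" and uw: "same_shape Q u w"
    obtain g g' where g: "strict_mono g" "strict_mono g'" "same_levels Q (lv g \<circ> u) (lv g' \<circ> w)"
      using same_shape_levels[OF Q uw] .
    have move: "holds M (fam b (lv h \<circ> v)) p \<longleftrightarrow> holds M (fam b v) p" if "strict_mono h"
      for h and v :: "nat \<Rightarrow> nat list"
    proof -
      have "holds M (fam b (lv h)) (ren (apfst v) p) \<longleftrightarrow> holds M (fam b id) (ren (apfst v) p)"
        using inv node[OF p] that unfolding lv_invariant_def by blast
      then show ?thesis by (simp add: fam_ren)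
    qed
    have "fst ` vars p \<subseteq> Q" using vars_cforms[OF p] by auto
    then have "same_levels (fst ` vars p) (lv g \<circ> u) (lv g' \<circ> w)"
      using g(3) unfolding same_levels_def by blast
    moreover have "p \<in> cforms L C (UNIV \<times> D)"
      using vars_cforms[OF p] by (intro cforms_mono[OF p]) auto
    ultimately have "holds M (fam b (lv g \<circ> u)) p \<longleftrightarrow> holds M (fam b (lv g' \<circ> w)) p"
      using lev unfolding level_invariant_def by blast
    then show "holds M (fam b u) p \<longleftrightarrow> holds M (fam b w) p" using move g by blast
  qed
  ultimately show ?thesis using that b by blast
qed

end

theorem theorem1p1:
  fixes K :: "'k set" and L :: "('f, 'r) lang" and T :: "('f, 'r) hsent set"
    and M :: "('a, 'f, 'r) struc" and C :: "'a set" and J :: "'j set"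
    and a :: "nat list \<Rightarrow> 'j \<Rightarrow> 'a"
  assumes "positive_theory L T"
    and "monster K L T M"
    and "thick K L M"
    and "J \<prec> K"
    and "\<And>\<eta>. a \<eta> ` J \<subseteq> carrier M"
    and "C \<subseteq> carrier M" and "C \<prec> K"
  shows "\<exists>b :: nat list \<Rightarrow> 'j \<Rightarrow> 'a.
    (\<forall>\<eta>. b \<eta> ` J \<subseteq> carrier M) \<and> str_indiscernible L M C J b \<and> EM_str_based L M C J b a"
proof (cases "J = {}")
  case True
  \<comment> \<open>Without coordinates there are no variables, so \<open>a\<close> itself serves.
    The case is separate because the completeness argument needs a variable to receive the
    additional free variables of a contradicting formula.\<close>
  have "holds M v p \<longleftrightarrow> holds M w p" if "p \<in> cforms L C {}" for v w :: "nat \<times> 'j \<Rightarrow> 'a" and p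
    using vars_cforms[OF that] by (intro holds_cong) auto
  then have "str_indiscernible L M C J a"
    unfolding str_indiscernible_def indiscernible_def by (simp add: True tp_eq_iff)
  moreover have "EM_str_based L M C J a a"
    by (auto simp: EM_str_based_def EM_based_def EM_type_def)
  ultimately show ?thesis using True by blast
next
  case False
  interpret monster_model K L T M by (rule monster_model.intro) (fact assms)+
  interpret skeleton K L T M C J
    by (rule skeleton.intro[OF monster_model_axioms skeleton_axioms.intro]) (fact assms False)+
  obtain d where d: "d \<in> carrier M" using carrier_nonempty by blast
  \<comment> \<open>A default outside \<open>J\<close> keeps all values in the model, as
    \<open>realizes\<close> demands of total families.\<close>
  define a' where "a' \<eta> j = (if j \<in> J then a \<eta> j else d)" for \<eta> j
  have a': "a' \<eta> j \<in> carrier M" for \<eta> j using assms(5) d by (auto simp: a'_def)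
  obtain b where b: "\<And>\<eta> j. b \<eta> j \<in> carrier M" "shape_based b a'" "shape_invariant b"
    by (rule shape_invariant_exists[of a', OF assms(3) a']) (rule that, blast+)
  have "str_indiscernible L M C J b"
    unfolding str_indiscernible_def indiscernible_def
  proof (intro ballI impI)
    fix \<eta>s \<nu>s assume "qftp L_str str_tree \<eta>s = qftp L_str str_tree \<nu>s"
    then have len: "length \<eta>s = length \<nu>s" and shape: "same_shape {..<length \<eta>s} ((!) \<eta>s) ((!) \<nu>s)"
      unfolding qftp_str_tree_iff by blast+
    have "holds M (fam b ((!) \<eta>s)) p \<longleftrightarrow> holds M (fam b ((!) \<nu>s)) p"
      if "p \<in> cforms L C (positions \<eta>s J)" for p
      using b(3) that shape finite_lessThan unfolding shape_invariant_def by blast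
    then show "tp L M C (positions \<eta>s J) (subtuple b \<eta>s) = tp L M C (positions \<nu>s J) (subtuple b \<nu>s)"
      by (simp add: tp_eq_iff subtuple_fam flip: len)
  qed
  moreover have "holds M (subtuple b \<nu>s) p"
    if eq: "qftp L_str str_tree \<nu>s = qftp L_str str_tree \<eta>s" and p: "p \<in> cforms L C (positions \<eta>s J)"
      and EM: "\<And>\<nu>s. qftp L_str str_tree \<nu>s = qftp L_str str_tree \<eta>s \<Longrightarrow> holds M (subtuple a \<nu>s) p"
    for \<eta>s \<nu>s p
  proof -
    let ?n = "length \<nu>s"
    have n: "?n = length \<eta>s" using eq by (simp add: qftp_str_tree_iff)
    have "holds M (fam a' u) p" if u: "same_shape {..<?n} u ((!) \<nu>s)" for u
    proof -
      let ?us = "map u [0..<?n]"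
      have "same_shape {..<?n} ((!) ?us) ((!) \<nu>s)" using u by (simp add: same_shape_def)
      then have "qftp L_str str_tree ?us = qftp L_str str_tree \<nu>s" by (simp add: qftp_str_tree_iff)
      then have "holds M (subtuple a ?us) p" using EM eq by simp
      moreover have "holds M (subtuple a ?us) p \<longleftrightarrow> holds M (fam a' u) p"
        using vars_cforms[OF p] n by (intro holds_cong) (auto simp: subtuple_def fam_def a'_def)
      ultimately show ?thesis by simp
    qed
    moreover have "p \<in> cforms L C ({..<?n} \<times> J)" using p n by simp
    ultimately have "holds M (fam b ((!) \<nu>s)) p"
      using b(2) unfolding shape_based_def by blast
    then show ?thesis by (simp add: subtuple_fam)
  qed
  then have "EM_str_based L M C J b a"
    unfolding EM_str_based_def EM_based_def EM_type_def by (fastforce simp: str_tree_def)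
  ultimately show ?thesis using b(1) by blast
qed

end
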